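(* Let $H$ be a Hilbert space and let $A : D(A) \subset H \to H$ be the infinitesimal generator of a $C_0$-group $(T(t))_{t \in \mathbb{R}}$ on $H$. Denote the eigenvalues of $A$ by $\lambda_n$, $n\in\mathbb{N}$ (counted with multiplicity), and let $K$ be a positive integer. Suppose that the following two conditions hold: 1. the span of the (generalized) eigenvectors of $A$ is dense in $H$; 2. the eigenvalues $\{\lambda_n\}$ (counted with multiplicity) can be decomposed into $K$ sets, each of which has a uniform gap. Then there are spectral projections $P_n$, $n \in \mathbb{N}$, of $A$ such that 1. $\sum_n P_n = I$, i.e., for every $x\in H$ there holds $\lim_{N\rightarrow \infty} \sum_{n=1}^N P_n x = x$; 2. the dimension of the range of $P_n$ is at most $K$ for every $n\in\mathbb{N}$; 3. the family of projections $\{P_n, n \in \mathbb{N}\}$ is a Riesz family.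
   Context: A $C_0$-group on $H$ is a strongly continuous one-parameter group of bounded operators $(T(t))_{t\in\mathbb{R}}$; its infinitesimal generator is the (in general unbounded) operator $A$ given by $Ax=\lim_{t\to 0} t^{-1}(T(t)x-x)$ on the domain $D(A)$ of those $x$ for which the limit exists. Generalized eigenvectors for an eigenvalue $\lambda$ are vectors $\phi_0, \phi_1, \dots, \phi_j \in D(A)$ with $\phi_0\neq 0$, $A\phi_0=\lambda\phi_0$ and $(A-\lambda)\phi_i=\phi_{i-1}$ for $1\le i\le j$. Eigenvalues are counted with (algebraic) multiplicity, i.e. each eigenvalue is repeated as many times as the dimension of the space spanned by its (generalized) eigenvectors. A set (family) $\{\lambda_n\}_{n\in I}$ of eigenvalues, counted with multiplicity, has a uniform gap if $\inf_{n\neq m,\ n,m\in I}|\lambda_n-\lambda_m|>0$; in particular no value is repeated within such a set. A spectral projection of $A$ is the spectral (Riesz) projection associated to a set $\sigma$ of eigenvalues of $A$; for a finite set $\sigma$ of isolated points of the spectrum of $A$ it is $P=\frac{1}{2\pi i}\oint_{\mathcal C}(zI-A)^{-1}\,dz$, where $\mathcal C$ is a finite union of positively oriented closed curves in the resolvent set enclosing exactly the points of $\sigma$ and no other point of the spectrum of $A$. A family of projections $\{P_n, n \in \mathbb{N}\}$ on $H$ is a Riesz family if there exist (positive) constants $m_1$ and $M_1$ such that $$ m_1 \|x\|^2 \leq \sum_{n} \|P_n x\|^2 \leq M_1 \|x\|^2 \quad\text{for all } x \in H.$$ *)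

theory Defs
  imports "HOL-Complex_Analysis.Complex_Analysis"
begin

text \<open>The libraries have no complex Hilbert spaces. The inner product is linear in its first
  argument; the real scalar multiplication and the norm are those induced by the complex
  structure.\<close>

class complex_hilbert_space = banach +
  fixes scaleC :: "complex \<Rightarrow> 'a \<Rightarrow> 'a" (infixr "*\<^sub>C" 75)
    and cinner :: "'a \<Rightarrow> 'a \<Rightarrow> complex"
  assumes scaleC_add_right: "a *\<^sub>C (x + y) = a *\<^sub>C x + a *\<^sub>C y"
    and scaleC_add_left: "(a + b) *\<^sub>C x = a *\<^sub>C x + b *\<^sub>C x"
    and scaleC_scaleC: "a *\<^sub>C (b *\<^sub>C x) = (a * b) *\<^sub>C x"
    and scaleC_one: "1 *\<^sub>C x = x"
    and scaleR_scaleC: "r *\<^sub>R x = complex_of_real r *\<^sub>C x"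
    and cinner_commute: "cinner x y = cnj (cinner y x)"
    and cinner_add_left: "cinner (x + y) z = cinner x z + cinner y z"
    and cinner_scaleC_left: "cinner (a *\<^sub>C x) y = a * cinner x y"
    and cinner_self: "cinner x x = complex_of_real ((norm x)\<^sup>2)"

global_interpretation complex_vector:
  vector_space "scaleC :: complex \<Rightarrow> 'a \<Rightarrow> 'a::complex_hilbert_space"
  by unfold_locales (simp_all add: scaleC_add_right scaleC_add_left scaleC_scaleC scaleC_one)

abbreviation cspan :: "'a::complex_hilbert_space set \<Rightarrow> 'a set"
  where "cspan \<equiv> complex_vector.span"

abbreviation cdim :: "'a::complex_hilbert_space set \<Rightarrow> nat"
  where "cdim \<equiv> complex_vector.dim"

text \<open>\<^term>\<open>cdim S\<close> is \<open>0\<close> when \<open>S\<close> spans an infinite-dimensional space, so it is only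
  meaningful together with the following predicate.\<close>

definition cfinite_dim :: "'a::complex_hilbert_space set \<Rightarrow> bool"
  where "cfinite_dim S \<longleftrightarrow> (\<exists>B. finite B \<and> S \<subseteq> cspan B)"

definition bounded_clinear ::
    "('a::complex_hilbert_space \<Rightarrow> 'b::complex_hilbert_space) \<Rightarrow> bool"
  where "bounded_clinear f \<longleftrightarrow> bounded_linear f \<and> (\<forall>c x. f (c *\<^sub>C x) = c *\<^sub>C f x)"

definition C0_group :: "(real \<Rightarrow> 'a::complex_hilbert_space \<Rightarrow> 'a) \<Rightarrow> bool"
  where "C0_group T \<longleftrightarrow>
    (\<forall>t. bounded_clinear (T t)) \<and> T 0 = id \<and> (\<forall>s t. T (s + t) = T s \<circ> T t) \<and>
    (\<forall>x. continuous_on UNIV (\<lambda>t. T t x))"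

text \<open>An unbounded operator is given by its domain \<open>D\<close> and a function \<open>A\<close> whose values outside
  \<open>D\<close> are irrelevant.\<close>

definition is_generator ::
    "(real \<Rightarrow> 'a::complex_hilbert_space \<Rightarrow> 'a) \<Rightarrow> 'a set \<Rightarrow> ('a \<Rightarrow> 'a) \<Rightarrow> bool"
  where "is_generator T D A \<longleftrightarrow>
    D = {x. \<exists>y. ((\<lambda>t. (1 / t) *\<^sub>R (T t x - x)) \<longlongrightarrow> y) (at 0)} \<and>
    (\<forall>x\<in>D. ((\<lambda>t. (1 / t) *\<^sub>R (T t x - x)) \<longlongrightarrow> A x) (at 0))"

definition eigenvalues :: "'a::complex_hilbert_space set \<Rightarrow> ('a \<Rightarrow> 'a) \<Rightarrow> complex set"
  where "eigenvalues D A = {\<mu>. \<exists>\<phi>\<in>D. \<phi> \<noteq> 0 \<and> A \<phi> = \<mu> *\<^sub>C \<phi>}"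

definition gen_eigenvectors ::
    "'a::complex_hilbert_space set \<Rightarrow> ('a \<Rightarrow> 'a) \<Rightarrow> complex \<Rightarrow> 'a set"
  where "gen_eigenvectors D A \<mu> =
    {v. \<exists>(\<phi> :: nat \<Rightarrow> 'a) j. v = \<phi> j \<and> (\<forall>i\<le>j. \<phi> i \<in> D) \<and> \<phi> 0 \<noteq> 0 \<and> A (\<phi> 0) = \<mu> *\<^sub>C \<phi> 0 \<and>
       (\<forall>i\<in>{1..j}. A (\<phi> i) - \<mu> *\<^sub>C \<phi> i = \<phi> (i - 1))}"

text \<open>\<open>lam\<close> lists the eigenvalues of \<open>A\<close>, each one as often as its algebraic multiplicity. A
  number that is not an eigenvalue has no generalized eigenvectors, hence dimension \<open>0\<close>,
  and is not listed.\<close>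

definition lists_eigenvalues ::
    "'a::complex_hilbert_space set \<Rightarrow> ('a \<Rightarrow> 'a) \<Rightarrow> (nat \<Rightarrow> complex) \<Rightarrow> bool"
  where "lists_eigenvalues D A lam \<longleftrightarrow>
    (\<forall>\<mu>. if cfinite_dim (cspan (gen_eigenvectors D A \<mu>))
         then finite {n. lam n = \<mu>} \<and> card {n. lam n = \<mu>} = cdim (cspan (gen_eigenvectors D A \<mu>))
         else infinite {n. lam n = \<mu>})"

text \<open>The infimum is taken in the extended reals, so that a family with at most one member has a
  uniform gap.\<close>

definition uniform_gap :: "(nat \<Rightarrow> complex) \<Rightarrow> nat set \<Rightarrow> bool"
  where "uniform_gap lam I \<longleftrightarrow>
    0 < (INF (n, m) \<in> {(n, m). n \<in> I \<and> m \<in> I \<and> n \<noteq> m}. ereal (cmod (lam n - lam m)))"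

definition resolvent ::
    "'a::complex_hilbert_space set \<Rightarrow> ('a \<Rightarrow> 'a) \<Rightarrow> complex \<Rightarrow> 'a \<Rightarrow> 'a"
  where "resolvent D A z = inv_into D (\<lambda>x. z *\<^sub>C x - A x)"

definition resolvent_set :: "'a::complex_hilbert_space set \<Rightarrow> ('a \<Rightarrow> 'a) \<Rightarrow> complex set"
  where "resolvent_set D A =
    {z. bij_betw (\<lambda>x. z *\<^sub>C x - A x) D UNIV \<and> bounded_clinear (resolvent D A z)}"

definition spectrum :: "'a::complex_hilbert_space set \<Rightarrow> ('a \<Rightarrow> 'a) \<Rightarrow> complex set"
  where "spectrum D A = - resolvent_set D A"

text \<open>The library's \<^const>\<open>contour_integral\<close>, for vector-valued integrands.\<close>

definition vec_contour_integral ::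
    "(real \<Rightarrow> complex) \<Rightarrow> (complex \<Rightarrow> 'a::complex_hilbert_space) \<Rightarrow> 'a"
  where "vec_contour_integral \<gamma> f =
    integral {0..1} (\<lambda>t. vector_derivative \<gamma> (at t within {0..1}) *\<^sub>C f (\<gamma> t))"

definition positive_closed_curve :: "(real \<Rightarrow> complex) \<Rightarrow> bool"
  where "positive_closed_curve \<gamma> \<longleftrightarrow>
    valid_path \<gamma> \<and> simple_path \<gamma> \<and> pathfinish \<gamma> = pathstart \<gamma> \<and>
    (\<forall>z\<in>inside (path_image \<gamma>). winding_number \<gamma> z = 1)"

text \<open>The interiors of the curves are disjoint, so that no point of \<open>\<sigma>\<close> is encircled twice. The
  operator-valued integral is evaluated pointwise.\<close>

definition is_spectral_projection ::
    "'a::complex_hilbert_space set \<Rightarrow> ('a \<Rightarrow> 'a) \<Rightarrow> complex set \<Rightarrow> ('a \<Rightarrow> 'a) \<Rightarrow> bool"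
  where "is_spectral_projection D A \<sigma> P \<longleftrightarrow>
    finite \<sigma> \<and> \<sigma> \<subseteq> eigenvalues D A \<and> (\<forall>z\<in>\<sigma>. z isolated_in spectrum D A) \<and>
    (\<exists>\<Gamma>. finite \<Gamma> \<and>
       (\<forall>\<gamma>\<in>\<Gamma>. positive_closed_curve \<gamma> \<and> path_image \<gamma> \<subseteq> resolvent_set D A) \<and>
       disjoint_family_on (\<lambda>\<gamma>. inside (path_image \<gamma>)) \<Gamma> \<and>
       (\<Union>\<gamma>\<in>\<Gamma>. inside (path_image \<gamma>)) \<inter> spectrum D A = \<sigma> \<and>
       (\<forall>x. P x = (1 / (2 * of_real pi * \<i>)) *\<^sub>C
                    (\<Sum>\<gamma>\<in>\<Gamma>. vec_contour_integral \<gamma> (\<lambda>z. resolvent D A z x))))"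

definition riesz_family :: "(nat \<Rightarrow> 'a::complex_hilbert_space \<Rightarrow> 'a) \<Rightarrow> bool"
  where "riesz_family P \<longleftrightarrow>
    (\<forall>n. bounded_clinear (P n) \<and> P n \<circ> P n = P n) \<and>
    (\<exists>m\<^sub>1>0. \<exists>M\<^sub>1>0. \<forall>x. summable (\<lambda>n. (norm (P n x))\<^sup>2) \<and>
       m\<^sub>1 * (norm x)\<^sup>2 \<le> (\<Sum>n. (norm (P n x))\<^sup>2) \<and>
       (\<Sum>n. (norm (P n x))\<^sup>2) \<le> M\<^sub>1 * (norm x)\<^sup>2)"

end

theory Submission
  imports Defs
begin

text \<open>
  The proof rests on two facts: away from the eigenvalues the resolvent is uniformly bounded,
  and its values at equidistant points of a vertical line are,
  up to a fixed invertible operator, the Fourier coefficients of an orbit of the group.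

  On a generalized eigenvector \<open>w\<close> the resolvent \<open>R(z)w\<close> is a rational function that vanishes at
  infinity. Following the group over a bounded time interval gives \<open>\<parallel>R(z)w\<parallel> \<le> C\<parallel>w\<parallel>\<close> for all
  \<open>\<bar>Re z\<bar> \<ge> a\<close>, with \<open>a\<close> large and \<open>C\<close> independent of \<open>w\<close> (\<open>apriori_bound\<close>). A Blaschke product of
  the half-plane \<open>Re > - a\<close> removes the poles of a scalar function \<open>\<langle>R(z)w, y\<rangle>\<close> and has
  modulus one on the line \<open>Re = - a\<close>, so the maximum principle bounds \<open>\<langle>R(z)w, y\<rangle>\<close> by \<open>C\<parallel>w\<parallel>\<parallel>y\<parallel>\<close>
  divided by the modulus of the Blaschke product at \<open>z\<close>. A strip contains boundedly many
  eigenvalues per unit of height; this makes \<open>\<Sum> 1 / \<bar>z - \<lambda>\<^sub>n\<bar>\<^sup>2\<close> bounded and hence the Blaschke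
  products bounded below, at all points of a fixed distance from the eigenvalues and regardless of
  which finite set of zeros is used (\<open>eigenspan_resolvent_bound\<close>). Density of the generalized
  eigenvectors and closedness of \<open>A\<close> extend the bound to all vectors; in particular the spectrum
  consists of the eigenvalues (\<open>spectrum_eq\<close>).

  The eigenvalues are then partitioned into clusters of at most \<open>K\<close> members, each of which can be
  separated from all others by a circle that stays a fixed distance away from the spectrum
  (\<open>cluster_eq\<close>, \<open>circle_dist\<close>). The projections are the Riesz projections for these circles. On
  generalized eigenvectors the residue theorem evaluates them, and density transfers
  idempotence, and the bound for the rank, to the whole space.

  For the Riesz property, assign to each cluster \<open>n\<close> the nearby node \<open>\<mu>\<^sub>n = a + \<i>k\<close> with integer \<open>k\<close>.
  The resolvent identity and the bounds on the circle give \<open>\<parallel>P\<^sub>n x\<parallel> \<le> C\<parallel>R(\<mu>\<^sub>n)x\<parallel>\<close> and, conversely,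
  \<open>P\<^sub>n x = R(\<mu>\<^sub>n)u\<^sub>n\<close> with \<open>\<parallel>u\<^sub>n\<parallel> \<le> C\<parallel>P\<^sub>n x\<parallel>\<close>. Since
  \<open>(I - e\<^bsup>-2\<pi>a\<^esup> T(2\<pi>)) R(a + \<i>k)x = \<integral>\<^sub>0\<^bsup>2\<pi>\<^esup> e\<^bsup>-\<i>kt\<^esup> e\<^bsup>-at\<^esup> T(t)x dt\<close>, Bessel's inequality turns the first estimate
  into \<open>\<Sum>\<parallel>P\<^sub>n x\<parallel>\<^sup>2 \<le> C\<parallel>x\<parallel>\<^sup>2\<close> (\<open>sum_projection_sq_le\<close>), and the orthogonality of the exponentials
  turns the second into \<open>\<parallel>\<Sum> P\<^sub>n x\<parallel>\<^sup>2 \<le> C \<Sum>\<parallel>P\<^sub>n x\<parallel>\<^sup>2\<close> for finite sums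
  (\<open>norm_sum_projection_sq_le\<close>). Together they bound the partial sums, which therefore converge to
  \<open>x\<close> for every \<open>x\<close>, and yield both Riesz inequalities.
\<close>

section \<open>Complex Hilbert spaces\<close>

lemma cinner_add_right: "cinner x (y + z) = cinner x y + cinner x z"
  by (metis cinner_add_left cinner_commute complex_cnj_add)

lemma cinner_scaleC_right: "cinner x (a *\<^sub>C y) = cnj a * cinner x y"
  by (metis cinner_scaleC_left cinner_commute complex_cnj_mult)

lemma cinner_zero_left [simp]: "cinner 0 y = 0"
  by (metis add_cancel_right_right cinner_add_left)

lemma cinner_zero_right [simp]: "cinner x 0 = 0"
  by (metis add_cancel_right_right cinner_add_right)

lemma cinner_diff_left: "cinner (x - y) z = cinner x z - cinner y z"
  by (metis add_diff_cancel cinner_add_left diff_add_cancel)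

lemma cinner_diff_right: "cinner x (y - z) = cinner x y - cinner x z"
  by (metis add_diff_cancel cinner_add_right diff_add_cancel)

lemma cinner_sum_left: "cinner (sum f S) y = (\<Sum>i\<in>S. cinner (f i) y)"
  by (induction S rule: infinite_finite_induct) (auto simp: cinner_add_left)

lemma cinner_sum_right: "cinner y (sum f S) = (\<Sum>i\<in>S. cinner y (f i))"
  by (induction S rule: infinite_finite_induct) (auto simp: cinner_add_right)

lemma Re_cinner_commute: "Re (cinner x y) = Re (cinner y x)"
  by (metis cinner_commute complex_cnj cnj.simps(1))

lemma norm_scaleC: "norm (a *\<^sub>C x) = cmod a * norm x"
proof -
  have "complex_of_real ((norm (a *\<^sub>C x))\<^sup>2) = (a * cnj a) * complex_of_real ((norm x)\<^sup>2)"
    by (metis cinner_self cinner_scaleC_left cinner_scaleC_right mult.assoc)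
  also have "\<dots> = complex_of_real ((cmod a * norm x)\<^sup>2)"
    by (simp only: complex_norm_square[symmetric] of_real_mult[symmetric] power_mult_distrib)
  finally have "(norm (a *\<^sub>C x))\<^sup>2 = (cmod a * norm x)\<^sup>2"
    using of_real_eq_iff by blast
  then show ?thesis
    by (simp add: power2_eq_iff_nonneg)
qed

lemma norm_minus_scaleC_unit_sq:
  assumes "norm e = 1"
  shows "(norm (x - cinner x e *\<^sub>C e))\<^sup>2 = (norm x)\<^sup>2 - (cmod (cinner x e))\<^sup>2"
proof -
  have e: "cinner e e = 1"
    using assms by (simp add: cinner_self)
  have c: "cinner e x = cnj (cinner x e)"
    by (rule cinner_commute)
  have "complex_of_real ((norm (x - cinner x e *\<^sub>C e))\<^sup>2)
      = cinner x x - cinner x e * cnj (cinner x e)"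
    unfolding cinner_self[symmetric]
    by (simp add: cinner_diff_left cinner_diff_right cinner_scaleC_left cinner_scaleC_right e c
        algebra_simps)
  also have "\<dots> = complex_of_real ((norm x)\<^sup>2 - (cmod (cinner x e))\<^sup>2)"
    by (simp only: cinner_self of_real_diff complex_norm_square)
  finally show ?thesis
    using of_real_eq_iff by blast
qed

lemma norm_cinner_le: "cmod (cinner x y) \<le> norm x * norm y"
proof (cases "y = 0")
  case False
  define e where "e = (1 / complex_of_real (norm y)) *\<^sub>C y"
  have e1: "norm e = 1"
    using False by (simp add: e_def norm_scaleC norm_divide)
  have "0 \<le> (norm x)\<^sup>2 - (cmod (cinner x e))\<^sup>2"
    using norm_minus_scaleC_unit_sq[OF e1, of x] by (metis zero_le_power2)
  then have "cmod (cinner x e) \<le> norm x"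
    by (intro power2_le_imp_le[of "cmod (cinner x e)"]) auto
  moreover have "cmod (cinner x e) = cmod (cinner x y) / norm y"
    by (simp add: e_def cinner_scaleC_right norm_mult norm_divide)
  ultimately show ?thesis
    using False by (simp add: divide_le_eq)
qed simp

lemma bounded_bilinear_scaleC: "bounded_bilinear (scaleC :: complex \<Rightarrow> 'a::complex_hilbert_space \<Rightarrow> 'a)"
proof
  show "\<exists>K. \<forall>a (b::'a). norm (a *\<^sub>C b) \<le> norm a * norm b * K"
    by (rule exI[of _ 1]) (simp add: norm_scaleC)
qed (auto simp: scaleC_add_left scaleC_add_right scaleR_scaleC scaleC_scaleC scaleR_conv_of_real
      mult.commute)

lemma bounded_bilinear_cinner: "bounded_bilinear (cinner :: 'a::complex_hilbert_space \<Rightarrow> 'a \<Rightarrow> complex)"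
proof
  show "\<exists>K. \<forall>a (b::'a). norm (cinner a b) \<le> norm a * norm b * K"
    by (rule exI[of _ 1]) (simp add: norm_cinner_le)
qed (auto simp: cinner_add_left cinner_add_right scaleR_scaleC cinner_scaleC_left
      cinner_scaleC_right scaleR_conv_of_real)

interpretation scaleC: bounded_bilinear "scaleC :: complex \<Rightarrow> 'a::complex_hilbert_space \<Rightarrow> 'a"
  by (rule bounded_bilinear_scaleC)

interpretation cinner: bounded_bilinear "cinner :: 'a::complex_hilbert_space \<Rightarrow> 'a \<Rightarrow> complex"
  by (rule bounded_bilinear_cinner)

lemma bounded_clinear_linear: "bounded_clinear f \<Longrightarrow> bounded_linear f"
  by (simp add: bounded_clinear_def)

lemma bounded_clinear_scaleC: "bounded_clinear f \<Longrightarrow> f (c *\<^sub>C x) = c *\<^sub>C f x"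
  by (simp add: bounded_clinear_def)

text \<open>Orthogonal projections turn membership in a finite-dimensional subspace into the fixed-point
  equation of a continuous map; this is what makes such subspaces closed.\<close>

lemma orthogonal_projection_exists:
  fixes B :: "'a::complex_hilbert_space set"
  assumes "finite B"
  shows "\<exists>p. continuous_on UNIV p \<and> (\<forall>x. p x \<in> cspan B) \<and> (\<forall>x\<in>cspan B. p x = x) \<and>
    (\<forall>x. \<forall>y\<in>cspan B. cinner (x - p x) y = 0)"
  using assms
proof (induction B rule: finite_induct)
  case empty
  show ?case
    by (rule exI[of _ "\<lambda>_. 0"]) simp
next
  case (insert a B)
  then obtain p where cont: "continuous_on UNIV p" and pin: "\<And>x. p x \<in> cspan B"
    and pid: "\<And>x. x \<in> cspan B \<Longrightarrow> p x = x"
    and orth: "\<And>x y. y \<in> cspan B \<Longrightarrow> cinner (x - p x) y = 0"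
    by blast
  have sub: "cspan B \<subseteq> cspan (insert a B)"
    by (simp add: complex_vector.span_mono subset_insertI)
  have ain: "a \<in> cspan (insert a B)"
    by (simp add: complex_vector.span_base)
  show ?case
  proof (cases "p a = a")
    case True
    then have "cspan (insert a B) = cspan B"
      using pin[of a] by (simp add: complex_vector.span_redundant)
    then show ?thesis
      using cont pin pid orth by metis
  next
    case False
    define d where "d = a - p a"
    define e where "e = (1 / complex_of_real (norm d)) *\<^sub>C d"
    have d0: "d \<noteq> 0"
      using False by (simp add: d_def)
    have e1: "norm e = 1"
      using d0 by (simp add: e_def norm_scaleC norm_divide)
    have ee: "cinner e e = 1"
      using e1 by (simp add: cinner_self)
    have d: "d = complex_of_real (norm d) *\<^sub>C e"
      using d0 by (simp add: e_def scaleC_scaleC scaleC_one)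
    have ein: "e \<in> cspan (insert a B)"
      unfolding e_def d_def
      using sub pin ain by (intro complex_vector.span_scale complex_vector.span_diff) auto
    have eorth: "cinner e y = 0" if "y \<in> cspan B" for y
      using orth[OF that, of a] by (simp add: e_def d_def cinner_scaleC_left)
    have eorth': "cinner y e = 0" if "y \<in> cspan B" for y
      using eorth[OF that] cinner_commute[of y e] by simp
    define q where "q x = p x + cinner x e *\<^sub>C e" for x
    have dec: "\<exists>w c. w \<in> cspan B \<and> y = w + c *\<^sub>C e" if y: "y \<in> cspan (insert a B)" for y
    proof -
      obtain k where k: "y - k *\<^sub>C a \<in> cspan B"
        using y by (auto simp: complex_vector.span_insert)
      have "y = (y - k *\<^sub>C a + k *\<^sub>C p a) + (k * complex_of_real (norm d)) *\<^sub>C e"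
      proof -
        have "(k * complex_of_real (norm d)) *\<^sub>C e = k *\<^sub>C d"
          using d by (metis scaleC_scaleC)
        then show ?thesis
          by (simp add: d_def complex_vector.scale_right_diff_distrib)
      qed
      moreover have "y - k *\<^sub>C a + k *\<^sub>C p a \<in> cspan B"
        using k pin by (intro complex_vector.span_add complex_vector.span_scale) auto
      ultimately show ?thesis by blast
    qed
    have qorth: "cinner (x - q x) y = 0" if y: "y \<in> cspan (insert a B)" for x y
    proof -
      obtain w c where w: "w \<in> cspan B" and yw: "y = w + c *\<^sub>C e"
        using dec[OF y] by blast
      have "cinner (x - q x) w = 0"
        using orth[OF w, of x] eorth[OF w]
        by (simp add: q_def cinner_diff_left cinner_add_left cinner_scaleC_left)
      moreover have "cinner (x - q x) e = 0"
        using eorth'[OF pin, of x] ee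
        by (simp add: q_def cinner_diff_left cinner_add_left cinner_scaleC_left)
      ultimately show ?thesis
        by (simp add: yw cinner_add_right cinner_scaleC_right)
    qed
    have qin: "q x \<in> cspan (insert a B)" for x
      unfolding q_def using sub pin ein
      by (intro complex_vector.span_add complex_vector.span_scale) auto
    have "q y = y" if "y \<in> cspan (insert a B)" for y
    proof -
      have "y - q y \<in> cspan (insert a B)"
        using that qin by (intro complex_vector.span_diff)
      then have "cinner (y - q y) (y - q y) = 0"
        using qorth by blast
      then show ?thesis
        by (simp add: cinner_self)
    qed
    moreover have "continuous_on UNIV q"
      unfolding q_def by (intro continuous_intros cont scaleC.continuous_on cinner.continuous_on)
    ultimately show ?thesis
      using qin qorth by blast
  qed
qed

lemma closed_cspan_finite:
  fixes B :: "'a::complex_hilbert_space set"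
  assumes "finite B"
  shows "closed (cspan B)"
proof -
  obtain p where p: "continuous_on UNIV p" "\<And>x. p x \<in> cspan B" "\<And>x. x \<in> cspan B \<Longrightarrow> p x = x"
    using orthogonal_projection_exists[OF assms] by blast
  have "x \<in> cspan B \<longleftrightarrow> p x = x" for x
    using p(2)[of x] p(3)[of x] by metis
  then have "cspan B = {x. p x = x}"
    by blast
  moreover have "closed {x. p x = x}"
    using p(1) by (intro closed_Collect_eq) auto
  ultimately show ?thesis by simp
qed

lemma cfinite_dim_basis:
  assumes "cfinite_dim S"
  obtains B where "finite B" "B \<subseteq> S" "complex_vector.independent B" "S \<subseteq> cspan B" "card B = cdim S"
proof -
  obtain B where B: "B \<subseteq> S" "complex_vector.independent B" "S \<subseteq> cspan B" "card B = cdim S"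
    by (rule complex_vector.basis_exists)
  obtain C where "finite C" "S \<subseteq> cspan C"
    using assms by (auto simp: cfinite_dim_def)
  then have "finite B"
    using B complex_vector.independent_span_bound[of C B] by blast
  then show ?thesis
    using B that by blast
qed

lemma card_le_cdim:
  assumes "cfinite_dim S" "complex_vector.independent X" "X \<subseteq> cspan S"
  shows "finite X \<and> card X \<le> cdim S"
proof -
  obtain B where B: "finite B" "S \<subseteq> cspan B" "card B = cdim S"
    using cfinite_dim_basis[OF assms(1)] by metis
  have "X \<subseteq> cspan B"
    using assms(3) B(2) by (metis complex_vector.span_minimal complex_vector.subspace_span subset_trans)
  then show ?thesis
    using complex_vector.independent_span_bound[OF B(1) assms(2)] B(3) by simp
qed

section \<open>Groups and their generators\<close>

text \<open>Uniform boundedness on compact time intervals comes from the category argument: the closed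
  sets on which all orbits stay below a natural number exhaust the space, so one of them contains
  a ball.\<close>

lemma C0_group_bounded_on_interval:
  fixes T :: "real \<Rightarrow> 'a::complex_hilbert_space \<Rightarrow> 'a"
  assumes "C0_group T"
  shows "\<exists>M\<ge>1. \<forall>t. \<bar>t\<bar> \<le> b \<longrightarrow> (\<forall>x. norm (T t x) \<le> M * norm x)"
proof -
  have bl: "bounded_linear (T t)" and cont: "continuous_on UNIV (\<lambda>t. T t x)" for t x
    using assms by (auto simp: C0_group_def bounded_clinear_def)
  define E where "E n = {x. \<forall>t. \<bar>t\<bar> \<le> b \<longrightarrow> norm (T t x) \<le> real n}" for n
  have clo: "closed (E n)" for n
  proof -
    have "E n = (\<Inter>t\<in>{t. \<bar>t\<bar> \<le> b}. {x. norm (T t x) \<le> real n})"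
      by (auto simp: E_def)
    moreover have "closed {x. norm (T t x) \<le> real n}" for t
      using bl by (intro closed_Collect_le continuous_intros)
        (auto intro: linear_continuous_on)
    ultimately show ?thesis by auto
  qed
  have cover: "(\<Union>n. E n) = UNIV"
  proof -
    have "\<exists>n. x \<in> E n" for x
    proof -
      have "compact ((\<lambda>t. T t x) ` {-b..b})"
        using cont by (intro compact_continuous_image) (auto intro: continuous_on_subset)
      then obtain B where B: "\<And>t. t \<in> {-b..b} \<Longrightarrow> norm (T t x) \<le> B"
        by (metis bounded_iff compact_imp_bounded imageI)
      have "norm (T t x) \<le> real (nat \<lceil>B\<rceil>)" if "\<bar>t\<bar> \<le> b" for t
        using B[of t] that real_nat_ceiling_ge[of B] by (simp add: abs_le_iff)
      then show ?thesis
        by (auto simp: E_def)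
    qed
    then show ?thesis by blast
  qed
  have "\<exists>n. interior (E n) \<noteq> {}"
  proof (rule ccontr)
    assume "\<nexists>n. interior (E n) \<noteq> {}"
    then have "Met_TC.mtopology interior_of (\<Union>(range E)) = {}"
      using clo complete_UNIV
      by (intro Met_TC.metric_Baire_category_alt) (auto simp: interior_of_def interior_def)
    then have "interior (\<Union>(range E)) = {}"
      by (auto simp: interior_of_def interior_def)
    then show False
      using cover by simp
  qed
  then obtain n x0 r where r: "r > 0" "cball x0 r \<subseteq> E n"
    by (meson equals0I interior_subset mem_interior_cball)
  have "norm (T t x) \<le> (2 * real n / r + 1) * norm x" if t: "\<bar>t\<bar> \<le> b" for t x
  proof (cases "x = 0")
    case True
    then show ?thesis
      using linear_simps(3)[OF bl] by simp
  next
    case False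
    define v where "v = (r / norm x) *\<^sub>R x"
    have "norm v = r"
      using False r(1) by (simp add: v_def)
    then have "x0 + v \<in> E n" "x0 \<in> E n"
      using r by (auto simp: dist_norm subset_iff)
    then have "norm (T t (x0 + v)) \<le> n" "norm (T t x0) \<le> n"
      using t by (auto simp: E_def)
    moreover have "T t v = T t (x0 + v) - T t x0"
      by (simp add: linear_simps[OF bl])
    ultimately have "norm (T t v) \<le> 2 * n"
      using norm_triangle_ineq4[of "T t (x0 + v)" "T t x0"] by simp
    moreover have "norm (T t v) = r / norm x * norm (T t x)"
      using r(1) by (simp add: v_def linear_simps[OF bl])
    ultimately have "norm (T t x) \<le> 2 * real n / r * norm x"
      using r(1) False by (simp add: field_simps)
    then show ?thesis
      using norm_ge_zero[of x] by (simp only: distrib_right mult_1)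
  qed
  then show ?thesis
    using r(1) by (intro exI[of _ "2 * real n / r + 1"]) auto
qed

locale group_generator =
  fixes T :: "real \<Rightarrow> 'a::complex_hilbert_space \<Rightarrow> 'a" and D :: "'a set" and A :: "'a \<Rightarrow> 'a"
  assumes group: "C0_group T" and generator: "is_generator T D A"
begin

lemma T_bounded_clinear: "bounded_clinear (T t)"
  using group by (simp add: C0_group_def)

lemma T_bounded_linear: "bounded_linear (T t)"
  using T_bounded_clinear by (rule bounded_clinear_linear)

lemmas T_simps = linear_simps[OF T_bounded_linear]

lemma T_scaleC: "T t (c *\<^sub>C x) = c *\<^sub>C T t x"
  using T_bounded_clinear by (rule bounded_clinear_scaleC)

lemma T_zero: "T 0 x = x"
  using group by (simp add: C0_group_def)

lemma T_add: "T (s + t) x = T s (T t x)"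
  using group by (simp add: C0_group_def)

lemma T_continuous: "continuous_on S (\<lambda>t. T t x)"
  using group by (auto simp: C0_group_def intro: continuous_on_subset)

lemma generator_limit: "x \<in> D \<Longrightarrow> ((\<lambda>t. (1 / t) *\<^sub>R (T t x - x)) \<longlongrightarrow> A x) (at 0)"
  using generator by (simp add: is_generator_def)

lemma generator_from_limit:
  assumes "((\<lambda>t. (1 / t) *\<^sub>R (T t x - x)) \<longlongrightarrow> y) (at 0)"
  shows "x \<in> D" "A x = y"
proof -
  show "x \<in> D"
    using generator assms by (auto simp: is_generator_def)
  then show "A x = y"
    using generator_limit assms LIM_unique by blast
qed

lemma generator_add:
  assumes "x \<in> D" "y \<in> D"
  shows "x + y \<in> D" "A (x + y) = A x + A y"
proof -
  have "((\<lambda>t. (1 / t) *\<^sub>R (T t (x + y) - (x + y))) \<longlongrightarrow> A x + A y) (at 0)"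
    using tendsto_add[OF generator_limit[OF assms(1)] generator_limit[OF assms(2)]]
    by (rule back_subst[where P = "\<lambda>f. (f \<longlongrightarrow> _) _"]) (auto simp: T_simps algebra_simps)
  then show "x + y \<in> D" "A (x + y) = A x + A y"
    by (rule generator_from_limit)+
qed

lemma generator_scaleC:
  assumes "x \<in> D"
  shows "c *\<^sub>C x \<in> D" "A (c *\<^sub>C x) = c *\<^sub>C A x"
proof -
  have "((\<lambda>t. (1 / t) *\<^sub>R (T t (c *\<^sub>C x) - c *\<^sub>C x)) \<longlongrightarrow> c *\<^sub>C A x) (at 0)"
    using scaleC.tendsto[OF tendsto_const generator_limit[OF assms], of c]
    by (rule back_subst[where P = "\<lambda>f. (f \<longlongrightarrow> _) _"])
      (auto simp: T_scaleC scaleR_scaleC scaleC_scaleC complex_vector.scale_right_diff_distrib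
        mult.commute)
  then show "c *\<^sub>C x \<in> D" "A (c *\<^sub>C x) = c *\<^sub>C A x"
    by (rule generator_from_limit)+
qed

lemma generator_zero: "0 \<in> D" "A 0 = 0"
  using generator_from_limit[of 0 0] by (auto simp: T_simps)

lemma generator_diff:
  assumes "x \<in> D" "y \<in> D"
  shows "x - y \<in> D" "A (x - y) = A x - A y"
  using generator_add[OF assms(1) generator_scaleC(1)[OF assms(2), of "-1"]]
    generator_scaleC(2)[OF assms(2), of "-1"] by auto

text \<open>The group law moves the derivative at \<open>0\<close> to every other time.\<close>

lemma orbit_derivative:
  assumes "x \<in> D"
  shows "((\<lambda>t. T t x) has_vector_derivative T t (A x)) (at t within S)"
proof -
  have "((\<lambda>h. T t ((1 / h) *\<^sub>R (T h x - x))) \<longlongrightarrow> T t (A x)) (at 0)"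
    by (rule bounded_linear.tendsto[OF T_bounded_linear generator_limit[OF assms]])
  moreover have "T t ((1 / h) *\<^sub>R (T h x - x)) = (T (t + h) x - T t x) /\<^sub>R h" for h
    by (simp only: T_simps T_add inverse_eq_divide)
  ultimately have "((\<lambda>h. (T (t + h) x - T t x) /\<^sub>R h) \<longlongrightarrow> T t (A x)) (at 0)"
    by simp
  then have "((\<lambda>h. norm ((T (t + h) x - T t x) /\<^sub>R h - T t (A x))) \<longlongrightarrow> 0) (at 0)"
    by (intro tendsto_norm_zero LIM_zero)
  then have "((\<lambda>h. norm (T (t + h) x - T t x - h *\<^sub>R T t (A x)) / norm h) \<longlongrightarrow> 0) (at 0)"
  proof (rule Lim_transform_eventually)
    have "norm ((T (t + h) x - T t x) /\<^sub>R h - T t (A x))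
        = norm (T (t + h) x - T t x - h *\<^sub>R T t (A x)) / norm h" if "h \<noteq> 0" for h
    proof -
      have "(T (t + h) x - T t x) /\<^sub>R h - T t (A x)
          = (T (t + h) x - T t x - h *\<^sub>R T t (A x)) /\<^sub>R h"
        using that by (simp add: scaleR_diff_right)
      then show ?thesis
        by (simp add: divide_inverse_commute)
    qed
    then show "\<forall>\<^sub>F h in at 0. norm ((T (t + h) x - T t x) /\<^sub>R h - T t (A x))
        = norm (T (t + h) x - T t x - h *\<^sub>R T t (A x)) / norm h"
      unfolding eventually_at_filter by (intro always_eventually) blast
  qed
  then have "((\<lambda>t. T t x) has_vector_derivative T t (A x)) (at t)"
    unfolding has_vector_derivative_def has_derivative_at
    by (simp add: bounded_linear_scaleR_left)
  then show ?thesis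
    by (rule has_vector_derivative_at_within)
qed

lemma twisted_orbit_derivative:
  assumes "x \<in> D"
  shows "((\<lambda>t. exp (- (z * of_real t)) *\<^sub>C T t x) has_vector_derivative
    - (exp (- (z * of_real t)) *\<^sub>C T t (z *\<^sub>C x - A x))) (at t within S)"
proof -
  have "((\<lambda>t. exp (- (z * of_real t))) has_vector_derivative - z * exp (- (z * of_real t)))
      (at t within S)"
    by (rule has_vector_derivative_real_field) (auto intro!: derivative_eq_intros)
  from scaleC.has_vector_derivative[OF this orbit_derivative[OF assms]]
  show ?thesis
    by (simp add: T_simps T_scaleC complex_vector.scale_right_diff_distrib scaleC_scaleC mult.commute)
qed

end

section \<open>Bessel inequality and orthogonality on an interval of length \<open>2\<pi>\<close>\<close>

lemma vector_derivative_bound: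
  fixes f :: "real \<Rightarrow> 'a::real_normed_vector"
  assumes "convex S" "\<And>t. t \<in> S \<Longrightarrow> (f has_vector_derivative f' t) (at t within S)"
    "\<And>t. t \<in> S \<Longrightarrow> norm (f' t) \<le> B" "x \<in> S" "y \<in> S"
  shows "norm (f x - f y) \<le> B * \<bar>x - y\<bar>"
proof -
  have "onorm (\<lambda>h. h *\<^sub>R f' t) \<le> B" if "t \<in> S" for t
  proof (rule onorm_bound)
    show "0 \<le> B"
      using assms(3)[OF that] norm_ge_zero order_trans by blast
    show "norm (h *\<^sub>R f' t) \<le> B * norm h" for h
      using mult_left_mono[OF assms(3)[OF that], of "\<bar>h\<bar>"] by (simp add: mult.commute)
  qed
  then show ?thesis
    using differentiable_bound[OF assms(1) _ _ assms(4,5), of f "\<lambda>t h. h *\<^sub>R f' t" B] assms(2)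
    by (auto simp: has_vector_derivative_def)
qed

lemma norm_sum_sq_le:
  fixes f :: "'i \<Rightarrow> 'b::real_normed_vector"
  shows "(norm (\<Sum>i\<in>I. f i))\<^sup>2 \<le> real (card I) * (\<Sum>i\<in>I. (norm (f i))\<^sup>2)"
proof -
  have "(norm (\<Sum>i\<in>I. f i))\<^sup>2 \<le> (\<Sum>i\<in>I. norm (f i))\<^sup>2"
    by (intro power_mono norm_sum) auto
  also have "\<dots> \<le> real (card I) * (\<Sum>i\<in>I. (norm (f i))\<^sup>2)"
    using sum_squared_le_sum_of_squares[of "\<lambda>i. norm (f i)" I] by (simp only: mult.commute)
  finally show ?thesis .
qed

text \<open>The variance of \<open>\<parallel>f\<parallel>\<close> over the interval is nonnegative.\<close>

lemma norm_integral_sq_le: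
  fixes f :: "real \<Rightarrow> 'a::banach"
  assumes "continuous_on {0..b} f" "b > 0"
  shows "(norm (integral {0..b} f))\<^sup>2 \<le> b * integral {0..b} (\<lambda>t. (norm (f t))\<^sup>2)"
proof -
  define I where "I = integral {0..b} (\<lambda>t. norm (f t))"
  have int: "(\<lambda>t. norm (f t)) integrable_on {0..b}" "(\<lambda>t. (norm (f t))\<^sup>2) integrable_on {0..b}"
    by (intro integrable_continuous_real continuous_intros assms(1))+
  have "norm (integral {0..b} f) \<le> I"
    unfolding I_def using int(1) assms(1)
    by (intro integral_norm_bound_integral integrable_continuous_real) (auto intro: continuous_intros)
  then have le: "(norm (integral {0..b} f))\<^sup>2 \<le> I\<^sup>2"
    by (simp add: power_mono)
  have "((\<lambda>t. (norm (f t))\<^sup>2 - 2 * (I / b) * norm (f t) + (I / b)\<^sup>2) has_integral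
      integral {0..b} (\<lambda>t. (norm (f t))\<^sup>2) - 2 * (I / b) * I + b * (I / b)\<^sup>2) {0..b}"
    unfolding I_def using int has_integral_const_real[of "(I / b)\<^sup>2" 0 b] assms(2)
    by (intro has_integral_add has_integral_diff has_integral_mult_right integrable_integral)
      (auto simp: I_def)
  moreover have "(norm (f t))\<^sup>2 - 2 * (I / b) * norm (f t) + (I / b)\<^sup>2 \<ge> 0" for t
    using zero_le_power2[of "norm (f t) - I / b"] by (simp add: power2_diff algebra_simps)
  ultimately have "0 \<le> integral {0..b} (\<lambda>t. (norm (f t))\<^sup>2) - 2 * (I / b) * I + b * (I / b)\<^sup>2"
    by (rule has_integral_nonneg)
  then have "I\<^sup>2 \<le> b * integral {0..b} (\<lambda>t. (norm (f t))\<^sup>2)"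
    using assms(2) by (simp add: power2_eq_square field_simps)
  with le show ?thesis by linarith
qed

lemma has_integral_exp_int:
  "((\<lambda>t. exp (\<i> * of_int m * of_real t)) has_integral (if m = 0 then 2 * pi else 0)) {0..2*pi}"
proof (cases "m = 0")
  case True
  then show ?thesis
    using has_integral_const_real[of "1::complex" 0 "2 * pi"] by (simp add: scaleR_conv_of_real)
next
  case False
  have "((\<lambda>t. exp (\<i> * of_int m * of_real t)) has_integral
      exp (\<i> * of_int m * of_real (2 * pi)) / (\<i> * of_int m)
      - exp (\<i> * of_int m * of_real 0) / (\<i> * of_int m)) {0..2*pi}"
    using False
    by (intro fundamental_theorem_of_calculus has_vector_derivative_real_field)
      (auto intro!: derivative_eq_intros)
  moreover have "exp (\<i> * of_int m * of_real (2 * pi)) = 1"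
    by (simp add: exp_eq_1 mult.commute mult.left_commute)
  ultimately show ?thesis
    using False by simp
qed

lemma has_integral_norm_trigonometric_sq:
  fixes u :: "'i \<Rightarrow> 'a::complex_hilbert_space" and m :: "'i \<Rightarrow> int"
  assumes "finite F" "inj_on m F"
  shows "((\<lambda>t. (norm (\<Sum>k\<in>F. exp (\<i> * of_int (m k) * of_real t) *\<^sub>C u k))\<^sup>2) has_integral
    2 * pi * (\<Sum>k\<in>F. (norm (u k))\<^sup>2)) {0..2*pi}"
proof -
  define e where "e k t = exp (\<i> * of_int (m k) * complex_of_real t)" for k t
  have e: "e k t * cnj (e l t) = exp (\<i> * of_int (m k - m l) * of_real t)" for k l t
    by (simp add: e_def exp_cnj exp_add[symmetric] algebra_simps)
  have eq: "complex_of_real ((norm (\<Sum>k\<in>F. e k t *\<^sub>C u k))\<^sup>2)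
      = (\<Sum>k\<in>F. \<Sum>l\<in>F. exp (\<i> * of_int (m k - m l) * of_real t) * cinner (u k) (u l))" for t
    unfolding cinner_self[symmetric] e[symmetric] cinner_sum_left cinner_sum_right
      cinner_scaleC_left cinner_scaleC_right sum_distrib_left
    by (subst sum.swap) (simp only: mult_ac)
  have "((\<lambda>t. \<Sum>k\<in>F. \<Sum>l\<in>F. exp (\<i> * of_int (m k - m l) * of_real t) * cinner (u k) (u l))
      has_integral (\<Sum>k\<in>F. \<Sum>l\<in>F. (if m k - m l = 0 then 2 * pi else 0) * cinner (u k) (u l)))
      {0..2*pi}"
    by (intro has_integral_sum assms(1) has_integral_mult_left has_integral_exp_int)
  also have "(\<Sum>k\<in>F. \<Sum>l\<in>F. (if m k - m l = 0 then 2 * pi else 0) * cinner (u k) (u l))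
      = (\<Sum>k\<in>F. \<Sum>l\<in>F. if k = l then 2 * pi * cinner (u k) (u l) else 0)"
    using assms(2) by (intro sum.cong refl) (auto dest: inj_onD)
  also have "\<dots> = complex_of_real (2 * pi * (\<Sum>k\<in>F. (norm (u k))\<^sup>2))"
    using assms(1) by (simp add: cinner_self sum_distrib_left)
  finally have "((\<lambda>t. complex_of_real ((norm (\<Sum>k\<in>F. e k t *\<^sub>C u k))\<^sup>2)) has_integral
      complex_of_real (2 * pi * (\<Sum>k\<in>F. (norm (u k))\<^sup>2))) {0..2*pi}"
    by (simp only: eq)
  from has_integral_linear[OF this bounded_linear_Re] show ?thesis
    by (simp add: o_def e_def)
qed

text \<open>The mean square distance from \<open>g\<close> to its partial Fourier sum is nonnegative, and expanding it
  leaves the difference of the two sides, up to the factor \<open>2 \<pi>\<close>.\<close>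

lemma bessel_inequality:
  fixes g :: "real \<Rightarrow> 'a::complex_hilbert_space"
  assumes "continuous_on {0..2*pi} g" "finite F"
    and w: "\<And>k. k \<in> F \<Longrightarrow>
      ((\<lambda>t. exp (- (\<i> * of_int k * of_real t)) *\<^sub>C g t) has_integral w k) {0..2*pi}"
  shows "(\<Sum>k\<in>F. (norm (w k))\<^sup>2) \<le> 2 * pi * integral {0..2*pi} (\<lambda>t. (norm (g t))\<^sup>2)"
proof -
  define u where "u k = complex_of_real (1 / (2 * pi)) *\<^sub>C w k" for k
  define s where "s t = (\<Sum>k\<in>F. exp (\<i> * of_int k * of_real t) *\<^sub>C u k)" for t
  define G where "G = integral {0..2*pi} (\<lambda>t. (norm (g t))\<^sup>2)"
  define W where "W = (\<Sum>k\<in>F. (norm (w k))\<^sup>2)"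
  have u: "(norm (u k))\<^sup>2 = (norm (w k))\<^sup>2 / (2 * pi)\<^sup>2" for k
    by (simp add: u_def norm_scaleC power_mult_distrib norm_divide norm_mult power_divide)
  have s2: "((\<lambda>t. (norm (s t))\<^sup>2) has_integral W / (2 * pi)) {0..2*pi}"
  proof -
    have "2 * pi * (\<Sum>k\<in>F. (norm (u k))\<^sup>2) = W / (2 * pi)"
      unfolding u W_def sum_divide_distrib[symmetric] by (simp add: power2_eq_square)
    then show ?thesis
      using has_integral_norm_trigonometric_sq[of F "\<lambda>k. k" u] assms(2) by (simp add: s_def)
  qed
  have g2: "((\<lambda>t. (norm (g t))\<^sup>2) has_integral G) {0..2*pi}"
    unfolding G_def using assms(1)
    by (intro integrable_integral integrable_continuous_real continuous_intros)
  have c: "((\<lambda>t. Re (cinner (g t) (s t))) has_integral W / (2 * pi)) {0..2*pi}"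
  proof -
    have "((\<lambda>t. \<Sum>k\<in>F. Re (cinner (exp (- (\<i> * of_int k * of_real t)) *\<^sub>C g t) (u k)))
        has_integral (\<Sum>k\<in>F. Re (cinner (w k) (u k)))) {0..2*pi}"
    proof (intro has_integral_sum assms(2))
      fix k assume "k \<in> F"
      have "bounded_linear (\<lambda>x. Re (cinner x (u k)))"
        using bounded_linear_compose[OF bounded_linear_Re cinner.bounded_linear_left[of "u k"]]
        by simp
      from has_integral_linear[OF w[OF \<open>k \<in> F\<close>] this]
      show "((\<lambda>t. Re (cinner (exp (- (\<i> * of_int k * of_real t)) *\<^sub>C g t) (u k)))
        has_integral Re (cinner (w k) (u k))) {0..2*pi}"
        by (simp add: o_def)
    qed
    moreover have "(\<Sum>k\<in>F. Re (cinner (w k) (u k))) = W / (2 * pi)"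
      by (simp add: u_def W_def cinner_scaleC_right cinner_self sum_divide_distrib)
    moreover have "(\<Sum>k\<in>F. Re (cinner (exp (- (\<i> * of_int k * of_real t)) *\<^sub>C g t) (u k)))
        = Re (cinner (g t) (s t))" for t
      by (simp add: s_def cinner_sum_right cinner_scaleC_left cinner_scaleC_right exp_cnj)
    ultimately show ?thesis by simp
  qed
  have expand: "(norm (g t - s t))\<^sup>2
      = (norm (g t))\<^sup>2 - 2 * Re (cinner (g t) (s t)) + (norm (s t))\<^sup>2" for t
  proof -
    have r: "(norm v)\<^sup>2 = Re (cinner v v)" for v :: 'a
      by (simp add: cinner_self)
    show ?thesis
      unfolding r using Re_cinner_commute[of "s t" "g t"]
      by (simp only: cinner_diff_left cinner_diff_right minus_complex.sel)
  qed
  have "((\<lambda>t. (norm (g t - s t))\<^sup>2) has_integral G - 2 * (W / (2 * pi)) + W / (2 * pi)) {0..2*pi}"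
    unfolding expand by (intro has_integral_add has_integral_diff has_integral_mult_right g2 c s2)
  then have "0 \<le> G - 2 * (W / (2 * pi)) + W / (2 * pi)"
    by (rule has_integral_nonneg) simp
  then have "W \<le> 2 * pi * G"
    by (simp add: field_simps)
  then show ?thesis
    by (simp only: G_def W_def)
qed

section \<open>Bounds for a generator and its resolvent at equidistant nodes\<close>

text \<open>The number \<open>a\<close> is so large that \<open>exp (- a t) T(t)\<close> halves every vector, at least, over the time
  \<open>2\<pi>\<close>, and likewise backwards in time.\<close>

locale group_with_constants = group_generator +
  fixes M a :: real
  assumes M: "M \<ge> 1" and a: "a > 0"
    and T_bound: "\<bar>t\<bar> \<le> 2 * pi \<Longrightarrow> norm (T t x) \<le> M * norm x"
    and decay: "exp (- (2 * pi * a)) * M \<le> 1 / 2"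

lemma (in group_generator) constants_exist: "\<exists>M a. group_with_constants T D A M a"
proof -
  obtain M where M: "M \<ge> 1" "\<And>t x. \<bar>t\<bar> \<le> 2 * pi \<Longrightarrow> norm (T t x) \<le> M * norm x"
    using C0_group_bounded_on_interval[OF group] by metis
  \<comment> \<open>Solves \<open>exp (- 2 \<pi> a) M = 1 / 2\<close>.\<close>
  define a where "a = ln (2 * M) / (2 * pi)"
  have "exp (- (2 * pi * a)) * M = 1 / 2"
    using M(1) by (simp add: a_def exp_minus field_simps)
  moreover have "a > 0"
    using M(1) by (simp add: a_def)
  ultimately have "group_with_constants T D A M a"
    using M by unfold_locales auto
  then show ?thesis by blast
qed

context group_with_constants
begin

text \<open>Following the twisted orbit over one period gives a lower bound for \<open>z - A\<close>; for the
  left half-plane the orbit is followed backwards in time.\<close>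

lemma apriori_bound:
  assumes "w \<in> D" "\<bar>Re z\<bar> \<ge> a"
  shows "norm w \<le> 4 * pi * M * norm (z *\<^sub>C w - A w)"
proof -
  define \<tau> :: real where "\<tau> = (if Re z \<ge> 0 then 2 * pi else - 2 * pi)"
  define S where "S = (if Re z \<ge> 0 then {0..2*pi} else {-2*pi..0})"
  define f where "f t = exp (- (z * of_real t)) *\<^sub>C T t w" for t
  define v where "v = z *\<^sub>C w - A w"
  have "norm (f \<tau> - f 0) \<le> M * norm v * \<bar>\<tau> - 0\<bar>"
  proof (rule vector_derivative_bound)
    show "(f has_vector_derivative - (exp (- (z * of_real t)) *\<^sub>C T t v)) (at t within S)" for t
      unfolding f_def v_def by (rule twisted_orbit_derivative[OF assms(1)])
    show "norm (- (exp (- (z * of_real t)) *\<^sub>C T t v)) \<le> M * norm v" if "t \<in> S" for t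
    proof -
      have "Re z * t \<ge> 0" "\<bar>t\<bar> \<le> 2 * pi"
        using that by (auto simp: S_def zero_le_mult_iff split: if_splits)
      then have "exp (- (Re z * t)) * norm (T t v) \<le> 1 * (M * norm v)"
        by (intro mult_mono T_bound) auto
      then show ?thesis
        by (simp add: norm_scaleC)
    qed
  qed (auto simp: S_def \<tau>_def)
  also have "\<bar>\<tau> - 0\<bar> = 2 * pi"
    by (simp add: \<tau>_def)
  finally have diff: "norm (f \<tau> - f 0) \<le> M * norm v * (2 * pi)" .
  have "norm (f \<tau>) \<le> exp (- (2 * pi * a)) * (M * norm w)"
  proof -
    have "Re z * \<tau> = 2 * pi * \<bar>Re z\<bar>"
      by (simp add: \<tau>_def)
    then have "Re z * \<tau> \<ge> 2 * pi * a"
      using assms(2) by simp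
    then have "exp (- (Re z * \<tau>)) * norm (T \<tau> w) \<le> exp (- (2 * pi * a)) * (M * norm w)"
      by (intro mult_mono T_bound) (auto simp: \<tau>_def)
    then show ?thesis
      by (simp add: f_def norm_scaleC)
  qed
  also have "\<dots> \<le> 1 / 2 * norm w"
    using mult_right_mono[OF decay, of "norm w"] by (simp add: mult.assoc)
  finally have "norm (f \<tau>) \<le> 1 / 2 * norm w" .
  moreover have "f 0 = w"
    by (simp add: f_def T_zero scaleC_one)
  then have "norm w \<le> norm (f \<tau>) + norm (f \<tau> - f 0)"
    by (metis norm_minus_commute norm_triangle_sub)
  ultimately show ?thesis
    using diff by (simp add: v_def algebra_simps)
qed

text \<open>The estimate \<open>\<parallel>T(t)u - u - t y\<parallel> \<le> \<bar>t\<bar> sup \<parallel>T(s)A u - y\<parallel>\<close>, which holds on the domain,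
  survives the limit.\<close>

lemma generator_closed:
  assumes u: "\<And>n::nat. u n \<in> D" and x: "u \<longlonglongrightarrow> x" and y: "(\<lambda>n. A (u n)) \<longlonglongrightarrow> y"
  shows "x \<in> D" "A x = y"
proof -
  have "((\<lambda>t. (1 / t) *\<^sub>R (T t x - x)) \<longlongrightarrow> y) (at 0)"
  proof (rule LIM_I)
    fix r :: real assume "r > 0"
    have "isCont (\<lambda>t. T t y) 0"
      using T_continuous[of UNIV y] by (simp add: continuous_on_eq_continuous_at)
    then obtain d where d: "d > 0" "\<And>t. dist t 0 < d \<Longrightarrow> dist (T t y) (T 0 y) < r / 2"
      unfolding continuous_at_eps_delta using \<open>r > 0\<close> by (metis half_gt_zero)
    define e where "e = min d (2 * pi)"
    have "norm ((1 / t) *\<^sub>R (T t x - x) - y) < r" if t: "t \<noteq> 0" "norm (t - 0) < e" for t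
    proof -
      define S where "S = {-\<bar>t\<bar>..\<bar>t\<bar>}"
      have S: "\<bar>s\<bar> \<le> 2 * pi" "dist s 0 < d" if "s \<in> S" for s
        using that t(2) by (auto simp: S_def e_def)
      have "norm ((T t (u n) - t *\<^sub>R y) - (T 0 (u n) - 0 *\<^sub>R y))
          \<le> (M * norm (A (u n) - y) + r / 2) * \<bar>t - 0\<bar>" for n
      proof (rule vector_derivative_bound[where S = S])
        show "((\<lambda>t. T t (u n) - t *\<^sub>R y) has_vector_derivative (T s (A (u n)) - y)) (at s within S)" for s
          by (rule derivative_eq_intros orbit_derivative u refl | simp)+
        show "norm (T s (A (u n)) - y) \<le> M * norm (A (u n) - y) + r / 2" if "s \<in> S" for s
        proof -
          have "norm (T s (A (u n) - y)) \<le> M * norm (A (u n) - y)"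
            using S that by (intro T_bound) auto
          moreover have "norm (T s y - y) \<le> r / 2"
            using d(2)[of s] S that by (simp add: T_zero dist_norm)
          ultimately show ?thesis
            using norm_triangle_ineq[of "T s (A (u n) - y)" "T s y - y"] by (simp add: T_simps)
        qed
      qed (auto simp: S_def)
      then have "norm (T t (u n) - t *\<^sub>R y - u n) \<le> (M * norm (A (u n) - y) + r / 2) * \<bar>t\<bar>" for n
        by (simp add: T_zero)
      moreover have "(\<lambda>n. norm (T t (u n) - t *\<^sub>R y - u n)) \<longlonglongrightarrow> norm (T t x - t *\<^sub>R y - x)"
        by (intro tendsto_intros x bounded_linear.tendsto[OF T_bounded_linear])
      moreover have "(\<lambda>n. (M * norm (A (u n) - y) + r / 2) * \<bar>t\<bar>) \<longlonglongrightarrow> (M * norm (y - y) + r / 2) * \<bar>t\<bar>"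
        by (intro tendsto_intros y)
      ultimately have le: "norm (T t x - t *\<^sub>R y - x) \<le> r / 2 * \<bar>t\<bar>"
        by (intro LIMSEQ_le[of "\<lambda>n. norm (T t (u n) - t *\<^sub>R y - u n)"]) auto
      have "(1 / t) *\<^sub>R (T t x - x) - y = (1 / t) *\<^sub>R (T t x - t *\<^sub>R y - x)"
        using t(1) by (simp add: scaleR_diff_right)
      then have "norm ((1 / t) *\<^sub>R (T t x - x) - y) = norm (T t x - t *\<^sub>R y - x) / \<bar>t\<bar>"
        by simp
      also have "\<dots> \<le> r / 2"
        using le t(1) by (simp add: divide_le_eq)
      finally show ?thesis
        using \<open>r > 0\<close> by simp
    qed
    moreover have "e > 0"
      using d(1) by (simp add: e_def)
    ultimately show "\<exists>s>0. \<forall>t. t \<noteq> 0 \<and> norm (t - 0) < s \<longrightarrow> norm ((1 / t) *\<^sub>R (T t x - x) - y) < r"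
      by blast
  qed
  then show "x \<in> D" "A x = y"
    by (rule generator_from_limit)+
qed

text \<open>The imaginary parts of the nodes are integers, so that \<open>exp (- node k * t)\<close> takes the same value
  \<open>exp (- 2 \<pi> a)\<close> at \<open>t = 2 \<pi>\<close> for all \<open>k\<close>.\<close>

definition node :: "int \<Rightarrow> complex" where
  "node k = complex_of_real a + \<i> * of_int k"

lemma norm_le_period_difference:
  "norm w \<le> 2 * norm (w - exp (- (2 * pi * a)) *\<^sub>R T (2 * pi) w)"
proof -
  have "norm (exp (- (2 * pi * a)) *\<^sub>R T (2 * pi) w) \<le> exp (- (2 * pi * a)) * (M * norm w)"
    using T_bound[of "2 * pi" w] by simp
  also have "\<dots> \<le> 1 / 2 * norm w"
    using mult_right_mono[OF decay, of "norm w"] by (simp add: mult.assoc)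
  finally show ?thesis
    using norm_triangle_sub[of w "exp (- (2 * pi * a)) *\<^sub>R T (2 * pi) w"] by simp
qed

lemma node_fourier:
  assumes "w \<in> D"
  shows "((\<lambda>t. exp (- (\<i> * of_int k * of_real t)) *\<^sub>C
      (exp (- (a * t)) *\<^sub>R T t (node k *\<^sub>C w - A w)))
    has_integral (w - exp (- (2 * pi * a)) *\<^sub>R T (2 * pi) w)) {0..2*pi}"
proof -
  define v where "v = node k *\<^sub>C w - A w"
  define f where "f t = - (exp (- (node k * of_real t)) *\<^sub>C T t w)" for t
  have "((\<lambda>t. exp (- (node k * of_real t)) *\<^sub>C T t v) has_integral f (2 * pi) - f 0) {0..2*pi}"
  proof (rule fundamental_theorem_of_calculus)
    show "(f has_vector_derivative exp (- (node k * of_real t)) *\<^sub>C T t v) (at t within {0..2*pi})" for t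
      using has_vector_derivative_minus[OF twisted_orbit_derivative[OF assms, of "node k" t "{0..2*pi}"]]
      by (simp add: f_def[abs_def] v_def)
  qed simp
  moreover have "exp (- (node k * of_real t)) *\<^sub>C T t v
      = exp (- (\<i> * of_int k * of_real t)) *\<^sub>C (exp (- (a * t)) *\<^sub>R T t v)" for t
    by (simp add: scaleR_scaleC scaleC_scaleC node_def exp_of_real[symmetric] exp_add[symmetric]
        algebra_simps)
  moreover have "f (2 * pi) - f 0 = w - exp (- (2 * pi * a)) *\<^sub>R T (2 * pi) w"
  proof -
    have "exp (- (node k * of_real (2 * pi))) = exp (- (2 * pi * a)) * exp (- (\<i> * of_int k * of_real (2 * pi)))"
      by (simp add: node_def exp_of_real[symmetric] exp_add[symmetric] algebra_simps)
    moreover have "exp (- (\<i> * of_int k * of_real (2 * pi))) = 1"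
      using exp_eq_1 by (simp add: exp_minus mult.commute mult.left_commute)
    ultimately show ?thesis
      by (simp add: f_def T_zero scaleC_one scaleR_scaleC)
  qed
  ultimately show ?thesis
    by (simp add: v_def)
qed

text \<open>The resolvent values of a fixed vector at the nodes are, up to an invertible operator, the
  Fourier coefficients of a weighted orbit.\<close>

lemma sum_node_resolvent_sq_le:
  assumes "finite F" "\<And>k. k \<in> F \<Longrightarrow> w k \<in> D" "\<And>k. k \<in> F \<Longrightarrow> node k *\<^sub>C w k - A (w k) = x"
  shows "(\<Sum>k\<in>F. (norm (w k))\<^sup>2) \<le> (4 * pi * M * norm x)\<^sup>2"
proof -
  define g where "g t = exp (- (a * t)) *\<^sub>R T t x" for t
  define c where "c k = w k - exp (- (2 * pi * a)) *\<^sub>R T (2 * pi) (w k)" for k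
  have cont: "continuous_on {0..2*pi} g"
    unfolding g_def by (intro continuous_intros T_continuous)
  have g: "(norm (g t))\<^sup>2 \<le> (M * norm x)\<^sup>2" if "t \<in> {0..2*pi}" for t
  proof -
    have "exp (- (a * t)) * norm (T t x) \<le> 1 * (M * norm x)"
      using that a by (intro mult_mono T_bound) auto
    then show ?thesis
      by (intro power_mono) (auto simp: g_def)
  qed
  have "(\<Sum>k\<in>F. (norm (w k))\<^sup>2) \<le> (\<Sum>k\<in>F. 4 * (norm (c k))\<^sup>2)"
  proof (rule sum_mono)
    fix k
    have "(norm (w k))\<^sup>2 \<le> (2 * norm (c k))\<^sup>2"
      unfolding c_def by (intro power_mono norm_le_period_difference) auto
    then show "(norm (w k))\<^sup>2 \<le> 4 * (norm (c k))\<^sup>2"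
      by (simp add: power_mult_distrib)
  qed
  also have "\<dots> = 4 * (\<Sum>k\<in>F. (norm (c k))\<^sup>2)"
    by (simp add: sum_distrib_left)
  also have "\<dots> \<le> 4 * (2 * pi * integral {0..2*pi} (\<lambda>t. (norm (g t))\<^sup>2))"
  proof (intro mult_left_mono bessel_inequality cont assms(1))
    show "((\<lambda>t. exp (- (\<i> * of_int k * of_real t)) *\<^sub>C g t) has_integral c k) {0..2*pi}"
      if "k \<in> F" for k
      using node_fourier[OF assms(2)[OF that], of k] by (simp add: assms(3)[OF that] g_def c_def)
  qed simp
  also have "\<dots> \<le> 4 * (2 * pi * integral {0..2*pi} (\<lambda>t. (M * norm x)\<^sup>2))"
    using g by (intro mult_left_mono integral_le integrable_continuous_real continuous_intros cont)
      auto
  also have "\<dots> = (4 * pi * M * norm x)\<^sup>2"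
    by (simp add: power2_eq_square)
  finally show ?thesis .
qed

text \<open>The estimate dual to the previous one: synthesis from the nodes is bounded because the
  exponentials are orthogonal.\<close>

lemma norm_sum_nodes_sq_le:
  assumes "finite F" "\<And>k. k \<in> F \<Longrightarrow> w k \<in> D"
  shows "(norm (\<Sum>k\<in>F. w k))\<^sup>2 \<le> (4 * pi * M)\<^sup>2 * (\<Sum>k\<in>F. (norm (node k *\<^sub>C w k - A (w k)))\<^sup>2)"
proof -
  define u where "u k = node k *\<^sub>C w k - A (w k)" for k
  define h where "h t = (\<Sum>k\<in>F. exp (\<i> * of_int (- k) * of_real t) *\<^sub>C u k)" for t
  define g where "g t = exp (- (a * t)) *\<^sub>R T t (h t)" for t
  define s where "s = (\<Sum>k\<in>F. w k)"
  have g_eq: "g t = (\<Sum>k\<in>F. exp (- (\<i> * of_int k * of_real t)) *\<^sub>C (exp (- (a * t)) *\<^sub>R T t (u k)))" for t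
    by (simp add: g_def h_def linear_sum[OF bounded_linear.linear[OF T_bounded_linear]] T_scaleC
        scaleR_scaleC scaleC_scaleC complex_vector.scale_sum_right mult.commute)
  have h_cont: "continuous_on {0..2*pi} h"
    unfolding h_def by (intro continuous_intros scaleC.continuous_on)
  have g_cont: "continuous_on {0..2*pi} g"
    unfolding g_eq by (intro continuous_intros scaleC.continuous_on T_continuous)
  have "(g has_integral (\<Sum>k\<in>F. w k - exp (- (2 * pi * a)) *\<^sub>R T (2 * pi) (w k))) {0..2*pi}"
    unfolding g_eq u_def by (intro has_integral_sum assms node_fourier)
  also have "(\<Sum>k\<in>F. w k - exp (- (2 * pi * a)) *\<^sub>R T (2 * pi) (w k))
      = s - exp (- (2 * pi * a)) *\<^sub>R T (2 * pi) s"
    by (simp add: s_def sum_subtractf scaleR_sum_right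
        linear_sum[OF bounded_linear.linear[OF T_bounded_linear]])
  finally have int: "integral {0..2*pi} g = s - exp (- (2 * pi * a)) *\<^sub>R T (2 * pi) s"
    by (rule integral_unique)
  have "(norm s)\<^sup>2 \<le> (2 * norm (integral {0..2*pi} g))\<^sup>2"
    unfolding int by (intro power_mono norm_le_period_difference) auto
  also have "\<dots> \<le> 4 * (2 * pi * integral {0..2*pi} (\<lambda>t. (norm (g t))\<^sup>2))"
    using norm_integral_sq_le[OF g_cont] by (simp add: power_mult_distrib)
  also have "\<dots> \<le> 4 * (2 * pi * integral {0..2*pi} (\<lambda>t. M\<^sup>2 * (norm (h t))\<^sup>2))"
  proof (intro mult_left_mono integral_le)
    show "(norm (g t))\<^sup>2 \<le> M\<^sup>2 * (norm (h t))\<^sup>2" if "t \<in> {0..2*pi}" for t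
    proof -
      have "exp (- (a * t)) * norm (T t (h t)) \<le> 1 * (M * norm (h t))"
        using that a by (intro mult_mono T_bound) auto
      then have "(norm (g t))\<^sup>2 \<le> (M * norm (h t))\<^sup>2"
        by (intro power_mono) (auto simp: g_def)
      then show ?thesis
        by (simp add: power_mult_distrib)
    qed
  qed (auto intro!: integrable_continuous_real continuous_intros g_cont h_cont)
  also have "integral {0..2*pi} (\<lambda>t. M\<^sup>2 * (norm (h t))\<^sup>2) = M\<^sup>2 * (2 * pi * (\<Sum>k\<in>F. (norm (u k))\<^sup>2))"
    using has_integral_norm_trigonometric_sq[OF assms(1), of uminus u]
    by (intro integral_unique has_integral_mult_right) (auto simp: h_def)
  also have "4 * (2 * pi * (M\<^sup>2 * (2 * pi * (\<Sum>k\<in>F. (norm (u k))\<^sup>2))))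
      = (4 * pi * M)\<^sup>2 * (\<Sum>k\<in>F. (norm (u k))\<^sup>2)"
    by (simp add: power2_eq_square)
  finally show ?thesis
    by (simp add: s_def u_def)
qed

end

section \<open>Sequences in a strip that split into separated sequences\<close>

lemma uniform_gap_obtain:
  assumes "uniform_gap lam I"
  obtains g where "g > 0" "\<And>n m. n \<in> I \<Longrightarrow> m \<in> I \<Longrightarrow> n \<noteq> m \<Longrightarrow> g \<le> cmod (lam n - lam m)"
proof -
  define X where "X = (INF (n, m) \<in> {(n, m). n \<in> I \<and> m \<in> I \<and> n \<noteq> m}. ereal (cmod (lam n - lam m)))"
  have "0 < X"
    using assms by (simp add: uniform_gap_def X_def)
  then obtain g where g: "0 < ereal g" "ereal g < X"
    using ereal_dense2 by blast
  have "g \<le> cmod (lam n - lam m)" if "n \<in> I" "m \<in> I" "n \<noteq> m" for n m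
  proof -
    have "X \<le> ereal (cmod (lam n - lam m))"
      unfolding X_def using that by (intro INF_lower2[of "(n, m)"]) auto
    then have "ereal g \<le> ereal (cmod (lam n - lam m))"
      using g(2) by (meson less_imp_le order_trans)
    then show ?thesis by simp
  qed
  then show ?thesis
    using that g(1) by simp
qed

lemma common_gap:
  fixes S :: "nat \<Rightarrow> nat set"
  assumes "\<And>k. k < K \<Longrightarrow> uniform_gap lam (S k)"
  shows "\<exists>g>0. \<forall>k<K. \<forall>n\<in>S k. \<forall>m\<in>S k. n \<noteq> m \<longrightarrow> g \<le> cmod (lam n - lam m)"
  using assms
proof (induction K)
  case 0
  show ?case by (rule exI[of _ 1]) simp
next
  case (Suc K)
  then obtain g where g: "g > 0" "\<forall>k<K. \<forall>n\<in>S k. \<forall>m\<in>S k. n \<noteq> m \<longrightarrow> g \<le> cmod (lam n - lam m)"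
    by auto
  obtain h where h: "h > 0" "\<And>n m. n \<in> S K \<Longrightarrow> m \<in> S K \<Longrightarrow> n \<noteq> m \<Longrightarrow> h \<le> cmod (lam n - lam m)"
    using uniform_gap_obtain[OF Suc.prems[of K]] by auto
  show ?case
    using g h by (intro exI[of _ "min g h"]) (auto simp: less_Suc_eq min_le_iff_disj)
qed

lemma sum_inverse_square_int:
  assumes "finite (F :: int set)"
  shows "(\<Sum>j\<in>F. 1 / (1 + (real_of_int j)\<^sup>2)) \<le> 2 * (\<Sum>n. 1 / (1 + (real n)\<^sup>2))"
proof -
  define f where "f n = 1 / (1 + (real n)\<^sup>2)" for n
  have f: "summable f"
  proof (rule summable_comparison_test)
    show "\<exists>N. \<forall>n\<ge>N. norm (f n) \<le> inverse ((real n)\<^sup>2)"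
      by (rule exI[of _ 1]) (auto simp: f_def inverse_eq_divide intro!: frac_le)
    show "summable (\<lambda>n. inverse ((real n)\<^sup>2))"
      using inverse_power_summable[of 2] by simp
  qed
  have f0: "f n \<ge> 0" for n
    by (simp add: f_def)
  have *: "(\<Sum>j\<in>X. f (nat \<bar>j\<bar>)) \<le> suminf f" if "X \<subseteq> F" "inj_on (\<lambda>j. nat \<bar>j\<bar>) X" for X
  proof -
    have "(\<Sum>j\<in>X. f (nat \<bar>j\<bar>)) = sum f ((\<lambda>j. nat \<bar>j\<bar>) ` X)"
      using that(2) by (simp add: sum.reindex)
    also have "\<dots> \<le> suminf f"
      using f f0 finite_subset[OF that(1) assms] by (intro sum_le_suminf) auto
    finally show ?thesis .
  qed
  have "(\<Sum>j\<in>F. 1 / (1 + (real_of_int j)\<^sup>2)) = (\<Sum>j\<in>F. f (nat \<bar>j\<bar>))"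
    by (intro sum.cong) (auto simp: f_def)
  also have "\<dots> = (\<Sum>j\<in>{j\<in>F. j \<ge> 0}. f (nat \<bar>j\<bar>)) + (\<Sum>j\<in>{j\<in>F. j < 0}. f (nat \<bar>j\<bar>))"
    using assms by (subst sum.union_disjoint[symmetric]) (auto intro!: sum.cong)
  also have "\<dots> \<le> suminf f + suminf f"
    by (intro add_mono *) (auto simp: inj_on_def)
  finally show ?thesis
    by (simp add: f_def[abs_def])
qed

text \<open>\<open>c n\<close> is the index of the separated subsequence to which \<open>n\<close> belongs.\<close>

locale separated_classes =
  fixes lam :: "nat \<Rightarrow> complex" and a g :: real and K :: nat and c :: "nat \<Rightarrow> nat"
  assumes strip: "\<bar>Re (lam n)\<bar> < a" and gap_pos: "g > 0"
    and class_less: "c n < K"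
    and gap: "c n = c m \<Longrightarrow> n \<noteq> m \<Longrightarrow> g \<le> cmod (lam n - lam m)"
begin

lemma a_pos: "a > 0"
  using strip[of 0] by linarith

lemma ball_indices:
  assumes "r \<le> g / 2"
  shows "finite {n. dist z (lam n) < r}" "card {n. dist z (lam n) < r} \<le> K"
proof -
  have inj: "inj_on c {n. dist z (lam n) < r}"
  proof (rule inj_onI, rule ccontr)
    fix n m assume *: "n \<in> {n. dist z (lam n) < r}" "m \<in> {n. dist z (lam n) < r}" "c n = c m" "n \<noteq> m"
    then have "dist (lam n) (lam m) < g"
      using dist_triangle3[of "lam n" "lam m" z] assms by simp
    then show False
      using gap[OF *(3,4)] by (simp add: dist_norm)
  qed
  have sub: "c ` {n. dist z (lam n) < r} \<subseteq> {..<K}"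
    using class_less by auto
  show "finite {n. dist z (lam n) < r}"
    using inj sub by (meson finite_imageD finite_lessThan finite_subset)
  show "card {n. dist z (lam n) < r} \<le> K"
    using card_inj_on_le[OF inj sub] by simp
qed

lemma positive_distance:
  assumes "z \<notin> range lam"
  shows "\<exists>\<delta>>0. \<forall>n. \<delta> \<le> cmod (z - lam n)"
proof -
  define F where "F = {n. dist z (lam n) < g / 2}"
  have fin: "finite F"
    unfolding F_def by (rule ball_indices) simp
  define \<delta> where "\<delta> = Min (insert (g / 2) ((\<lambda>n. dist z (lam n)) ` F))"
  have "\<delta> > 0"
    using fin gap_pos assms by (auto simp: \<delta>_def)
  moreover have "\<delta> \<le> dist z (lam n)" for n
  proof (cases "n \<in> F")
    case True
    then show ?thesis
      using fin by (auto simp: \<delta>_def intro: Min_le)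
  next
    case False
    have "\<delta> \<le> g / 2"
      unfolding \<delta>_def using fin by (intro Min_le) auto
    with False show ?thesis
      by (simp add: F_def)
  qed
  ultimately show ?thesis
    by (metis dist_norm)
qed

text \<open>Squares of side \<open>g / 2\<close> have diameter less than \<open>g\<close>, hence contain at most one member of
  each class; a unit piece of the strip is covered by boundedly many of them.\<close>

lemma row_indices:
  "\<exists>N. \<forall>m::int. finite {n. \<lfloor>Im (lam n)\<rfloor> = m} \<and> card {n. \<lfloor>Im (lam n)\<rfloor> = m} \<le> N"
proof -
  define s where "s = g / 2"
  have s: "s > 0"
    using gap_pos by (simp add: s_def)
  define q where "q n = (c n, \<lfloor>Re (lam n) / s\<rfloor>, \<lfloor>Im (lam n) / s\<rfloor>)" for n
  define R where "R = {\<lfloor>- a / s\<rfloor>..\<lfloor>a / s\<rfloor>}"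
  define L where "L = nat (\<lfloor>1 / s\<rfloor> + 2)"
  define B where "B m = {..<K} \<times> R \<times> {\<lfloor>real_of_int m / s\<rfloor>..\<lfloor>(real_of_int m + 1) / s\<rfloor>}" for m
  have near: "\<bar>x - y\<bar> < s" if "\<lfloor>x / s\<rfloor> = \<lfloor>y / s\<rfloor>" for x y :: real
  proof -
    have "\<bar>x / s - y / s\<bar> < 1"
      using that by linarith
    then have "\<bar>x - y\<bar> / s < 1"
      using s by (simp add: diff_divide_distrib[symmetric])
    then show ?thesis
      using s by simp
  qed
  have inj: "inj_on q A" for A
  proof (rule inj_onI, rule ccontr)
    fix n m assume *: "q n = q m" "n \<noteq> m"
    then have "\<bar>Re (lam n - lam m)\<bar> < s" "\<bar>Im (lam n - lam m)\<bar> < s" "c n = c m"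
      using near by (auto simp: q_def)
    then have "cmod (lam n - lam m) < g"
      using cmod_le[of "lam n - lam m"] by (simp add: s_def)
    then show False
      using gap[OF \<open>c n = c m\<close> *(2)] by simp
  qed
  have sub: "q ` {n. \<lfloor>Im (lam n)\<rfloor> = m} \<subseteq> B m" for m
  proof (rule image_subsetI)
    fix n assume "n \<in> {n. \<lfloor>Im (lam n)\<rfloor> = m}"
    then have "m = \<lfloor>Im (lam n)\<rfloor>"
      by simp
    then have "real_of_int m \<le> Im (lam n)" "Im (lam n) \<le> real_of_int m + 1"
      by linarith+
    moreover have "- a \<le> Re (lam n)" "Re (lam n) \<le> a"
      using strip[of n] by auto
    ultimately have "\<lfloor>- a / s\<rfloor> \<le> \<lfloor>Re (lam n) / s\<rfloor>" "\<lfloor>Re (lam n) / s\<rfloor> \<le> \<lfloor>a / s\<rfloor>"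
      "\<lfloor>real_of_int m / s\<rfloor> \<le> \<lfloor>Im (lam n) / s\<rfloor>" "\<lfloor>Im (lam n) / s\<rfloor> \<le> \<lfloor>(real_of_int m + 1) / s\<rfloor>"
      using s by (intro floor_mono divide_right_mono; simp)+
    then show "q n \<in> B m"
      unfolding q_def B_def R_def using class_less by simp
  qed
  have fin: "finite (B m)" for m
    by (simp add: B_def R_def)
  have cardB: "card (B m) \<le> K * (card R * L)" for m
  proof -
    have "\<lfloor>(real_of_int m + 1) / s\<rfloor> + 1 - \<lfloor>real_of_int m / s\<rfloor> \<le> \<lfloor>1 / s\<rfloor> + 2"
      by (simp add: add_divide_distrib) linarith
    then have "card {\<lfloor>real_of_int m / s\<rfloor>..\<lfloor>(real_of_int m + 1) / s\<rfloor>} \<le> L"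
      by (simp add: L_def nat_mono)
    then show ?thesis
      by (simp add: B_def card_cartesian_product)
  qed
  show ?thesis
  proof (intro exI allI conjI)
    fix m
    show "finite {n. \<lfloor>Im (lam n)\<rfloor> = m}"
      using inj sub fin by (meson finite_imageD finite_subset)
    show "card {n. \<lfloor>Im (lam n)\<rfloor> = m} \<le> K * (card R * L)"
      using card_inj_on_le[OF inj sub fin] cardB le_trans by blast
  qed
qed

text \<open>Summing over the rows \<open>m \<le> Im < m + 1\<close> reduces this to the series of \<open>1 / (1 + m\<^sup>2)\<close>; the
  distance \<open>\<delta>\<close> takes care of the rows next to \<open>z\<close>.\<close>

lemma sum_inverse_square_distance:
  assumes "\<delta> > 0"
  shows "\<exists>C. \<forall>z J. finite J \<longrightarrow> (\<forall>n. \<delta> \<le> cmod (z - lam n)) \<longrightarrow>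
    (\<Sum>n\<in>J. 1 / (cmod (z - lam n))\<^sup>2) \<le> C"
proof -
  obtain N where N: "\<And>m::int. finite {n. \<lfloor>Im (lam n)\<rfloor> = m}" "\<And>m::int. card {n. \<lfloor>Im (lam n)\<rfloor> = m} \<le> N"
    using row_indices by blast
  define A where "A = 4 * (1 + 1 / \<delta>\<^sup>2)"
  define Z where "Z = (\<Sum>n. 1 / (1 + (real n)\<^sup>2))"
  have "(\<Sum>n\<in>J. 1 / (cmod (z - lam n))\<^sup>2) \<le> A * (real N * (2 * Z))"
    if J: "finite J" and z: "\<forall>n. \<delta> \<le> cmod (z - lam n)" for z J
  proof -
    define j where "j n = \<lfloor>Im (lam n)\<rfloor> - \<lfloor>Im z\<rfloor>" for n
    have term_le: "1 / (cmod (z - lam n))\<^sup>2 \<le> A * (1 / (1 + (real_of_int (j n))\<^sup>2))" for n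
    proof -
      define r where "r = cmod (z - lam n)"
      have r: "r \<ge> \<delta>"
        using z by (simp add: r_def)
      define d where "d = \<bar>Im z - Im (lam n)\<bar>"
      have "d \<le> r"
        using abs_Im_le_cmod[of "z - lam n"] by (simp add: r_def d_def)
      \<comment> \<open>Rounding both imaginary parts changes their distance by at most one.\<close>
      have "\<bar>real_of_int (j n)\<bar> \<le> d + 1"
        unfolding j_def d_def by linarith
      then have "(real_of_int (j n))\<^sup>2 \<le> (d + 1)\<^sup>2"
        by (metis abs_ge_zero power2_abs power_mono)
      also have "(d + 1)\<^sup>2 \<le> 2 * d\<^sup>2 + 2"
        using sum_squares_bound[of d 1] by (simp add: power2_sum)
      finally have "1 + (real_of_int (j n))\<^sup>2 \<le> 4 * (1 + d\<^sup>2)"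
        by (smt (verit) zero_le_power2)
      also have "\<dots> \<le> 4 * (r\<^sup>2 / \<delta>\<^sup>2 + r\<^sup>2)"
      proof -
        have "1 \<le> r\<^sup>2 / \<delta>\<^sup>2"
          using r assms by (simp add: power_mono)
        moreover have "d\<^sup>2 \<le> r\<^sup>2"
          using \<open>d \<le> r\<close> by (intro power_mono) (auto simp: d_def)
        ultimately show ?thesis by simp
      qed
      also have "\<dots> = A * r\<^sup>2"
        by (simp add: A_def algebra_simps)
      finally have "1 + (real_of_int (j n))\<^sup>2 \<le> A * r\<^sup>2" .
      moreover have "r\<^sup>2 > 0"
        using r assms by simp
      moreover have "1 + (real_of_int (j n))\<^sup>2 > 0"
        by (simp add: add_pos_nonneg)
      ultimately show ?thesis
        unfolding r_def[symmetric] by (simp add: field_simps)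
    qed
    have "(\<Sum>n\<in>J. 1 / (1 + (real_of_int (j n))\<^sup>2))
        = (\<Sum>i\<in>j ` J. \<Sum>n\<in>{n\<in>J. j n = i}. 1 / (1 + (real_of_int (j n))\<^sup>2))"
      using J by (rule sum.image_gen)
    also have "\<dots> = (\<Sum>i\<in>j ` J. real (card {n\<in>J. j n = i}) * (1 / (1 + (real_of_int i)\<^sup>2)))"
      by (intro sum.cong) auto
    also have "\<dots> \<le> (\<Sum>i\<in>j ` J. real N * (1 / (1 + (real_of_int i)\<^sup>2)))"
    proof (intro sum_mono mult_right_mono)
      fix i
      have "{n\<in>J. j n = i} \<subseteq> {n. \<lfloor>Im (lam n)\<rfloor> = i + \<lfloor>Im z\<rfloor>}"
        by (auto simp: j_def)
      then show "real (card {n\<in>J. j n = i}) \<le> real N"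
        using N card_mono le_trans of_nat_le_iff by meson
    qed simp
    also have "\<dots> = real N * (\<Sum>i\<in>j ` J. 1 / (1 + (real_of_int i)\<^sup>2))"
      by (simp add: sum_distrib_left)
    also have "\<dots> \<le> real N * (2 * Z)"
      unfolding Z_def using J by (intro mult_left_mono sum_inverse_square_int) auto
    finally have s: "(\<Sum>n\<in>J. 1 / (1 + (real_of_int (j n))\<^sup>2)) \<le> real N * (2 * Z)" .
    have "(\<Sum>n\<in>J. 1 / (cmod (z - lam n))\<^sup>2) \<le> (\<Sum>n\<in>J. A * (1 / (1 + (real_of_int (j n))\<^sup>2)))"
      by (intro sum_mono term_le)
    also have "\<dots> = A * (\<Sum>n\<in>J. 1 / (1 + (real_of_int (j n))\<^sup>2))"
      by (simp add: sum_distrib_left)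
    also have "\<dots> \<le> A * (real N * (2 * Z))"
      using s by (intro mult_left_mono) (auto simp: A_def)
    finally show ?thesis .
  qed
  then show ?thesis by blast
qed

text \<open>This bounds the Blaschke products of the half-plane \<open>Re > - a\<close> from below. Because
  \<open>\<bar>z + cnj \<lambda> + 2 a\<bar>\<^sup>2 - \<bar>z - \<lambda>\<bar>\<^sup>2 = 4 (Re z + a) (Re \<lambda> + a) \<le> 16 a\<^sup>2\<close>, the reciprocal of a single
  factor is at most \<open>exp (16 a\<^sup>2 / \<bar>z - \<lambda>\<bar>\<^sup>2)\<close>, and the exponents have bounded sum.\<close>

lemma blaschke_lower_bound:
  assumes "\<delta> > 0"
  shows "\<exists>C\<ge>0. \<forall>z J. finite J \<longrightarrow> Re z \<le> a \<longrightarrow> (\<forall>n. \<delta> \<le> cmod (z - lam n)) \<longrightarrow>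
    (\<Prod>n\<in>J. cmod (z + cnj (lam n) + 2 * a)) \<le> C * (\<Prod>n\<in>J. cmod (z - lam n))"
proof -
  obtain C where C: "\<And>z J. finite J \<Longrightarrow> (\<forall>n. \<delta> \<le> cmod (z - lam n)) \<Longrightarrow>
      (\<Sum>n\<in>J. 1 / (cmod (z - lam n))\<^sup>2) \<le> C"
    using sum_inverse_square_distance[OF assms] by blast
  have "(\<Prod>n\<in>J. cmod (z + cnj (lam n) + 2 * a)) \<le> exp (16 * a\<^sup>2 * C) * (\<Prod>n\<in>J. cmod (z - lam n))"
    if J: "finite J" and z: "Re z \<le> a" "\<forall>n. \<delta> \<le> cmod (z - lam n)" for z J
  proof -
    have factor: "cmod (z + cnj (lam n) + 2 * a) \<le> exp (16 * a\<^sup>2 * (1 / (cmod (z - lam n))\<^sup>2)) * cmod (z - lam n)" for n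
    proof -
      define r where "r = cmod (z - lam n)"
      have r: "r > 0"
        using spec[OF z(2), of n] assms unfolding r_def by linarith
      have sq: "(cmod (z + cnj (lam n) + 2 * a))\<^sup>2 = r\<^sup>2 + 4 * ((Re z + a) * (Re (lam n) + a))"
        unfolding r_def cmod_power2 by (simp add: power2_eq_square algebra_simps)
      have "(Re z + a) * (Re (lam n) + a) \<le> (2 * a) * (Re (lam n) + a)"
        using z(1) strip[of n] by (intro mult_right_mono) auto
      also have "\<dots> \<le> (2 * a) * (2 * a)"
        using strip[of n] a_pos by (intro mult_left_mono) auto
      finally have "(Re z + a) * (Re (lam n) + a) \<le> (2 * a) * (2 * a)" .
      then have "(cmod (z + cnj (lam n) + 2 * a))\<^sup>2 \<le> (1 + 16 * a\<^sup>2 / r\<^sup>2) * r\<^sup>2"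
        unfolding sq using r by (simp add: distrib_right power2_eq_square)
      also have "\<dots> \<le> (1 + 16 * a\<^sup>2 / r\<^sup>2)\<^sup>2 * r\<^sup>2"
        by (intro mult_right_mono self_le_power) auto
      finally have "cmod (z + cnj (lam n) + 2 * a) \<le> (1 + 16 * a\<^sup>2 / r\<^sup>2) * r"
        by (rule power2_le_imp_le[OF _ mult_nonneg_nonneg, unfolded power_mult_distrib])
          (use r in auto)
      also have "\<dots> \<le> exp (16 * a\<^sup>2 / r\<^sup>2) * r"
        using r by (intro mult_right_mono exp_ge_add_one_self) auto
      finally show ?thesis
        by (simp add: r_def)
    qed
    have "(\<Prod>n\<in>J. cmod (z + cnj (lam n) + 2 * a))
        \<le> (\<Prod>n\<in>J. exp (16 * a\<^sup>2 * (1 / (cmod (z - lam n))\<^sup>2)) * cmod (z - lam n))"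
      by (intro prod_mono conjI factor) auto
    also have "\<dots> = exp (16 * a\<^sup>2 * (\<Sum>n\<in>J. 1 / (cmod (z - lam n))\<^sup>2)) * (\<Prod>n\<in>J. cmod (z - lam n))"
      using J by (simp only: prod.distrib exp_sum[symmetric] sum_distrib_left)
    also have "\<dots> \<le> exp (16 * a\<^sup>2 * C) * (\<Prod>n\<in>J. cmod (z - lam n))"
      using C[OF J z(2)] by (intro mult_right_mono prod_nonneg) (auto intro!: mult_left_mono)
    finally show ?thesis .
  qed
  then show ?thesis
    by (intro exI[of _ "exp (16 * a\<^sup>2 * C)"]) auto
qed

text \<open>The maximum principle, applied to a function with finitely many poles after the poles have
  been removed by a Blaschke product, which has modulus one on the boundary line.\<close>

lemma half_plane_maximum_principle:
  assumes H: "H holomorphic_on UNIV" and J: "finite J"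
    and eq: "\<And>z. z \<notin> lam ` J \<Longrightarrow> H z = (\<Prod>n\<in>J. z - lam n) * f z"
    and lim: "(f \<longlongrightarrow> 0) at_infinity"
    and bound: "\<And>z. Re z = - a \<Longrightarrow> cmod (f z) \<le> B"
    and z: "Re z > - a"
  shows "cmod (H z) \<le> B * (\<Prod>n\<in>J. cmod (z + cnj (lam n) + 2 * a))"
proof -
  define Q where "Q z = (\<Prod>n\<in>J. z + cnj (lam n) + 2 * a)" for z
  define h where "h z = H z / Q z" for z
  have Q_nz: "Q \<zeta> \<noteq> 0" if "Re \<zeta> \<ge> - a" for \<zeta>
  proof -
    have "Re (\<zeta> + cnj (lam n) + 2 * a) > 0" for n
      using strip[of n] that by simp
    then have "\<zeta> + cnj (lam n) + 2 * a \<noteq> 0" for n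
      by (metis less_irrefl zero_complex.sel(1))
    then show ?thesis
      using J by (simp add: Q_def)
  qed
  have B: "B \<ge> 0"
    using bound[of "of_real (- a)"] by (meson Re_complex_of_real norm_ge_zero order_trans)
  have le: "cmod (h z) \<le> B + \<epsilon>" if \<epsilon>: "\<epsilon> > 0" for \<epsilon>
  proof -
    obtain R0 where R0: "\<And>\<zeta>. R0 \<le> cmod \<zeta> \<Longrightarrow> cmod (f \<zeta>) < \<epsilon>"
      using tendstoD[OF lim \<epsilon>] by (auto simp: eventually_at_infinity)
    \<comment> \<open>On the arc of radius \<open>R\<close> the function \<open>f\<close> is small, and no pole lies on it.\<close>
    define R where "R = max R0 (Max (insert (cmod z) ((\<lambda>n. cmod (lam n)) ` J))) + 1"
    have "x < R" if "x \<in> insert (cmod z) ((\<lambda>n. cmod (lam n)) ` J)" for x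
      using Max_ge[OF _ that] J by (simp add: R_def)
    then have R: "R > R0" "R > cmod z" "\<And>n. n \<in> J \<Longrightarrow> R > cmod (lam n)"
      by (auto simp: R_def)
    define S where "S = {\<zeta>. Re \<zeta> > - a} \<inter> ball 0 R"
    have opS: "open S"
      unfolding S_def by (intro open_Int open_halfspace_Re_gt open_ball)
    have clS: "closure S \<subseteq> {\<zeta>. Re \<zeta> \<ge> - a} \<inter> cball 0 R"
      unfolding S_def by (intro closure_minimal closed_Int closed_halfspace_Re_ge closed_cball) auto
    have Q_hol: "Q holomorphic_on UNIV"
      unfolding Q_def by (intro holomorphic_intros)
    have h_hol: "h holomorphic_on X" if "X \<subseteq> {\<zeta>. Re \<zeta> \<ge> - a}" for X
      unfolding h_def using that Q_nz H Q_hol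
      by (intro holomorphic_on_divide) (auto intro: holomorphic_on_subset)
    show ?thesis
    proof (rule maximum_modulus_frontier[where f = h and S = S])
      show "h holomorphic_on interior S"
        unfolding interior_open[OF opS] by (intro h_hol) (auto simp: S_def)
      show "continuous_on (closure S) h"
        using clS by (intro holomorphic_on_imp_continuous_on h_hol) auto
      show "bounded S"
        unfolding S_def by (simp add: bounded_Int)
      show "z \<in> S"
        using z R by (simp add: S_def)
      show "cmod (h \<zeta>) \<le> B + \<epsilon>" if "\<zeta> \<in> frontier S" for \<zeta>
      proof -
        have \<zeta>: "Re \<zeta> \<ge> - a" "cmod \<zeta> \<le> R" "\<not> (Re \<zeta> > - a \<and> cmod \<zeta> < R)"
          using that clS interior_open[OF opS] by (auto simp: frontier_def S_def)
        have nin: "\<zeta> \<notin> lam ` J"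
        proof
          assume "\<zeta> \<in> lam ` J"
          then obtain n where "n \<in> J" "\<zeta> = lam n" by blast
          then show False
            using \<zeta> R(3) strip[of n] by auto
        qed
        have "cmod (f \<zeta>) \<le> B + \<epsilon>"
        proof (cases "Re \<zeta> = - a")
          case True
          then show ?thesis
            using bound[of \<zeta>] \<epsilon> by simp
        next
          case False
          then have "cmod \<zeta> = R"
            using \<zeta> by linarith
          then show ?thesis
            using R0[of \<zeta>] R(1) B by simp
        qed
        moreover have "(\<Prod>n\<in>J. cmod (\<zeta> - lam n)) \<le> cmod (Q \<zeta>)"
        proof -
          have "cmod (\<zeta> - lam n) \<le> cmod (\<zeta> + cnj (lam n) + 2 * a)" for n
          proof -
            have "(cmod (\<zeta> + cnj (lam n) + 2 * a))\<^sup>2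
                = (cmod (\<zeta> - lam n))\<^sup>2 + 4 * ((Re \<zeta> + a) * (Re (lam n) + a))"
              unfolding cmod_power2 by (simp add: power2_eq_square algebra_simps)
            moreover have "(Re \<zeta> + a) * (Re (lam n) + a) \<ge> 0"
              using \<zeta>(1) strip[of n] by (intro mult_nonneg_nonneg) auto
            ultimately show ?thesis
              by (intro power2_le_imp_le[of "cmod (\<zeta> - lam n)"]) (linarith, rule norm_ge_zero)
          qed
          then show ?thesis
            unfolding Q_def prod_norm[symmetric] by (intro prod_mono) auto
        qed
        ultimately have "(\<Prod>n\<in>J. cmod (\<zeta> - lam n)) * cmod (f \<zeta>) \<le> cmod (Q \<zeta>) * (B + \<epsilon>)"
          by (intro mult_mono) auto
        then show ?thesis
          using Q_nz[OF \<zeta>(1)] eq[OF nin]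
          by (simp add: h_def norm_divide norm_mult prod_norm[symmetric] divide_le_eq mult.commute)
      qed
    qed
  qed
  then have "cmod (h z) \<le> B"
    by (rule field_le_epsilon)
  moreover have "cmod (Q z) > 0"
    using Q_nz[of z] z by simp
  ultimately have "cmod (H z) \<le> B * cmod (Q z)"
    by (simp add: h_def norm_divide pos_divide_le_eq)
  then show ?thesis
    by (simp only: Q_def prod_norm)
qed

end

section \<open>The resolvent on generalized eigenvectors\<close>

text \<open>The value at \<open>z\<close> of the resolvent on the last member \<open>\<phi> j\<close> of a Jordan chain.\<close>

definition chain_resolvent :: "(nat \<Rightarrow> 'a::complex_hilbert_space) \<Rightarrow> complex \<Rightarrow> nat \<Rightarrow> complex \<Rightarrow> 'a" where
  "chain_resolvent \<phi> \<mu> j z = (\<Sum>i\<le>j. (1 / (z - \<mu>) ^ Suc i) *\<^sub>C \<phi> (j - i))"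

lemma chain_resolvent_0: "chain_resolvent \<phi> \<mu> 0 z = (1 / (z - \<mu>)) *\<^sub>C \<phi> 0"
  by (simp add: chain_resolvent_def)

lemma chain_resolvent_Suc:
  "chain_resolvent \<phi> \<mu> (Suc j) z = (1 / (z - \<mu>)) *\<^sub>C (\<phi> (Suc j) + chain_resolvent \<phi> \<mu> j z)"
proof -
  have "chain_resolvent \<phi> \<mu> (Suc j) z
      = (1 / (z - \<mu>)) *\<^sub>C \<phi> (Suc j) + (\<Sum>i\<le>j. (1 / (z - \<mu>) ^ Suc (Suc i)) *\<^sub>C \<phi> (j - i))"
    unfolding chain_resolvent_def by (subst sum.atMost_Suc_shift) simp
  also have "(\<Sum>i\<le>j. (1 / (z - \<mu>) ^ Suc (Suc i)) *\<^sub>C \<phi> (j - i))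
      = (1 / (z - \<mu>)) *\<^sub>C chain_resolvent \<phi> \<mu> j z"
    unfolding chain_resolvent_def complex_vector.scale_sum_right
    by (intro sum.cong refl) (simp add: scaleC_scaleC)
  finally show ?thesis
    by (simp add: scaleC_add_right)
qed

text \<open>The decomposition into sets with a uniform gap enters through a common gap \<open>g\<close> and the map \<open>c\<close>
  that selects the set of each index.\<close>

locale complete_eigen_system = group_with_constants +
  fixes lam :: "nat \<Rightarrow> complex" and g :: real and K :: nat and c :: "nat \<Rightarrow> nat"
  assumes lists: "lists_eigenvalues D A lam"
    and dense: "closure (cspan (\<Union>\<mu>. gen_eigenvectors D A \<mu>)) = UNIV"
    and g_pos: "g > 0" and c_less: "c n < K"
    and c_gap: "c n = c m \<Longrightarrow> n \<noteq> m \<Longrightarrow> g \<le> cmod (lam n - lam m)"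
begin

lemma eigenvalue_strip: "\<mu> \<in> eigenvalues D A \<Longrightarrow> \<bar>Re \<mu>\<bar> < a"
  using apriori_bound[of _ \<mu>] by (force simp: eigenvalues_def not_less[symmetric])

lemma gen_eigenvectorsE:
  assumes "v \<in> gen_eigenvectors D A \<mu>"
  obtains \<phi> :: "nat \<Rightarrow> 'a" and j where "v = \<phi> j" "\<And>i. i \<le> j \<Longrightarrow> \<phi> i \<in> D" "\<phi> 0 \<noteq> 0" "A (\<phi> 0) = \<mu> *\<^sub>C \<phi> 0"
    "\<And>i. i < j \<Longrightarrow> A (\<phi> (Suc i)) = \<mu> *\<^sub>C \<phi> (Suc i) + \<phi> i"
proof -
  obtain \<phi> :: "nat \<Rightarrow> 'a" and j where *: "v = \<phi> j" "\<forall>i\<le>j. \<phi> i \<in> D" "\<phi> 0 \<noteq> 0" "A (\<phi> 0) = \<mu> *\<^sub>C \<phi> 0"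
    "\<forall>i\<in>{1..j}. A (\<phi> i) - \<mu> *\<^sub>C \<phi> i = \<phi> (i - 1)"
    using assms unfolding gen_eigenvectors_def by blast
  have "A (\<phi> (Suc i)) = \<mu> *\<^sub>C \<phi> (Suc i) + \<phi> i" if "i < j" for i
    using bspec[OF *(5), of "Suc i"] that by (simp add: diff_eq_eq add.commute)
  with * that show ?thesis by blast
qed

lemma gen_eigenvectors_eq_empty: "gen_eigenvectors D A \<mu> = {} \<longleftrightarrow> \<mu> \<notin> eigenvalues D A"
proof
  assume empty: "gen_eigenvectors D A \<mu> = {}"
  show "\<mu> \<notin> eigenvalues D A"
  proof
    assume "\<mu> \<in> eigenvalues D A"
    then obtain \<phi> where "\<phi> \<in> D" "\<phi> \<noteq> 0" "A \<phi> = \<mu> *\<^sub>C \<phi>"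
      by (auto simp: eigenvalues_def)
    then have "\<phi> \<in> gen_eigenvectors D A \<mu>"
      unfolding gen_eigenvectors_def by (intro CollectI exI[of _ "\<lambda>_. \<phi>"] exI[of _ 0]) auto
    with empty show False by simp
  qed
next
  assume "\<mu> \<notin> eigenvalues D A"
  then show "gen_eigenvectors D A \<mu> = {}"
    by (auto simp: eigenvalues_def elim!: gen_eigenvectorsE)
qed

lemma inj_on_class: "inj_on c {n. lam n = \<mu>}"
  using c_gap g_pos by (force intro!: inj_onI)

text \<open>A set with a uniform gap contains a given value at most once, so every eigenvalue occurs at most
  \<open>K\<close> times in the list and its generalized eigenspace is finite-dimensional.\<close>

lemma fiber: "finite {n. lam n = \<mu>}" "cfinite_dim (cspan (gen_eigenvectors D A \<mu>))"
  "card {n. lam n = \<mu>} = cdim (cspan (gen_eigenvectors D A \<mu>))"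
proof -
  have "c ` {n. lam n = \<mu>} \<subseteq> {..<K}"
    using c_less by auto
  then show fin: "finite {n. lam n = \<mu>}"
    using inj_on_class by (meson finite_imageD finite_lessThan finite_subset)
  then show fd: "cfinite_dim (cspan (gen_eigenvectors D A \<mu>))"
    using lists unfolding lists_eigenvalues_def by metis
  then show "card {n. lam n = \<mu>} = cdim (cspan (gen_eigenvectors D A \<mu>))"
    using lists unfolding lists_eigenvalues_def by metis
qed

text \<open>The members of a Jordan chain are linearly independent, since applying \<open>A - \<mu>\<close> to a
  dependence shortens it.\<close>

lemma chain_length_le:
  assumes "\<And>i. i \<le> j \<Longrightarrow> \<phi> i \<in> D" "\<phi> 0 \<noteq> 0" "A (\<phi> 0) = \<mu> *\<^sub>C \<phi> 0"
    and step: "\<And>i. i < j \<Longrightarrow> A (\<phi> (Suc i)) = \<mu> *\<^sub>C \<phi> (Suc i) + \<phi> i"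
  shows "Suc j \<le> card {n. lam n = \<mu>}"
proof -
  \<comment> \<open>\<open>A - \<mu>\<close> maps the span of the first \<open>i + 1\<close> members into the span of the first \<open>i\<close>.\<close>
  have shift: "x \<in> D \<and> A x - \<mu> *\<^sub>C x \<in> cspan (\<phi> ` {..<i})" if "x \<in> cspan (\<phi> ` {..<Suc i})" "i \<le> j" for x i
    using that(1)
  proof (induction rule: complex_vector.span_induct_alt)
    case base
    then show ?case
      by (simp add: generator_zero complex_vector.span_zero)
  next
    case (step k x y)
    then obtain l where l: "x = \<phi> l" "l \<le> i" by auto
    have "A x - \<mu> *\<^sub>C x \<in> cspan (\<phi> ` {..<i})"
    proof (cases l)
      case 0
      then show ?thesis
        using l assms(3) by (simp add: complex_vector.span_zero)
    next
      case (Suc l')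
      then have "A x - \<mu> *\<^sub>C x = \<phi> l'" "l' < i"
        using l assms(4)[of l'] that(2) by auto
      then show ?thesis
        by (auto intro: complex_vector.span_base)
    qed
    moreover have "x \<in> D"
      using l assms(1) that(2) by simp
    moreover have "A (k *\<^sub>C x + y) - \<mu> *\<^sub>C (k *\<^sub>C x + y)
        = k *\<^sub>C (A x - \<mu> *\<^sub>C x) + (A y - \<mu> *\<^sub>C y)"
      using \<open>x \<in> D\<close> step
      by (simp add: generator_add generator_scaleC scaleC_add_right scaleC_scaleC
          complex_vector.scale_right_diff_distrib mult.commute)
    ultimately show ?case
      using step by (auto intro!: generator_add generator_scaleC complex_vector.span_add
          complex_vector.span_scale)
  qed
  have new: "\<phi> i \<notin> cspan (\<phi> ` {..<i})" if "i \<le> j" for i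
    using that
  proof (induction i)
    case 0
    then show ?case using assms(2) by simp
  next
    case (Suc i)
    then show ?case
      using shift[of "\<phi> (Suc i)" i] step[of i] by auto
  qed
  have indep: "complex_vector.independent (\<phi> ` {..<i}) \<and> card (\<phi> ` {..<i}) = i" if "i \<le> Suc j" for i
    using that
  proof (induction i)
    case (Suc i)
    then have n: "\<phi> i \<notin> cspan (\<phi> ` {..<i})"
      using new by simp
    then have out: "\<phi> i \<notin> \<phi> ` {..<i}"
      by (rule contra_subsetD[OF complex_vector.span_superset])
    note IH = conjunct1[OF Suc.IH[OF Suc_leD[OF Suc.prems]]] conjunct2[OF Suc.IH[OF Suc_leD[OF Suc.prems]]]
    have "\<phi> ` {..<Suc i} = insert (\<phi> i) (\<phi> ` {..<i})"
      by (simp add: lessThan_Suc)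
    then show ?case
      using IH complex_vector.independent_insertI[OF n IH(1)] card_insert_disjoint[OF _ out] by simp
  qed (simp add: complex_vector.independent_empty)
  have "\<phi> i \<in> gen_eigenvectors D A \<mu>" if "i \<le> j" for i
  proof -
    have "A (\<phi> k) - \<mu> *\<^sub>C \<phi> k = \<phi> (k - 1)" if k: "k \<in> {1..i}" for k
    proof -
      obtain m where "k = Suc m" "m < j"
        using k \<open>i \<le> j\<close> by (cases k) auto
      then show ?thesis
        using step by simp
    qed
    then show ?thesis
      unfolding gen_eigenvectors_def using that assms(1-3)
      by (intro CollectI exI[of _ \<phi>] exI[of _ i]) auto
  qed
  then have "\<phi> ` {..<Suc j} \<subseteq> cspan (cspan (gen_eigenvectors D A \<mu>))"
    by (auto intro!: complex_vector.span_base)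
  then show ?thesis
    using card_le_cdim[OF fiber(2), of "\<phi> ` {..<Suc j}"] indep[of "Suc j"] fiber(3)[of \<mu>] by simp
qed

lemma range_lam: "range lam = eigenvalues D A"
proof -
  have "\<mu> \<in> range lam \<longleftrightarrow> \<mu> \<in> eigenvalues D A" for \<mu>
  proof (cases "\<mu> \<in> eigenvalues D A")
    case True
    then obtain v where "v \<in> gen_eigenvectors D A \<mu>"
      using gen_eigenvectors_eq_empty by blast
    then obtain \<phi> :: "nat \<Rightarrow> 'a" and j :: nat where "\<And>i. i \<le> j \<Longrightarrow> \<phi> i \<in> D" "\<phi> 0 \<noteq> 0" "A (\<phi> 0) = \<mu> *\<^sub>C \<phi> 0"
      "\<And>i. i < j \<Longrightarrow> A (\<phi> (Suc i)) = \<mu> *\<^sub>C \<phi> (Suc i) + \<phi> i"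
      by (elim gen_eigenvectorsE) blast
    then have "card {n. lam n = \<mu>} \<noteq> 0"
      using chain_length_le[of j \<phi> \<mu>] by simp
    then show ?thesis
      using True by (auto simp: card_eq_0_iff)
  next
    case False
    then have "card {n. lam n = \<mu>} = 0"
      using fiber(3)[of \<mu>] gen_eigenvectors_eq_empty[of \<mu>] complex_vector.dim_eq_card_independent[of "{}"]
      by (simp add: complex_vector.independent_empty)
    then show ?thesis
      using False fiber(1)[of \<mu>] by auto
  qed
  then show ?thesis by blast
qed

sublocale separated_classes lam a g K c
proof
  show "\<bar>Re (lam n)\<bar> < a" for n
    using eigenvalue_strip range_lam by auto
qed (use g_pos c_less c_gap in auto)

text \<open>Vectors on which the resolvent is a rational function that vanishes at infinity, with a
  common denominator built from finitely many members of the eigenvalue list.\<close>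

definition rational_resolvent :: "'a \<Rightarrow> nat set \<Rightarrow> (complex \<Rightarrow> 'a) \<Rightarrow> bool" where
  "rational_resolvent w J G \<longleftrightarrow> finite J \<and>
    (\<forall>z. z \<notin> lam ` J \<longrightarrow> G z \<in> D \<and> z *\<^sub>C G z - A (G z) = w) \<and>
    (\<forall>y. ((\<lambda>z. cinner (G z) y) \<longlongrightarrow> 0) at_infinity) \<and>
    (\<forall>y. \<exists>H. H holomorphic_on UNIV \<and>
      (\<forall>z. z \<notin> lam ` J \<longrightarrow> H z = (\<Prod>n\<in>J. z - lam n) * cinner (G z) y))"

lemma rational_resolvent_mono:
  assumes "rational_resolvent w J G" "J \<subseteq> J'" "finite J'"
  shows "rational_resolvent w J' G"
  unfolding rational_resolvent_def
proof (intro conjI allI impI)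
  show "G z \<in> D" "z *\<^sub>C G z - A (G z) = w" if "z \<notin> lam ` J'" for z
    using assms that unfolding rational_resolvent_def by (meson image_mono subsetD)+
next
  fix y
  obtain H where H: "H holomorphic_on UNIV" "\<And>z. z \<notin> lam ` J \<Longrightarrow> H z = (\<Prod>n\<in>J. z - lam n) * cinner (G z) y"
    using assms(1) unfolding rational_resolvent_def by blast
  have split: "(\<Prod>n\<in>J'. z - lam n) = (\<Prod>n\<in>J' - J. z - lam n) * (\<Prod>n\<in>J. z - lam n)" for z
    using assms(2,3) by (rule prod.subset_diff)
  show "\<exists>H. H holomorphic_on UNIV \<and> (\<forall>z. z \<notin> lam ` J' \<longrightarrow> H z = (\<Prod>n\<in>J'. z - lam n) * cinner (G z) y)"
    unfolding split using H assms(2)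
    by (intro exI[of _ "\<lambda>z. (\<Prod>n\<in>J' - J. z - lam n) * H z"]) (auto intro!: holomorphic_intros)
qed (use assms in \<open>auto simp: rational_resolvent_def\<close>)

lemma rational_resolvent_combine:
  assumes "rational_resolvent v J G" "rational_resolvent w J F"
  shows "rational_resolvent (k *\<^sub>C v + w) J (\<lambda>z. k *\<^sub>C G z + F z)"
  unfolding rational_resolvent_def
proof (intro conjI allI impI)
  fix z assume "z \<notin> lam ` J"
  then have *: "G z \<in> D" "z *\<^sub>C G z - A (G z) = v" "F z \<in> D" "z *\<^sub>C F z - A (F z) = w"
    using assms by (auto simp: rational_resolvent_def)
  then show "k *\<^sub>C G z + F z \<in> D"
    by (intro generator_add generator_scaleC)
  show "z *\<^sub>C (k *\<^sub>C G z + F z) - A (k *\<^sub>C G z + F z) = k *\<^sub>C v + w"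
    unfolding *(2)[symmetric] *(4)[symmetric] using *(1,3)
    by (simp add: generator_add generator_scaleC scaleC_add_right scaleC_scaleC
          complex_vector.scale_right_diff_distrib mult.commute)
next
  fix y
  have "((\<lambda>z. k * cinner (G z) y + cinner (F z) y) \<longlongrightarrow> k * 0 + 0) at_infinity"
    using assms unfolding rational_resolvent_def by (intro tendsto_intros) auto
  then show "((\<lambda>z. cinner (k *\<^sub>C G z + F z) y) \<longlongrightarrow> 0) at_infinity"
    by (simp add: cinner_add_left cinner_scaleC_left)
  obtain H H' where "H holomorphic_on UNIV" "\<And>z. z \<notin> lam ` J \<Longrightarrow> H z = (\<Prod>n\<in>J. z - lam n) * cinner (G z) y"
    "H' holomorphic_on UNIV" "\<And>z. z \<notin> lam ` J \<Longrightarrow> H' z = (\<Prod>n\<in>J. z - lam n) * cinner (F z) y"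
    using assms unfolding rational_resolvent_def by metis
  then show "\<exists>H. H holomorphic_on UNIV \<and>
      (\<forall>z. z \<notin> lam ` J \<longrightarrow> H z = (\<Prod>n\<in>J. z - lam n) * cinner (k *\<^sub>C G z + F z) y)"
    by (intro exI[of _ "\<lambda>z. k * H z + H' z"])
      (auto intro!: holomorphic_intros simp: cinner_add_left cinner_scaleC_left algebra_simps)
qed (use assms in \<open>auto simp: rational_resolvent_def\<close>)

lemma chain_resolvent_equation:
  assumes "\<And>i. i \<le> j \<Longrightarrow> \<phi> i \<in> D" "A (\<phi> 0) = \<mu> *\<^sub>C \<phi> 0"
    and "\<And>i. i < j \<Longrightarrow> A (\<phi> (Suc i)) = \<mu> *\<^sub>C \<phi> (Suc i) + \<phi> i" and z: "z \<noteq> \<mu>"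
  shows "chain_resolvent \<phi> \<mu> j z \<in> D \<and> z *\<^sub>C chain_resolvent \<phi> \<mu> j z - A (chain_resolvent \<phi> \<mu> j z) = \<phi> j"
  using assms(1,3)
proof (induction j)
  case 0
  have "(1 / (z - \<mu>)) *\<^sub>C (z *\<^sub>C \<phi> 0 - \<mu> *\<^sub>C \<phi> 0) = \<phi> 0"
    using z by (simp add: complex_vector.scale_left_diff_distrib[symmetric] scaleC_scaleC scaleC_one)
  then show ?case
    using 0 assms(2)
    by (simp add: chain_resolvent_0 generator_scaleC scaleC_scaleC
        complex_vector.scale_right_diff_distrib mult.commute)
next
  case (Suc j)
  define x where "x = chain_resolvent \<phi> \<mu> j z"
  define y where "y = \<phi> (Suc j)"
  have x: "x \<in> D" "z *\<^sub>C x - A x = \<phi> j"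
    using Suc by (auto simp: x_def)
  have y: "y \<in> D" "A y = \<mu> *\<^sub>C y + \<phi> j"
    using Suc.prems by (auto simp: y_def)
  have "z *\<^sub>C ((1 / (z - \<mu>)) *\<^sub>C (y + x)) - A ((1 / (z - \<mu>)) *\<^sub>C (y + x))
      = (1 / (z - \<mu>)) *\<^sub>C ((z *\<^sub>C y - A y) + (z *\<^sub>C x - A x))"
    using x(1) y(1) by (simp add: generator_add generator_scaleC scaleC_scaleC scaleC_add_right
        complex_vector.scale_right_diff_distrib mult.commute)
  also have "\<dots> = (1 / (z - \<mu>)) *\<^sub>C ((z - \<mu>) *\<^sub>C y)"
    unfolding x(2) y(2) by (simp add: complex_vector.scale_left_diff_distrib)
  also have "\<dots> = y"
    using z by (simp add: scaleC_scaleC scaleC_one)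
  finally show ?case
    using x y by (simp add: chain_resolvent_Suc x_def[symmetric] y_def[symmetric] generator_add generator_scaleC)
qed

lemma rational_resolvent_chain:
  assumes "\<And>i. i \<le> j \<Longrightarrow> \<phi> i \<in> D" "\<phi> 0 \<noteq> 0" "A (\<phi> 0) = \<mu> *\<^sub>C \<phi> 0"
    and "\<And>i. i < j \<Longrightarrow> A (\<phi> (Suc i)) = \<mu> *\<^sub>C \<phi> (Suc i) + \<phi> i"
  shows "rational_resolvent (\<phi> j) {n. lam n = \<mu>} (chain_resolvent \<phi> \<mu> j)"
proof -
  define p where "p = card {n. lam n = \<mu>}"
  have p: "j < p"
    using chain_length_le[of j \<phi> \<mu>, OF assms] by (simp add: p_def)
  then have "{n. lam n = \<mu>} \<noteq> {}"
    unfolding p_def by (metis card.empty not_less_zero)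
  then have im: "lam ` {n. lam n = \<mu>} = {\<mu>}"
    by auto
  have prod: "(\<Prod>n\<in>{n. lam n = \<mu>}. z - lam n) = (z - \<mu>) ^ p" for z
    unfolding p_def prod_constant[symmetric] by (intro prod.cong) auto
  show ?thesis
    unfolding rational_resolvent_def im prod
  proof (intro conjI allI impI)
    fix z assume "z \<notin> {\<mu>}"
    then show "chain_resolvent \<phi> \<mu> j z \<in> D" "z *\<^sub>C chain_resolvent \<phi> \<mu> j z - A (chain_resolvent \<phi> \<mu> j z) = \<phi> j"
      using chain_resolvent_equation[of j \<phi> \<mu> z, OF assms(1,3,4)] by auto
  next
    fix y
    have cin: "cinner (chain_resolvent \<phi> \<mu> j z) y = (\<Sum>i\<le>j. (1 / (z - \<mu>) ^ Suc i) * cinner (\<phi> (j - i)) y)" for z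
      by (simp add: chain_resolvent_def cinner_sum_left cinner_scaleC_left)
    have "((\<lambda>z. 1 / (z - \<mu>)) \<longlongrightarrow> 0) at_infinity"
      unfolding diff_conv_add_uminus
      by (rule tendsto_divide_0[OF tendsto_const
            tendsto_add_filterlim_at_infinity'[OF filterlim_ident tendsto_const]])
    then have "((\<lambda>z. \<Sum>i\<le>j. (1 / (z - \<mu>)) ^ Suc i * cinner (\<phi> (j - i)) y) \<longlongrightarrow>
        (\<Sum>i\<le>j. 0 ^ Suc i * cinner (\<phi> (j - i)) y)) at_infinity"
      by (intro tendsto_intros)
    then show "((\<lambda>z. cinner (chain_resolvent \<phi> \<mu> j z) y) \<longlongrightarrow> 0) at_infinity"
      by (simp add: cin power_one_over)
    have "(z - \<mu>) ^ p * (1 / (z - \<mu>) ^ Suc i) = (z - \<mu>) ^ (p - Suc i)" if "i \<le> j" "z \<noteq> \<mu>" for i z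
    proof -
      have "(z - \<mu>) ^ p = (z - \<mu>) ^ (p - Suc i) * (z - \<mu>) ^ Suc i"
        using p that(1) by (simp only: power_add[symmetric]) simp
      then show ?thesis
        using that(2) by simp
    qed
    then show "\<exists>H. H holomorphic_on UNIV \<and>
        (\<forall>z. z \<notin> {\<mu>} \<longrightarrow> H z = (z - \<mu>) ^ p * cinner (chain_resolvent \<phi> \<mu> j z) y)"
      unfolding cin sum_distrib_left mult.assoc[symmetric]
      by (intro exI[of _ "\<lambda>z. \<Sum>i\<le>j. (z - \<mu>) ^ (p - Suc i) * cinner (\<phi> (j - i)) y"])
        (auto intro!: holomorphic_intros sum.cong)
  qed (rule fiber(1))
qed

abbreviation eigenspan :: "'a set" where
  "eigenspan \<equiv> cspan (\<Union>\<mu>. gen_eigenvectors D A \<mu>)"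

lemma rational_resolvent_eigenspan:
  assumes "w \<in> eigenspan"
  shows "\<exists>J G. rational_resolvent w J G"
  using assms
proof (induction rule: complex_vector.span_induct_alt)
  case base
  have "rational_resolvent 0 {} (\<lambda>_. 0)"
    unfolding rational_resolvent_def
    by (auto simp: generator_zero intro: exI[of _ "\<lambda>_. 0"])
  then show ?case by blast
next
  case (step k x y)
  then obtain \<mu> where "x \<in> gen_eigenvectors D A \<mu>"
    by blast
  then obtain J G where 1: "rational_resolvent x J G"
    using rational_resolvent_chain by (elim gen_eigenvectorsE) blast
  obtain J' G' where 2: "rational_resolvent y J' G'"
    using step by blast
  have fin: "finite J" "finite J'"
    using 1 2 by (auto simp: rational_resolvent_def)
  have "rational_resolvent x (J \<union> J') G" "rational_resolvent y (J \<union> J') G'"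
    using 1 2 fin by (auto intro: rational_resolvent_mono)
  then show ?case
    using rational_resolvent_combine by blast
qed

section \<open>Uniform resolvent bounds\<close>

text \<open>Multiplying the scalar function \<open>cinner (G \<zeta>) y\<close> by a Blaschke product removes its poles
  without changing its modulus on the line \<open>Re \<zeta> = - a\<close>, where the a priori bound holds. The
  maximum principle carries the bound inside, at the cost of the Blaschke product at \<open>z\<close>, and
  that is bounded below away from the eigenvalues.\<close>

lemma eigenspan_resolvent_bound:
  assumes "\<delta> > 0"
  shows "\<exists>C\<ge>0. \<forall>z. (\<forall>n. \<delta> \<le> cmod (z - lam n)) \<longrightarrow>
    (\<forall>w\<in>eigenspan. \<exists>u\<in>D. z *\<^sub>C u - A u = w \<and> norm u \<le> C * norm w)"
proof -
  obtain C where C: "C \<ge> 0" "\<And>z J. finite J \<Longrightarrow> Re z \<le> a \<Longrightarrow> (\<forall>n. \<delta> \<le> cmod (z - lam n)) \<Longrightarrow>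
    (\<Prod>n\<in>J. cmod (z + cnj (lam n) + 2 * a)) \<le> C * (\<Prod>n\<in>J. cmod (z - lam n))"
    using blaschke_lower_bound[OF assms] by metis
  define B where "B = 4 * pi * M"
  have B: "B \<ge> 0"
    using M by (simp add: B_def)
  have "\<exists>u\<in>D. z *\<^sub>C u - A u = w \<and> norm u \<le> max B (B * C) * norm w"
    if z: "\<forall>n. \<delta> \<le> cmod (z - lam n)" and w: "w \<in> eigenspan" for z w
  proof -
    obtain J G where JG: "rational_resolvent w J G"
      using rational_resolvent_eigenspan[OF w] by blast
    have J: "finite J" and G: "\<And>\<zeta>. \<zeta> \<notin> lam ` J \<Longrightarrow> G \<zeta> \<in> D \<and> \<zeta> *\<^sub>C G \<zeta> - A (G \<zeta>) = w"
      and lim: "\<And>y. ((\<lambda>\<zeta>. cinner (G \<zeta>) y) \<longlongrightarrow> 0) at_infinity"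
      using JG by (auto simp: rational_resolvent_def)
    have pos: "cmod (z - lam n) > 0" for n
      using spec[OF z, of n] assms by linarith
    then have nin: "z \<notin> lam ` J"
      by force
    have edge: "norm (G \<zeta>) \<le> B * norm w" if "\<bar>Re \<zeta>\<bar> \<ge> a" for \<zeta>
    proof -
      have "\<zeta> \<notin> lam ` J"
        using strip that by (metis image_iff not_le)
      then show ?thesis
        using G[of \<zeta>] apriori_bound[of "G \<zeta>" \<zeta>] that by (auto simp: B_def)
    qed
    have "norm (G z) \<le> max B (B * C) * norm w"
    proof (cases "\<bar>Re z\<bar> \<ge> a")
      case True
      then show ?thesis
        using edge[OF True] mult_right_mono[of B "max B (B * C)" "norm w"] by simp
    next
      case False
      \<comment> \<open>Testing against \<open>G z\<close> itself recovers the norm of \<open>G z\<close>.\<close>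
      define y where "y = G z"
      obtain H where H: "H holomorphic_on UNIV"
          "\<And>\<zeta>. \<zeta> \<notin> lam ` J \<Longrightarrow> H \<zeta> = (\<Prod>n\<in>J. \<zeta> - lam n) * cinner (G \<zeta>) y"
        using JG unfolding rational_resolvent_def by blast
      define P where "P = (\<Prod>n\<in>J. cmod (z - lam n))"
      have P: "P > 0"
        unfolding P_def using pos by (intro prod_pos) auto
      have "cmod (H z) \<le> (B * norm w * norm y) * (\<Prod>n\<in>J. cmod (z + cnj (lam n) + 2 * a))"
      proof (rule half_plane_maximum_principle[OF H(1) J H(2) lim])
        show "cmod (cinner (G \<zeta>) y) \<le> B * norm w * norm y" if "Re \<zeta> = - a" for \<zeta>
        proof -
          have "norm (G \<zeta>) * norm y \<le> B * norm w * norm y"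
            using edge[of \<zeta>] that by (intro mult_right_mono) auto
          then show ?thesis
            using norm_cinner_le[of "G \<zeta>" y] by linarith
        qed
      qed (use False in auto)
      also have "\<dots> \<le> (B * norm w * norm y) * (C * P)"
        unfolding P_def using C(2)[OF J _ z] False B by (intro mult_left_mono) auto
      also have "cmod (H z) = P * (norm y)\<^sup>2"
        using H(2)[OF nin] by (simp add: P_def norm_mult prod_norm y_def cinner_self norm_power)
      finally have "P * (norm y * norm y) \<le> P * (B * C * norm w * norm y)"
        by (simp add: power2_eq_square mult_ac)
      then have "norm y * norm y \<le> B * C * norm w * norm y"
        using P by simp
      then have "norm y \<le> B * C * norm w"
        using B C(1) by (cases "y = 0") auto
      also have "\<dots> \<le> max B (B * C) * norm w"
        by (intro mult_right_mono) auto
      finally show ?thesis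
        by (simp add: y_def)
    qed
    then show ?thesis
      using G[OF nin] by blast
  qed
  moreover have "max B (B * C) \<ge> 0"
    using B by simp
  ultimately show ?thesis by blast
qed

lemma injective_off_eigenvalues:
  assumes "z \<notin> range lam" "u \<in> D" "v \<in> D" "z *\<^sub>C u - A u = z *\<^sub>C v - A v"
  shows "u = v"
proof (rule ccontr)
  assume "u \<noteq> v"
  moreover have "A (u - v) = z *\<^sub>C (u - v)" "u - v \<in> D"
    using assms by (auto simp: generator_diff complex_vector.scale_right_diff_distrib algebra_simps)
  ultimately have "z \<in> eigenvalues D A"
    unfolding eigenvalues_def using right_minus_eq[of u v] by blast
  with assms(1) range_lam show False by simp
qed

text \<open>Solutions for an approximating sequence in the span of the generalized eigenvectors form a Cauchy
  sequence, and closedness of \<open>A\<close> identifies its limit.\<close>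

lemma resolvent_solution_bound:
  assumes "\<delta> > 0"
  shows "\<exists>C\<ge>0. \<forall>z. (\<forall>n. \<delta> \<le> cmod (z - lam n)) \<longrightarrow>
    (\<forall>x. \<exists>u\<in>D. z *\<^sub>C u - A u = x \<and> norm u \<le> C * norm x)"
proof -
  obtain C where C: "C \<ge> 0" "\<And>z w. (\<forall>n. \<delta> \<le> cmod (z - lam n)) \<Longrightarrow> w \<in> eigenspan \<Longrightarrow>
      \<exists>u\<in>D. z *\<^sub>C u - A u = w \<and> norm u \<le> C * norm w"
    using eigenspan_resolvent_bound[OF assms] by metis
  have "\<exists>u\<in>D. z *\<^sub>C u - A u = x \<and> norm u \<le> C * norm x"
    if z: "\<forall>n. \<delta> \<le> cmod (z - lam n)" for z x
  proof -
    have nin: "z \<notin> range lam"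
    proof
      assume "z \<in> range lam"
      then obtain n where "z = lam n" by blast
      with spec[OF z, of n] assms show False by simp
    qed
    obtain R where R: "\<And>w. w \<in> eigenspan \<Longrightarrow> R w \<in> D \<and> z *\<^sub>C R w - A (R w) = w \<and> norm (R w) \<le> C * norm w"
      using C(2)[OF z] by metis
    have R_eq: "z *\<^sub>C R w - A (R w) = w" if "w \<in> eigenspan" for w
      using R[OF that] by blast
    have R_diff: "norm (R v - R w) \<le> C * norm (v - w)" if "v \<in> eigenspan" "w \<in> eigenspan" for v w
    proof -
      have d: "v - w \<in> eigenspan"
        using that by (rule complex_vector.span_diff)
      have D: "R v \<in> D" "R w \<in> D" "R (v - w) \<in> D"
        using R that d by blast+
      have "z *\<^sub>C (R v - R w) - A (R v - R w) = (z *\<^sub>C R v - A (R v)) - (z *\<^sub>C R w - A (R w))"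
        unfolding generator_diff(2)[OF D(1,2)] complex_vector.scale_right_diff_distrib
        by (simp add: diff_diff_eq2 add.commute diff_add_eq)
      also have "\<dots> = z *\<^sub>C R (v - w) - A (R (v - w))"
        by (simp only: R_eq[OF that(1)] R_eq[OF that(2)] R_eq[OF d])
      finally have "R v - R w = R (v - w)"
        by (rule injective_off_eigenvalues[OF nin generator_diff(1)[OF D(1,2)] D(3)])
      then show ?thesis
        using R[OF d] by simp
    qed
    have "x \<in> closure eigenspan"
      using dense by simp
    then obtain w where w: "\<And>n. w n \<in> eigenspan" "w \<longlonglongrightarrow> x"
      by (auto simp: closure_sequential)
    have "Cauchy (\<lambda>n. R (w n))"
    proof (rule metric_CauchyI)
      fix e :: real assume "e > 0"
      then have "e / (C + 1) > 0"
        using C(1) by simp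
      then obtain N where N: "\<And>m n. m \<ge> N \<Longrightarrow> n \<ge> N \<Longrightarrow> dist (w m) (w n) < e / (C + 1)"
        using LIMSEQ_imp_Cauchy[OF w(2)] unfolding Cauchy_def by metis
      have "dist (R (w m)) (R (w n)) < e" if "m \<ge> N" "n \<ge> N" for m n
      proof -
        have "norm (R (w m) - R (w n)) \<le> C * norm (w m - w n)"
          using w(1) by (intro R_diff)
        also have "\<dots> \<le> (C + 1) * norm (w m - w n)"
          by (intro mult_right_mono) auto
        also have "\<dots> < e"
          using N[OF that] C(1) by (simp add: dist_norm field_simps)
        finally show ?thesis
          by (simp add: dist_norm)
      qed
      then show "\<exists>N. \<forall>m\<ge>N. \<forall>n\<ge>N. dist (R (w m)) (R (w n)) < e"
        by blast
    qed
    then obtain u where u: "(\<lambda>n. R (w n)) \<longlonglongrightarrow> u"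
      using Cauchy_convergent convergent_def by blast
    have AR: "A (R (w n)) = z *\<^sub>C R (w n) - w n" for n
      using R[OF w(1)[of n]] by (metis diff_diff_eq2 add_diff_cancel_left')
    have lim: "(\<lambda>n. A (R (w n))) \<longlonglongrightarrow> z *\<^sub>C u - x"
      unfolding AR by (intro tendsto_diff scaleC.tendsto tendsto_const u w(2))
    have "u \<in> D" "A u = z *\<^sub>C u - x"
      using generator_closed[OF _ u lim] R w(1) by blast+
    moreover have "norm u \<le> C * norm x"
    proof (rule LIMSEQ_le)
      show "(\<lambda>n. norm (R (w n))) \<longlonglongrightarrow> norm u" "(\<lambda>n. C * norm (w n)) \<longlonglongrightarrow> C * norm x"
        by (intro tendsto_intros u w(2))+
      show "\<exists>N. \<forall>n\<ge>N. norm (R (w n)) \<le> C * norm (w n)"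
        using R w(1) by blast
    qed
    ultimately show ?thesis
      by (intro bexI[of _ u]) auto
  qed
  with C(1) show ?thesis by blast
qed

abbreviation Res :: "complex \<Rightarrow> 'a \<Rightarrow> 'a" where
  "Res \<equiv> resolvent D A"

lemma Res_unique:
  assumes "z \<notin> range lam" "u \<in> D"
  shows "Res z (z *\<^sub>C u - A u) = u"
  unfolding resolvent_def using assms injective_off_eigenvalues
  by (intro inv_into_f_f inj_onI) blast+

lemma Res_solves:
  assumes "z \<notin> range lam"
  shows "Res z x \<in> D" "z *\<^sub>C Res z x - A (Res z x) = x"
proof -
  obtain \<delta> where \<delta>: "\<delta> > 0" "\<forall>n. \<delta> \<le> cmod (z - lam n)"
    using positive_distance[OF assms] by blast
  obtain u where u: "u \<in> D" "z *\<^sub>C u - A u = x"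
    using resolvent_solution_bound[OF \<delta>(1)] \<delta>(2) by metis
  then have "Res z x = u"
    using Res_unique[OF assms u(1)] by simp
  with u show "Res z x \<in> D" "z *\<^sub>C Res z x - A (Res z x) = x"
    by auto
qed

lemma Res_bound:
  assumes "\<delta> > 0"
  shows "\<exists>C\<ge>0. \<forall>z. (\<forall>n. \<delta> \<le> cmod (z - lam n)) \<longrightarrow> (\<forall>x. norm (Res z x) \<le> C * norm x)"
proof -
  obtain C where C: "C \<ge> 0" "\<And>z x. (\<forall>n. \<delta> \<le> cmod (z - lam n)) \<Longrightarrow>
      \<exists>u\<in>D. z *\<^sub>C u - A u = x \<and> norm u \<le> C * norm x"
    using resolvent_solution_bound[OF assms] by metis
  have "norm (Res z x) \<le> C * norm x" if z: "\<forall>n. \<delta> \<le> cmod (z - lam n)" for z x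
  proof -
    have "z \<notin> range lam"
    proof
      assume "z \<in> range lam"
      then obtain n where "z = lam n" by blast
      with spec[OF z, of n] assms show False by simp
    qed
    then show ?thesis
      using C(2)[OF z, of x] Res_unique by auto
  qed
  with C(1) show ?thesis by blast
qed

lemma Res_bounded_clinear:
  assumes "z \<notin> range lam"
  shows "bounded_clinear (Res z)"
proof -
  obtain \<delta> where \<delta>: "\<delta> > 0" "\<forall>n. \<delta> \<le> cmod (z - lam n)"
    using positive_distance[OF assms] by blast
  obtain C where C: "\<And>x. norm (Res z x) \<le> C * norm x"
    using Res_bound[OF \<delta>(1)] \<delta>(2) by metis
  note R = Res_solves[OF assms]
  have add: "Res z (x + y) = Res z x + Res z y" for x y
    using Res_unique[OF assms generator_add(1)[OF R(1)[of x] R(1)[of y]]] R(2)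
    by (simp add: generator_add R(1) scaleC_add_right add_diff_add)
  have scale: "Res z (k *\<^sub>C x) = k *\<^sub>C Res z x" for k x
  proof -
    have "z *\<^sub>C (k *\<^sub>C Res z x) - A (k *\<^sub>C Res z x) = k *\<^sub>C (z *\<^sub>C Res z x - A (Res z x))"
      by (simp add: generator_scaleC R(1) complex_vector.scale_right_diff_distrib scaleC_scaleC mult.commute)
    then show ?thesis
      using Res_unique[OF assms generator_scaleC(1)[OF R(1)[of x]], of k] R(2) by simp
  qed
  have "bounded_linear (Res z)"
    using C by (intro bounded_linear_intro[of _ C]) (auto simp: add scale scaleR_scaleC mult.commute)
  then show ?thesis
    by (simp add: bounded_clinear_def scale)
qed

lemma resolvent_set_eq: "resolvent_set D A = - range lam"
proof (intro equalityI subsetI)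
  fix z assume z: "z \<in> - range lam"
  have "bij_betw (\<lambda>x. z *\<^sub>C x - A x) D UNIV"
    using z Res_solves[of z] injective_off_eigenvalues[of z]
    by (auto simp: bij_betw_def inj_on_def image_iff) metis
  then show "z \<in> resolvent_set D A"
    using z Res_bounded_clinear by (simp add: resolvent_set_def)
next
  fix z assume "z \<in> resolvent_set D A"
  then have inj: "inj_on (\<lambda>x. z *\<^sub>C x - A x) D"
    by (simp add: resolvent_set_def bij_betw_def)
  show "z \<in> - range lam"
  proof
    assume "z \<in> range lam"
    then obtain \<phi> where "\<phi> \<in> D" "\<phi> \<noteq> 0" "A \<phi> = z *\<^sub>C \<phi>"
      using range_lam by (auto simp: eigenvalues_def)
    then show False
      using inj_onD[OF inj, of \<phi> 0] generator_zero by simp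
  qed
qed

lemma spectrum_eq: "spectrum D A = range lam"
  by (simp add: spectrum_def resolvent_set_eq)

lemma resolvent_identity:
  assumes "z \<notin> range lam" "\<mu> \<notin> range lam"
  shows "Res z x = Res \<mu> (x + (\<mu> - z) *\<^sub>C Res z x)"
    and "Res z x = Res \<mu> x + (\<mu> - z) *\<^sub>C Res z (Res \<mu> x)"
proof -
  have "\<mu> *\<^sub>C Res z x - A (Res z x) = x + (\<mu> - z) *\<^sub>C Res z x"
    using Res_solves(2)[OF assms(1), of x]
    by (simp add: complex_vector.scale_left_diff_distrib algebra_simps)
  then show "Res z x = Res \<mu> (x + (\<mu> - z) *\<^sub>C Res z x)"
    using Res_unique[OF assms(2) Res_solves(1)[OF assms(1)], of x] by simp
  define y where "y = Res \<mu> x"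
  have y: "y \<in> D" "\<mu> *\<^sub>C y - A y = x"
    using Res_solves[OF assms(2)] by (auto simp: y_def)
  define u where "u = y + (\<mu> - z) *\<^sub>C Res z y"
  note R = Res_solves[OF assms(1), of y]
  have "u \<in> D"
    unfolding u_def by (intro generator_add(1) generator_scaleC(1) y R)
  moreover have "z *\<^sub>C u - A u = (z *\<^sub>C y - A y) + (\<mu> - z) *\<^sub>C (z *\<^sub>C Res z y - A (Res z y))"
    unfolding u_def using R(1) y(1)
    by (simp add: generator_add generator_scaleC scaleC_add_right scaleC_scaleC
        complex_vector.scale_right_diff_distrib mult.commute)
  then have "z *\<^sub>C u - A u = x"
    using R(2) y(2) by (simp add: complex_vector.scale_left_diff_distrib)
  ultimately show "Res z x = Res \<mu> x + (\<mu> - z) *\<^sub>C Res z (Res \<mu> x)"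
    using Res_unique[OF assms(1)] by (metis u_def y_def)
qed

end

section \<open>Clusters of eigenvalues\<close>

context separated_classes
begin

text \<open>The ratio four between the distances of outer and inner members makes the member sets of two
  isolating discs nested as soon as they intersect, so that the largest ones form a partition.\<close>

definition radius :: "nat \<Rightarrow> real" where
  "radius j = g / 2 / 4 ^ j"

definition isolating :: "complex \<Rightarrow> nat \<Rightarrow> bool" where
  "isolating z j \<longleftrightarrow> j < K \<and> (\<forall>n. dist z (lam n) < radius j \<longrightarrow> dist z (lam n) < radius j / 4)"

definition level :: "nat \<Rightarrow> nat" where
  "level n = (LEAST j. \<exists>z. isolating z j \<and> dist z (lam n) < radius j)"

definition centre :: "nat \<Rightarrow> complex" where
  "centre n = (SOME z. isolating z (level n) \<and> dist z (lam n) < radius (level n))"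

definition cluster :: "nat \<Rightarrow> nat set" where
  "cluster n = {m. dist (centre n) (lam m) < radius (level n)}"

lemma radius_pos: "radius j > 0"
  using gap_pos by (simp add: radius_def)

lemma radius_Suc: "radius (Suc j) = radius j / 4"
  by (simp add: radius_def)

lemma radius_antimono: "i \<le> j \<Longrightarrow> radius j \<le> radius i"
  unfolding radius_def using gap_pos by (intro divide_left_mono) (auto intro: power_increasing)

text \<open>At most \<open>K\<close> members lie within \<open>g / 2\<close> of a given one, so their number cannot drop at each
  of \<open>K\<close> successive reductions of the radius.\<close>

lemma isolating_exists: "\<exists>j. isolating (lam n) j"
proof (rule ccontr)
  assume no: "\<nexists>j. isolating (lam n) j"
  \<comment> \<open>By assumption every step from \<open>j\<close> to \<open>j + 1\<close> loses a member.\<close>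
  define Q where "Q j = {m. dist (lam n) (lam m) < radius j}" for j
  have fin: "finite (Q j)" for j
    unfolding Q_def using radius_antimono[of 0 j] by (intro ball_indices) (simp add: radius_def)
  have "card (Q j) + j \<le> K" if "j \<le> K" for j
    using that
  proof (induction j)
    case 0
    then show ?case
      using ball_indices(2)[of "radius 0" "lam n"] by (simp add: Q_def radius_def)
  next
    case (Suc j)
    have "\<not> isolating (lam n) j" "j < K"
      using no Suc.prems by auto
    then obtain m where "m \<in> Q j" "m \<notin> Q (Suc j)"
      unfolding isolating_def Q_def radius_Suc by blast
    moreover have "Q (Suc j) \<subseteq> Q j"
      using radius_antimono[of j "Suc j"] by (auto simp: Q_def)
    ultimately have "card (Q (Suc j)) < card (Q j)"
      using fin by (intro psubset_card_mono) auto
    then show ?case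
      using Suc by simp
  qed
  then have "card (Q K) = 0"
    by force
  moreover have "n \<in> Q K"
    using radius_pos by (simp add: Q_def)
  ultimately show False
    using fin by auto
qed

lemma centre: "isolating (centre n) (level n)" "dist (centre n) (lam n) < radius (level n)"
proof -
  have "\<exists>j z. isolating z j \<and> dist z (lam n) < radius j"
    using isolating_exists[of n] radius_pos by (metis dist_self)
  then have "\<exists>z. isolating z (level n) \<and> dist z (lam n) < radius (level n)"
    unfolding level_def by (rule LeastI_ex)
  then have "isolating (centre n) (level n) \<and> dist (centre n) (lam n) < radius (level n)"
    unfolding centre_def by (rule someI_ex)
  then show "isolating (centre n) (level n)" "dist (centre n) (lam n) < radius (level n)"
    by auto
qed

lemma self_in_cluster: "n \<in> cluster n"
  using centre(2) by (simp add: cluster_def)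

lemma level_le: "isolating z j \<Longrightarrow> dist z (lam n) < radius j \<Longrightarrow> level n \<le> j"
  unfolding level_def by (rule Least_le) blast

lemma in_cluster_dist: "m \<in> cluster n \<Longrightarrow> dist (centre n) (lam m) < radius (level n) / 4"
  using centre(1) by (auto simp: cluster_def isolating_def)

lemma notin_cluster_dist: "m \<notin> cluster n \<Longrightarrow> radius (level n) \<le> dist (centre n) (lam m)"
  by (simp add: cluster_def)

text \<open>If the disc of \<open>m\<close> were larger than that of \<open>n\<close>, it would contain \<open>lam n\<close>, against the choice of
  the largest isolating disc for \<open>n\<close>; two discs of equal size that share a member have the same
  members.\<close>

lemma cluster_eq:
  assumes "m \<in> cluster n"
  shows "cluster m = cluster n"
proof -
  have dm: "dist (centre n) (lam m) < radius (level n) / 4"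
    and dn: "dist (centre n) (lam n) < radius (level n) / 4"
    and dm': "dist (centre m) (lam m) < radius (level m) / 4"
    using in_cluster_dist assms self_in_cluster by auto
  have le: "level m \<le> level n"
    using dm radius_pos[of "level n"] by (intro level_le[OF centre(1)]) linarith
  have "dist (centre m) (lam n) < radius (level m)"
    using dm dn dm' radius_antimono[OF le] dist_triangle[of "centre m" "lam n" "lam m"]
      dist_triangle3[of "lam m" "lam n" "centre n"] radius_pos[of "level m"] by linarith
  then have "level n \<le> level m"
    by (rule level_le[OF centre(1)])
  with le have level: "level m = level n" by simp
  have near: "dist (centre m) (centre n) < radius (level n) / 2"
    using dm dm'[unfolded level] dist_triangle2[of "centre m" "centre n" "lam m"] by linarith
  show ?thesis
  proof (intro equalityI subsetI)
    fix p assume "p \<in> cluster m"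
    then have "dist (centre n) (lam p) < radius (level n)"
      using in_cluster_dist[of p m, unfolded level] near radius_pos[of "level n"]
        dist_triangle3[of "centre n" "lam p" "centre m"] by linarith
    then show "p \<in> cluster n"
      by (simp add: cluster_def)
  next
    fix p assume "p \<in> cluster n"
    then have "dist (centre m) (lam p) < radius (level m)"
      unfolding level using in_cluster_dist[of p n] near radius_pos[of "level n"]
        dist_triangle[of "centre m" "lam p" "centre n"] by linarith
    then show "p \<in> cluster m"
      by (simp add: cluster_def)
  qed
qed

lemma radius_level_le: "radius (level n) \<le> g / 2"
  using radius_antimono[of 0 "level n"] by (simp add: radius_def)

lemma radius_level_ge: "radius K \<le> radius (level n)"
  using centre(1)[of n] by (intro radius_antimono) (simp add: isolating_def)

lemma finite_cluster: "finite (cluster n)" and card_cluster_le: "card (cluster n) \<le> K"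
  unfolding cluster_def using ball_indices radius_level_le by auto

lemma circle_dist:
  assumes "z \<in> sphere (centre n) (radius (level n) / 2)"
  shows "radius K / 4 \<le> cmod (z - lam m)" "cmod (z - lam n) \<le> g"
proof -
  have z: "dist (centre n) z = radius (level n) / 2"
    using assms by simp
  have "radius (level n) / 4 \<le> dist z (lam m)"
  proof (cases "m \<in> cluster n")
    case True
    then show ?thesis
      using z in_cluster_dist[OF True] dist_triangle2[of "centre n" z "lam m"] by linarith
  next
    case False
    then show ?thesis
      using z notin_cluster_dist[OF False] radius_pos[of "level n"] dist_triangle[of "centre n" "lam m" z]
      by linarith
  qed
  then show "radius K / 4 \<le> cmod (z - lam m)"
    using radius_level_ge[of n] by (simp add: dist_norm)
  have "dist z (lam n) \<le> g"
    using z in_cluster_dist[OF self_in_cluster, of n] radius_level_le[of n] radius_pos[of "level n"]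
      dist_triangle3[of z "lam n" "centre n"] by linarith
  then show "cmod (z - lam n) \<le> g"
    by (simp add: dist_norm)
qed

lemma range_inter_ball: "ball (centre n) (radius (level n) / 2) \<inter> range lam = lam ` cluster n"
proof (intro equalityI subsetI)
  fix z assume "z \<in> ball (centre n) (radius (level n) / 2) \<inter> range lam"
  then show "z \<in> lam ` cluster n"
    using notin_cluster_dist[of _ n] radius_pos[of "level n"] by force
next
  fix z assume "z \<in> lam ` cluster n"
  then show "z \<in> ball (centre n) (radius (level n) / 2) \<inter> range lam"
    using in_cluster_dist[of _ n] radius_pos[of "level n"] by force
qed

definition leader :: "nat \<Rightarrow> bool" where
  "leader n \<longleftrightarrow> (\<forall>m\<in>cluster n. n \<le> m)"

lemma leader_exists: "\<exists>n. leader n \<and> k \<in> cluster n"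
proof -
  define n where "n = Min (cluster k)"
  have n: "n \<in> cluster k"
    unfolding n_def using finite_cluster self_in_cluster by (intro Min_in) auto
  have "leader n"
    unfolding leader_def cluster_eq[OF n] unfolding n_def using finite_cluster by auto
  moreover have "k \<in> cluster n"
    using cluster_eq[OF n] self_in_cluster by simp
  ultimately show ?thesis by blast
qed

lemma leader_unique: "leader n \<Longrightarrow> leader m \<Longrightarrow> k \<in> cluster n \<Longrightarrow> k \<in> cluster m \<Longrightarrow> n = m"
  using cluster_eq self_in_cluster unfolding leader_def by (metis antisym)

lemma isolated_in_range: "lam n isolated_in range lam"
proof -
  define F where "F = {m. dist (lam n) (lam m) < g / 2}"
  have "finite F"
    unfolding F_def by (rule ball_indices) simp
  then have "open (ball (lam n) (g / 2) - (lam ` F - {lam n}))"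
    by (intro open_Diff finite_imp_closed) auto
  moreover have "(ball (lam n) (g / 2) - (lam ` F - {lam n})) \<inter> range lam = {lam n}"
    using gap_pos by (auto simp: F_def)
  ultimately show ?thesis
    unfolding isolated_in_def by blast
qed

end

section \<open>Vector-valued contour integrals over circles\<close>

lemma vec_contour_integral_circlepath:
  fixes f :: "complex \<Rightarrow> 'a::complex_hilbert_space"
  assumes "continuous_on (sphere z r) f" "r > 0"
  shows "((\<lambda>t. vector_derivative (circlepath z r) (at t within {0..1}) *\<^sub>C f (circlepath z r t))
    has_integral vec_contour_integral (circlepath z r) f) {0..1}"
proof -
  have "continuous_on {0..1} (\<lambda>t. f (circlepath z r t))"
  proof (rule continuous_on_compose2[OF assms(1)])
    show "continuous_on {0..1} (circlepath z r)"
      using path_circlepath path_def by blast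
    show "circlepath z r ` {0..1} \<subseteq> sphere z r"
      using path_image_circlepath[of z r] assms(2) by (simp add: path_image_def)
  qed
  then have "continuous_on {0..1} (\<lambda>t. (2 * pi * \<i> * r * exp (2 * of_real pi * \<i> * of_real t)) *\<^sub>C f (circlepath z r t))"
    by (intro scaleC.continuous_on continuous_intros)
  then have "continuous_on {0..1} (\<lambda>t. vector_derivative (circlepath z r) (at t within {0..1}) *\<^sub>C f (circlepath z r t))"
    by (rule continuous_on_eq) (simp add: vector_derivative_circlepath01)
  then show ?thesis
    unfolding vec_contour_integral_def by (intro integrable_integral integrable_continuous_real)
qed

lemma circlepath_in_sphere: "r > 0 \<Longrightarrow> t \<in> {0..1} \<Longrightarrow> circlepath z r t \<in> sphere z r"
  using path_image_circlepath[of z r] unfolding path_image_def by auto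

lemma norm_vec_contour_integral_circlepath_le:
  fixes f :: "complex \<Rightarrow> 'a::complex_hilbert_space"
  assumes "continuous_on (sphere z r) f" "r > 0" "\<And>\<zeta>. \<zeta> \<in> sphere z r \<Longrightarrow> norm (f \<zeta>) \<le> B"
  shows "norm (vec_contour_integral (circlepath z r) f) \<le> 2 * pi * r * B"
proof -
  have "z + of_real r \<in> sphere z r"
    using assms(2) by (simp add: dist_norm)
  then have "0 \<le> B"
    using assms(3) norm_ge_zero order_trans by blast
  have "norm (vec_contour_integral (circlepath z r) f) \<le> (2 * pi * r * B) * measure lborel (cbox 0 (1::real))"
  proof (rule has_integral_bound)
    show "0 \<le> 2 * pi * r * B"
      using \<open>0 \<le> B\<close> assms(2) by simp
    show "((\<lambda>t. vector_derivative (circlepath z r) (at t within {0..1}) *\<^sub>C f (circlepath z r t))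
      has_integral vec_contour_integral (circlepath z r) f) (cbox 0 1)"
      using vec_contour_integral_circlepath[OF assms(1,2)] by simp
    fix t :: real assume "t \<in> cbox 0 1"
    then have t: "0 \<le> t" "t \<le> 1" by auto
    have "norm (vector_derivative (circlepath z r) (at t within {0..1})) = 2 * pi * r"
      using assms(2) t by (simp add: vector_derivative_circlepath01 norm_mult)
    then show "norm (vector_derivative (circlepath z r) (at t within {0..1}) *\<^sub>C f (circlepath z r t)) \<le> 2 * pi * r * B"
      using assms(2) circlepath_in_sphere[OF assms(2), of t z] t
      by (simp add: norm_scaleC assms(3))
  qed
  then show ?thesis by simp
qed

lemma vec_contour_integral_circlepath_cong:
  assumes "r > 0" "\<And>\<zeta>. \<zeta> \<in> sphere z r \<Longrightarrow> f \<zeta> = h \<zeta>"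
  shows "vec_contour_integral (circlepath z r) f = vec_contour_integral (circlepath z r) h"
  unfolding vec_contour_integral_def using circlepath_in_sphere[OF assms(1)] assms(2)
  by (intro integral_cong) simp

lemma vec_contour_integral_circlepath_linear:
  fixes f :: "complex \<Rightarrow> 'a::complex_hilbert_space"
  assumes "bounded_clinear L" "continuous_on (sphere z r) f" "r > 0"
  shows "L (vec_contour_integral (circlepath z r) f) = vec_contour_integral (circlepath z r) (\<lambda>\<zeta>. L (f \<zeta>))"
  using has_integral_linear[OF vec_contour_integral_circlepath[OF assms(2,3)]
      bounded_clinear_linear[OF assms(1)]]
  by (simp add: vec_contour_integral_def o_def bounded_clinear_scaleC[OF assms(1)] integral_unique)

lemma vec_contour_integral_circlepath_add:
  fixes f h :: "complex \<Rightarrow> 'a::complex_hilbert_space"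
  assumes "continuous_on (sphere z r) f" "continuous_on (sphere z r) h" "r > 0"
  shows "vec_contour_integral (circlepath z r) (\<lambda>\<zeta>. f \<zeta> + h \<zeta>)
    = vec_contour_integral (circlepath z r) f + vec_contour_integral (circlepath z r) h"
  unfolding vec_contour_integral_def[of _ "\<lambda>\<zeta>. f \<zeta> + h \<zeta>"]
  using has_integral_add[OF vec_contour_integral_circlepath[OF assms(1,3)] vec_contour_integral_circlepath[OF assms(2,3)]]
  by (intro integral_unique) (simp add: scaleC_add_right)

lemma bounded_clinear_scaleC_left: "bounded_clinear ((*\<^sub>C) k :: 'a::complex_hilbert_space \<Rightarrow> 'a)"
  unfolding bounded_clinear_def using scaleC.bounded_linear_right
  by (auto simp: scaleC_scaleC mult.commute)

lemma vec_contour_integral_circlepath_diff: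
  fixes f h :: "complex \<Rightarrow> 'a::complex_hilbert_space"
  assumes "continuous_on (sphere z r) f" "continuous_on (sphere z r) h" "r > 0"
  shows "vec_contour_integral (circlepath z r) (\<lambda>\<zeta>. f \<zeta> - h \<zeta>)
    = vec_contour_integral (circlepath z r) f - vec_contour_integral (circlepath z r) h"
proof -
  have "vec_contour_integral (circlepath z r) (\<lambda>\<zeta>. f \<zeta> + (-1) *\<^sub>C h \<zeta>)
    = vec_contour_integral (circlepath z r) f + (-1) *\<^sub>C vec_contour_integral (circlepath z r) h"
    unfolding vec_contour_integral_circlepath_linear[OF bounded_clinear_scaleC_left assms(2,3)]
    by (intro vec_contour_integral_circlepath_add assms scaleC.continuous_on continuous_on_const)
  then show ?thesis
    by (simp add: scaleC_one)
qed

lemma vec_contour_integral_circlepath_scalar: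
  assumes "continuous_on (sphere z r) k" "r > 0"
  shows "vec_contour_integral (circlepath z r) (\<lambda>\<zeta>. k \<zeta> *\<^sub>C v)
    = contour_integral (circlepath z r) k *\<^sub>C v"
proof -
  have "k contour_integrable_on circlepath z r"
    using assms by (intro contour_integrable_continuous_circlepath) simp
  then have "(k has_contour_integral contour_integral (circlepath z r) k) (circlepath z r)"
    by (rule has_contour_integral_integral)
  from has_integral_linear[OF this[unfolded has_contour_integral_def] scaleC.bounded_linear_left[of v]]
  show ?thesis
    by (simp add: vec_contour_integral_def o_def scaleC_scaleC mult.commute integral_unique)
qed

lemma contour_integral_power_inside:
  assumes "dist z \<mu> < r"
  shows "contour_integral (circlepath z r) (\<lambda>\<zeta>. 1 / (\<zeta> - \<mu>) ^ Suc i) = (if i = 0 then 2 * of_real pi * \<i> else 0)"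
proof (cases i)
  case 0
  have "((\<lambda>\<zeta>. 1 / (\<zeta> - \<mu>)) has_contour_integral 2 * of_real pi * \<i> * 1) (circlepath z r)"
    using assms by (intro Cauchy_integral_circlepath_simple) (auto simp: dist_norm norm_minus_commute)
  then show ?thesis
    using 0 by (simp add: contour_integral_unique)
next
  case (Suc m)
  define F where "F \<zeta> = - (1 / of_nat (Suc m)) * inverse (\<zeta> - \<mu>) ^ Suc m" for \<zeta>
  have "((\<lambda>\<zeta>. 1 / (\<zeta> - \<mu>) ^ Suc i) has_contour_integral
      (F (pathfinish (circlepath z r)) - F (pathstart (circlepath z r)))) (circlepath z r)"
  proof (rule contour_integral_primitive[where S = "- {\<mu>}"])
    show "(F has_field_derivative 1 / (\<zeta> - \<mu>) ^ Suc i) (at \<zeta> within - {\<mu>})" if "\<zeta> \<in> - {\<mu>}" for \<zeta>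
    proof -
      define v where "v = inverse (\<zeta> - \<mu>)"
      have "((\<lambda>\<zeta>. inverse (\<zeta> - \<mu>)) has_field_derivative - (v * v)) (at \<zeta> within - {\<mu>})"
        using that by (auto intro!: derivative_eq_intros simp: v_def)
      from DERIV_cmult[OF DERIV_power[OF this, of "Suc m"], of "- (1 / of_nat (Suc m))"]
      have "(F has_field_derivative - (1 / of_nat (Suc m)) * (of_nat (Suc m) * (- (v * v) * v ^ m)))
          (at \<zeta> within - {\<mu>})"
        by (simp add: F_def[abs_def] v_def)
      also have "- (1 / of_nat (Suc m)) * (of_nat (Suc m) * (- (v * v) * v ^ m)) = v ^ Suc (Suc m)"
        using of_nat_neq_0[of m, where ?'a = complex] by (simp del: of_nat_Suc)
      also have "\<dots> = 1 / (\<zeta> - \<mu>) ^ Suc i"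
        by (simp only: v_def Suc inverse_eq_divide power_one_over)
      finally show ?thesis .
    qed
    show "path_image (circlepath z r) \<subseteq> - {\<mu>}"
      using assms zero_le_dist[of z \<mu>] by auto
  qed simp
  then show ?thesis
    using Suc by (simp add: contour_integral_unique)
qed

lemma contour_integral_power_outside:
  assumes "r < dist z \<mu>" "r > 0"
  shows "contour_integral (circlepath z r) (\<lambda>\<zeta>. 1 / (\<zeta> - \<mu>) ^ Suc i) = 0"
proof (rule contour_integral_unique, rule Cauchy_theorem_convex_simple)
  show "(\<lambda>\<zeta>. 1 / (\<zeta> - \<mu>) ^ Suc i) holomorphic_on ball z (dist z \<mu>)"
    by (intro holomorphic_intros) auto
  show "path_image (circlepath z r) \<subseteq> ball z (dist z \<mu>)"
    using assms by auto
qed auto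

text \<open>Only the simple pole of the resolvent contributes to the integral.\<close>

lemma vec_contour_integral_chain_resolvent:
  assumes "dist z \<mu> \<noteq> r" "r > 0"
  shows "vec_contour_integral (circlepath z r) (chain_resolvent \<phi> \<mu> j)
    = (if dist z \<mu> < r then (2 * of_real pi * \<i>) *\<^sub>C \<phi> j else 0)"
proof -
  have nz: "\<zeta> - \<mu> \<noteq> 0" if "\<zeta> \<in> sphere z r" for \<zeta>
    using that assms(1) by auto
  have cont: "continuous_on (sphere z r) (\<lambda>\<zeta>. 1 / (\<zeta> - \<mu>) ^ Suc i)" for i
    using nz by (intro continuous_intros) auto
  have *: "vec_contour_integral (circlepath z r) (chain_resolvent \<phi> \<mu> j) =
      contour_integral (circlepath z r) (\<lambda>\<zeta>. 1 / (\<zeta> - \<mu>) ^ Suc 0) *\<^sub>C \<phi> j"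
    if zero: "\<And>i. contour_integral (circlepath z r) (\<lambda>\<zeta>. 1 / (\<zeta> - \<mu>) ^ Suc (Suc i)) = 0"
  proof -
    have "((\<lambda>t. \<Sum>i\<le>j. vector_derivative (circlepath z r) (at t within {0..1}) *\<^sub>C
        ((1 / (circlepath z r t - \<mu>) ^ Suc i) *\<^sub>C \<phi> (j - i))) has_integral
        (\<Sum>i\<le>j. vec_contour_integral (circlepath z r) (\<lambda>\<zeta>. (1 / (\<zeta> - \<mu>) ^ Suc i) *\<^sub>C \<phi> (j - i)))) {0..1}"
      using cont assms(2)
      by (intro has_integral_sum vec_contour_integral_circlepath scaleC.continuous_on continuous_on_const) auto
    then have "vec_contour_integral (circlepath z r) (chain_resolvent \<phi> \<mu> j)
        = (\<Sum>i\<le>j. vec_contour_integral (circlepath z r) (\<lambda>\<zeta>. (1 / (\<zeta> - \<mu>) ^ Suc i) *\<^sub>C \<phi> (j - i)))"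
      unfolding vec_contour_integral_def[of _ "chain_resolvent \<phi> \<mu> j"] chain_resolvent_def complex_vector.scale_sum_right
      by (rule integral_unique)
    also have "\<dots> = (\<Sum>i\<le>j. contour_integral (circlepath z r) (\<lambda>\<zeta>. 1 / (\<zeta> - \<mu>) ^ Suc i) *\<^sub>C \<phi> (j - i))"
      by (intro sum.cong refl vec_contour_integral_circlepath_scalar cont assms(2))
    also have "\<dots> = (\<Sum>i\<le>j. if i = 0 then contour_integral (circlepath z r) (\<lambda>\<zeta>. 1 / (\<zeta> - \<mu>) ^ Suc 0) *\<^sub>C \<phi> j else 0)"
    proof (intro sum.cong refl)
      fix i
      show "contour_integral (circlepath z r) (\<lambda>\<zeta>. 1 / (\<zeta> - \<mu>) ^ Suc i) *\<^sub>C \<phi> (j - i)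
          = (if i = 0 then contour_integral (circlepath z r) (\<lambda>\<zeta>. 1 / (\<zeta> - \<mu>) ^ Suc 0) *\<^sub>C \<phi> j else 0)"
        using zero by (cases i) auto
    qed
    finally show ?thesis by simp
  qed
  show ?thesis
  proof (cases "dist z \<mu> < r")
    case True
    show ?thesis
      by (subst *) (simp_all only: contour_integral_power_inside[OF True] True if_True
          nat.distinct if_False simp_thms)
  next
    case False
    then have "r < dist z \<mu>"
      using assms(1) by simp
    then show ?thesis
      by (subst *) (simp_all only: contour_integral_power_outside[OF _ assms(2)] False if_False
          complex_vector.scale_zero_left)
  qed
qed

lemma positive_closed_curve_circlepath:
  assumes "r > 0"
  shows "positive_closed_curve (circlepath z r)" "inside (path_image (circlepath z r)) = ball z r"
proof -
  have "inside (frontier (cball z r)) = interior (cball z r)"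
    by (rule inside_frontier_eq_interior) auto
  then show ins: "inside (path_image (circlepath z r)) = ball z r"
    using assms by simp
  show "positive_closed_curve (circlepath z r)"
    unfolding positive_closed_curve_def ins using assms
    by (auto simp: simple_path_circlepath dist_norm norm_minus_commute intro!: winding_number_circlepath)
qed

section \<open>Spectral projections of clusters\<close>

context complete_eigen_system
begin

definition proj :: "nat \<Rightarrow> 'a \<Rightarrow> 'a" where
  "proj n x = (1 / (2 * of_real pi * \<i>)) *\<^sub>C
    vec_contour_integral (circlepath (centre n) (radius (level n) / 2)) (\<lambda>z. Res z x)"

abbreviation circle :: "nat \<Rightarrow> complex set" where
  "circle n \<equiv> sphere (centre n) (radius (level n) / 2)"

lemma circle_resolvent: "z \<in> circle n \<Longrightarrow> z \<notin> range lam"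
proof
  assume "z \<in> circle n" "z \<in> range lam"
  then obtain m where "z = lam m" by blast
  with circle_dist(1)[OF \<open>z \<in> circle n\<close>, of m] radius_pos[of K] show False
    by simp
qed

lemma circle_radius_pos: "radius (level n) / 2 > 0"
  using radius_pos by simp

text \<open>The circles keep a uniform distance from the spectrum, so one constant bounds the resolvent
  on all of them.\<close>

lemma Res_bound_circles: "\<exists>C\<ge>0. \<forall>n. \<forall>z\<in>circle n. \<forall>x. norm (Res z x) \<le> C * norm x"
  using Res_bound[of "radius K / 4"] radius_pos[of K] circle_dist(1) by fastforce

lemma Res_continuous_on_circle: "continuous_on (circle n) (\<lambda>z. Res z x)"
proof -
  obtain C where C: "C \<ge> 0" "\<And>n z x. z \<in> circle n \<Longrightarrow> norm (Res z x) \<le> C * norm x"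
    using Res_bound_circles by metis
  have "dist (Res z x) (Res w x) \<le> (C * (C * norm x)) * dist z w" if "z \<in> circle n" "w \<in> circle n" for z w
  proof -
    have "Res z x - Res w x = (w - z) *\<^sub>C Res z (Res w x)"
      using resolvent_identity(2)[OF circle_resolvent[OF that(1)] circle_resolvent[OF that(2)], of x] by simp
    then have "dist (Res z x) (Res w x) = dist z w * norm (Res z (Res w x))"
      by (simp add: dist_norm norm_scaleC norm_minus_commute)
    also have "\<dots> \<le> dist z w * (C * (C * norm x))"
      using order_trans[OF C(2)[OF that(1)] mult_left_mono[OF C(2)[OF that(2)] C(1)]]
      by (intro mult_left_mono) auto
    finally show ?thesis
      by (simp add: mult.commute)
  qed
  then have "(C * (C * norm x))-lipschitz_on (circle n) (\<lambda>z. Res z x)"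
    using C(1) by (intro lipschitz_onI) auto
  then show ?thesis
    by (rule lipschitz_on_continuous_on)
qed

lemma norm_proj_le:
  assumes "\<And>z. z \<in> circle n \<Longrightarrow> norm (Res z x) \<le> B"
  shows "norm (proj n x) \<le> g * B"
proof -
  define r where "r = radius (level n) / 2"
  have r: "r > 0" "r \<le> g"
    using circle_radius_pos radius_level_le[of n] gap_pos by (auto simp: r_def)
  have "centre n + of_real r \<in> circle n"
    using r(1) by (simp add: dist_norm r_def)
  then have "B \<ge> 0"
    using assms norm_ge_zero order_trans by blast
  have "norm (vec_contour_integral (circlepath (centre n) r) (\<lambda>z. Res z x)) \<le> 2 * pi * r * B"
    using assms Res_continuous_on_circle r(1)
    by (intro norm_vec_contour_integral_circlepath_le) (auto simp: r_def)
  then have "norm (proj n x) \<le> r * B"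
    by (simp add: proj_def norm_scaleC norm_divide norm_mult r_def[symmetric] divide_le_eq mult_ac)
  also have "\<dots> \<le> g * B"
    using r(2) \<open>B \<ge> 0\<close> by (rule mult_right_mono)
  finally show ?thesis .
qed

lemma proj_bounded_clinear: "bounded_clinear (proj n)"
proof -
  obtain C where C: "C \<ge> 0" "\<And>n z x. z \<in> circle n \<Longrightarrow> norm (Res z x) \<le> C * norm x"
    using Res_bound_circles by metis
  have lin: "Res z (x + y) = Res z x + Res z y" "Res z (k *\<^sub>C x) = k *\<^sub>C Res z x" if "z \<in> circle n" for z x y k
    using Res_bounded_clinear[OF circle_resolvent[OF that]]
    by (auto simp: bounded_clinear_def linear_simps)
  have add: "proj n (x + y) = proj n x + proj n y" for x y
    unfolding proj_def
    by (subst vec_contour_integral_circlepath_cong[OF circle_radius_pos lin(1)])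
      (auto simp: vec_contour_integral_circlepath_add Res_continuous_on_circle circle_radius_pos radius_pos
        scaleC_add_right)
  have scale: "proj n (k *\<^sub>C x) = k *\<^sub>C proj n x" for k x
    unfolding proj_def
    by (subst vec_contour_integral_circlepath_cong[OF circle_radius_pos lin(2)])
      (auto simp: vec_contour_integral_circlepath_linear[OF bounded_clinear_scaleC_left, symmetric]
        Res_continuous_on_circle radius_pos scaleC_scaleC mult.commute)
  have "norm (proj n x) \<le> norm x * (g * C)" for x
    using norm_proj_le[of n x "C * norm x"] C(2) by (simp add: mult_ac)
  then have "bounded_linear (proj n)"
    by (intro bounded_linear_intro[of _ "g * C"]) (auto simp: add scale scaleR_scaleC)
  then show ?thesis
    by (simp add: bounded_clinear_def scale)
qed

lemma proj_gen_eigenvector: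
  assumes "v \<in> gen_eigenvectors D A (lam k)"
  shows "proj n v = (if k \<in> cluster n then v else 0)"
proof -
  obtain \<phi> j where v: "v = \<phi> j" and chain: "\<And>i. i \<le> j \<Longrightarrow> \<phi> i \<in> D" "\<phi> 0 \<noteq> 0" "A (\<phi> 0) = lam k *\<^sub>C \<phi> 0"
    "\<And>i. i < j \<Longrightarrow> A (\<phi> (Suc i)) = lam k *\<^sub>C \<phi> (Suc i) + \<phi> i"
    using assms by (elim gen_eigenvectorsE) blast
  have "Res z v = chain_resolvent \<phi> (lam k) j z" if "z \<in> circle n" for z
  proof -
    have "z \<notin> range lam"
      using circle_resolvent[OF that] .
    then have eq: "chain_resolvent \<phi> (lam k) j z \<in> D \<and>
        z *\<^sub>C chain_resolvent \<phi> (lam k) j z - A (chain_resolvent \<phi> (lam k) j z) = v"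
      unfolding v by (intro chain_resolvent_equation[OF chain(1,3,4)]) auto
    then show ?thesis
      using Res_unique[OF \<open>z \<notin> range lam\<close>] by metis
  qed
  then have "proj n v = (1 / (2 * of_real pi * \<i>)) *\<^sub>C
      vec_contour_integral (circlepath (centre n) (radius (level n) / 2)) (chain_resolvent \<phi> (lam k) j)"
    unfolding proj_def by (subst vec_contour_integral_circlepath_cong[OF circle_radius_pos]) auto
  moreover have "dist (centre n) (lam k) < radius (level n) / 2 \<longleftrightarrow> k \<in> cluster n"
    "dist (centre n) (lam k) \<noteq> radius (level n) / 2"
    using in_cluster_dist[of k n] notin_cluster_dist[of k n] radius_pos[of "level n"] by force+
  ultimately show ?thesis
    using vec_contour_integral_chain_resolvent[OF _ circle_radius_pos, of "centre n" "lam k" n \<phi> j]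
    by (simp add: v scaleC_scaleC scaleC_one)
qed

definition cluster_space :: "nat \<Rightarrow> 'a set" where
  "cluster_space n = cspan (\<Union>k\<in>cluster n. gen_eigenvectors D A (lam k))"

lemma proj_simps: "proj n 0 = 0" "proj n (x + y) = proj n x + proj n y" "proj n (k *\<^sub>C x) = k *\<^sub>C proj n x"
  using proj_bounded_clinear[of n] by (auto simp: bounded_clinear_def linear_simps)

lemma gen_eigenvector_index:
  assumes "v \<in> gen_eigenvectors D A \<mu>"
  obtains k where "\<mu> = lam k"
  using assms gen_eigenvectors_eq_empty range_lam by blast

lemma proj_eigenspan:
  assumes "w \<in> eigenspan"
  shows "proj n w \<in> cluster_space n"
  using assms
proof (induction rule: complex_vector.span_induct_alt)
  case base
  then show ?case
    by (simp add: proj_simps cluster_space_def complex_vector.span_zero)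
next
  case (step k x y)
  then obtain \<mu> where "x \<in> gen_eigenvectors D A \<mu>" by blast
  moreover from this obtain m where "\<mu> = lam m"
    by (rule gen_eigenvector_index)
  ultimately have x: "x \<in> gen_eigenvectors D A (lam m)" by simp
  then have "proj n x \<in> cluster_space n"
    unfolding proj_gen_eigenvector[OF x] cluster_space_def
    by (auto intro: complex_vector.span_base complex_vector.span_zero)
  then show ?case
    unfolding proj_simps using step unfolding cluster_space_def
    by (intro complex_vector.span_add complex_vector.span_scale)
qed

lemma proj_cluster_space:
  assumes "w \<in> cluster_space n"
  shows "proj n w = w"
  using assms unfolding cluster_space_def
proof (induction rule: complex_vector.span_induct_alt)
  case (step k x y)
  then show ?case
    using proj_gen_eigenvector by (force simp: proj_simps)
qed (simp add: proj_simps)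

text \<open>The dimensions of the generalized eigenspaces add up to the number of indices in the cluster.\<close>

lemma cluster_space_basis: "\<exists>B. finite B \<and> card B \<le> K \<and> cluster_space n = cspan B"
proof -
  have "\<exists>B. finite B \<and> cspan B = cspan (gen_eigenvectors D A \<mu>) \<and> card B = card {m. lam m = \<mu>}" for \<mu>
  proof -
    obtain B where B: "finite B" "B \<subseteq> cspan (gen_eigenvectors D A \<mu>)"
      "cspan (gen_eigenvectors D A \<mu>) \<subseteq> cspan B" "card B = cdim (cspan (gen_eigenvectors D A \<mu>))"
      using cfinite_dim_basis[OF fiber(2)[of \<mu>]] by metis
    have "cspan B = cspan (gen_eigenvectors D A \<mu>)"
      using B(2,3) complex_vector.span_minimal[OF B(2) complex_vector.subspace_span] by blast
    then show ?thesis
      using B(1,4) fiber(3)[of \<mu>] by auto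
  qed
  then obtain B where B: "\<And>\<mu>. finite (B \<mu>)" "\<And>\<mu>. cspan (B \<mu>) = cspan (gen_eigenvectors D A \<mu>)"
    "\<And>\<mu>. card (B \<mu>) = card {m. lam m = \<mu>}"
    by metis
  define U where "U = (\<Union>\<mu>\<in>lam ` cluster n. B \<mu>)"
  have fin: "finite (lam ` cluster n)"
    using finite_cluster by simp
  have "card U \<le> (\<Sum>\<mu>\<in>lam ` cluster n. card (B \<mu>))"
    unfolding U_def by (rule card_UN_le[OF fin])
  also have "\<dots> = (\<Sum>\<mu>\<in>lam ` cluster n. card {m \<in> cluster n. lam m = \<mu>})"
  proof (intro sum.cong refl)
    fix \<mu> assume "\<mu> \<in> lam ` cluster n"
    then have "{m. lam m = \<mu>} = {m \<in> cluster n. lam m = \<mu>}"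
      by (auto simp: cluster_def)
    then show "card (B \<mu>) = card {m \<in> cluster n. lam m = \<mu>}"
      by (simp add: B(3))
  qed
  also have "\<dots> = card (cluster n)"
    using sum.image_gen[OF finite_cluster, of "\<lambda>_. 1::nat" n lam] by simp
  also have "\<dots> \<le> K"
    by (rule card_cluster_le)
  finally have "card U \<le> K" .
  moreover have "finite U"
    unfolding U_def using fin B(1) by blast
  moreover have "cluster_space n = cspan U"
  proof (rule subset_antisym)
    have "gen_eigenvectors D A (lam k) \<subseteq> cspan U" if "k \<in> cluster n" for k
    proof -
      have "gen_eigenvectors D A (lam k) \<subseteq> cspan (B (lam k))"
        unfolding B(2) by (rule complex_vector.span_superset)
      also have "\<dots> \<subseteq> cspan U"
        using that by (intro complex_vector.span_mono) (auto simp: U_def)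
      finally show ?thesis .
    qed
    then show "cluster_space n \<subseteq> cspan U"
      unfolding cluster_space_def by (intro complex_vector.span_minimal complex_vector.subspace_span) blast
    have "B (lam k) \<subseteq> cluster_space n" if "k \<in> cluster n" for k
    proof -
      have "B (lam k) \<subseteq> cspan (gen_eigenvectors D A (lam k))"
        unfolding B(2)[symmetric] by (rule complex_vector.span_superset)
      also have "\<dots> \<subseteq> cluster_space n"
        unfolding cluster_space_def using that by (intro complex_vector.span_mono) blast
      finally show ?thesis .
    qed
    then show "cspan U \<subseteq> cluster_space n"
      unfolding U_def cluster_space_def
      by (intro complex_vector.span_minimal complex_vector.subspace_span) blast
  qed
  ultimately show ?thesis by blast
qed

text \<open>The range is contained in the closure of the cluster space, which is closed because its dimension
  is finite.\<close>

lemma proj_in_cluster_space: "proj n x \<in> cluster_space n"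
proof -
  obtain B where B: "finite B" "cluster_space n = cspan B"
    using cluster_space_basis by blast
  have "closed (proj n -` cluster_space n)"
    unfolding B(2) using proj_bounded_clinear
    by (intro continuous_closed_vimage closed_cspan_finite B(1))
      (auto intro: linear_continuous_at bounded_clinear_linear)
  then have "closure eigenspan \<subseteq> proj n -` cluster_space n"
    using proj_eigenspan by (intro closure_minimal) auto
  then show ?thesis
    using dense by auto
qed

lemma proj_proj: "proj n (proj n x) = proj n x"
  using proj_cluster_space proj_in_cluster_space by blast

lemma proj_in_domain: "proj n x \<in> D"
proof -
  have "w \<in> D" if "w \<in> cluster_space n" for w
    using that unfolding cluster_space_def
  proof (induction rule: complex_vector.span_induct_alt)
    case (step k x y)
    then have "x \<in> D"
      by (auto elim: gen_eigenvectorsE)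
    then show ?case
      using step by (intro generator_add(1) generator_scaleC(1))
  qed (rule generator_zero)
  then show ?thesis
    using proj_in_cluster_space by blast
qed

text \<open>Indices that do not represent a cluster get the zero operator, the spectral projection of the
  empty set; this way the family is indexed by all natural numbers without an enumeration of the
  clusters.\<close>

definition projection :: "nat \<Rightarrow> 'a \<Rightarrow> 'a" where
  "projection n x = (if leader n then proj n x else 0)"

lemma spectral_projection: "\<exists>\<sigma>. is_spectral_projection D A \<sigma> (projection n)"
proof (cases "leader n")
  case True
  have "is_spectral_projection D A (lam ` cluster n) (projection n)"
    unfolding is_spectral_projection_def
  proof (intro conjI exI[of _ "{circlepath (centre n) (radius (level n) / 2)}"])
    show "lam ` cluster n \<subseteq> eigenvalues D A"
      using range_lam by blast
    show "\<forall>z\<in>lam ` cluster n. z isolated_in spectrum D A"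
      unfolding spectrum_eq using isolated_in_range by blast
    show "\<forall>\<gamma>\<in>{circlepath (centre n) (radius (level n) / 2)}.
        positive_closed_curve \<gamma> \<and> path_image \<gamma> \<subseteq> resolvent_set D A"
      using positive_closed_curve_circlepath(1)[OF circle_radius_pos] circle_resolvent[of _ n] radius_pos[of "level n"]
      unfolding resolvent_set_eq by (auto simp del: mem_sphere)
    show "(\<Union>\<gamma>\<in>{circlepath (centre n) (radius (level n) / 2)}. inside (path_image \<gamma>)) \<inter> spectrum D A
        = lam ` cluster n"
      using positive_closed_curve_circlepath(2)[OF circle_radius_pos, of "centre n" n]
        range_inter_ball[of n] unfolding spectrum_eq by simp
    show "\<forall>x. projection n x = (1 / (2 * of_real pi * \<i>)) *\<^sub>C
        (\<Sum>\<gamma>\<in>{circlepath (centre n) (radius (level n) / 2)}. vec_contour_integral \<gamma> (\<lambda>z. Res z x))"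
      using True by (simp add: projection_def proj_def)
  qed (auto simp: finite_cluster disjoint_family_on_def)
  then show ?thesis by blast
next
  case False
  have "is_spectral_projection D A {} (projection n)"
    unfolding is_spectral_projection_def
    using False by (auto simp: projection_def disjoint_family_on_def intro!: exI[of _ "{}"])
  then show ?thesis by blast
qed

lemma projection_bounded_clinear: "bounded_clinear (projection n)"
proof (cases "leader n")
  case True
  then have "projection n = proj n"
    by (auto simp: projection_def)
  then show ?thesis
    by (simp add: proj_bounded_clinear)
next
  case False
  then have "projection n = (\<lambda>_. 0)"
    by (auto simp: projection_def)
  then show ?thesis
    by (simp add: bounded_clinear_def)
qed

lemma projection_idempotent: "projection n \<circ> projection n = projection n"
  by (auto simp: projection_def proj_proj)

lemma range_projection: "cfinite_dim (range (projection n))" "cdim (range (projection n)) \<le> K"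
proof -
  obtain B where B: "finite B" "card B \<le> K" "cluster_space n = cspan B"
    using cluster_space_basis by blast
  have sub: "range (projection n) \<subseteq> cspan B"
    using proj_in_cluster_space[of n] B(3) by (auto simp: projection_def complex_vector.span_zero)
  then show "cfinite_dim (range (projection n))"
    using B(1) by (auto simp: cfinite_dim_def)
  show "cdim (range (projection n)) \<le> K"
    using complex_vector.dim_le_card[OF sub B(1)] B(2) by simp
qed

lemma projection_sums_eigenspan:
  assumes "w \<in> eigenspan"
  shows "(\<lambda>n. projection n w) sums w"
  using assms
proof (induction rule: complex_vector.span_induct_alt)
  case base
  have "(\<lambda>n. projection n 0) = (\<lambda>_. 0)"
    by (auto simp: projection_def proj_simps)
  then show ?case by simp
next
  case (step k x y)
  then obtain \<mu> where "x \<in> gen_eigenvectors D A \<mu>" by blast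
  moreover from this obtain m where "\<mu> = lam m"
    by (rule gen_eigenvector_index)
  ultimately have x: "x \<in> gen_eigenvectors D A (lam m)" by simp
  obtain l where l: "leader l" "m \<in> cluster l"
    using leader_exists by blast
  have "projection n x = (if n = l then x else 0)" for n
    using l leader_unique proj_gen_eigenvector[OF x] by (auto simp: projection_def)
  then have "(\<lambda>n. projection n x) sums x"
    using sums_single[of l "\<lambda>_. x"] by simp
  then have "(\<lambda>n. k *\<^sub>C projection n x) sums (k *\<^sub>C x)"
    by (rule bounded_linear.sums[OF scaleC.bounded_linear_right])
  then have "(\<lambda>n. k *\<^sub>C projection n x + projection n y) sums (k *\<^sub>C x + y)"
    using step by (intro sums_add)
  moreover have "projection n (k *\<^sub>C x + y) = k *\<^sub>C projection n x + projection n y" for n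
    by (simp add: projection_def proj_simps)
  ultimately show ?case by simp
qed

section \<open>The Riesz property\<close>

definition height :: "nat \<Rightarrow> int" where
  "height n = \<lfloor>Im (lam n)\<rfloor>"

lemma node_resolvent: "node k \<notin> range lam"
proof
  assume "node k \<in> range lam"
  then obtain n where "node k = lam n" by blast
  then have "Re (lam n) = Re (node k)"
    by simp
  then show False
    using strip[of n] by (simp add: node_def)
qed

lemma node_circle_dist:
  assumes "z \<in> circle n"
  shows "cmod (node (height n) - z) \<le> 2 * a + 1 + g"
proof -
  have "\<bar>Im (node (height n) - lam n)\<bar> \<le> 1"
    by (simp add: node_def height_def) linarith
  moreover have "\<bar>Re (node (height n) - lam n)\<bar> \<le> 2 * a"
    using strip[of n] by (simp add: node_def)
  ultimately have "cmod (node (height n) - lam n) \<le> 2 * a + 1"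
    using cmod_le[of "node (height n) - lam n"] by linarith
  then show ?thesis
    using circle_dist(2)[OF assms] norm_triangle_ineq[of "node (height n) - lam n" "lam n - z"]
    by (simp add: norm_minus_commute)
qed

text \<open>On the circle \<open>R(z) x = (1 + (\<mu> - z) R(z)) R(\<mu>) x\<close>, where the node \<open>\<mu>\<close> is within bounded distance
  of \<open>z\<close>.\<close>

lemma projection_le_node_resolvent:
  "\<exists>C\<ge>0. \<forall>n x. norm (projection n x) \<le> C * norm (Res (node (height n)) x)"
proof -
  obtain C where C: "C \<ge> 0" "\<And>n z x. z \<in> circle n \<Longrightarrow> norm (Res z x) \<le> C * norm x"
    using Res_bound_circles by metis
  define L where "L = 2 * a + 1 + g"
  have L: "L \<ge> 0"
    using a_pos gap_pos by (simp add: L_def)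
  have "norm (proj n x) \<le> g * ((1 + L * C) * norm (Res (node (height n)) x))" for n x
  proof (rule norm_proj_le)
    fix z assume z: "z \<in> circle n"
    define y where "y = Res (node (height n)) x"
    have "Res z x = y + (node (height n) - z) *\<^sub>C Res z y"
      unfolding y_def by (rule resolvent_identity(2)[OF circle_resolvent[OF z] node_resolvent])
    then have "norm (Res z x) \<le> norm y + cmod (node (height n) - z) * norm (Res z y)"
      by (metis norm_scaleC norm_triangle_ineq)
    also have "\<dots> \<le> norm y + L * (C * norm y)"
      using node_circle_dist[OF z] C(2)[OF z, of y] L
      by (intro add_left_mono mult_mono) (auto simp: L_def)
    finally show "norm (Res z x) \<le> (1 + L * C) * norm (Res (node (height n)) x)"
      by (simp add: y_def algebra_simps)
  qed
  then have "norm (projection n x) \<le> (g * (1 + L * C)) * norm (Res (node (height n)) x)" for n x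
    using gap_pos L C(1) by (auto simp: projection_def mult.assoc)
  then show ?thesis
    using gap_pos L C(1) by (intro exI[of _ "g * (1 + L * C)"]) auto
qed

text \<open>Conversely the values of a projection lie in the range of the resolvent at the node, with
  preimages of comparable norm. The preimage is found by applying
  \<open>(\<mu> - A) R(z) = 1 + (\<mu> - z) R(z)\<close> under the contour integral, in which the constant term drops out.\<close>

lemma node_image_projection:
  "\<exists>C\<ge>0. \<forall>n x. norm (node (height n) *\<^sub>C projection n x - A (projection n x)) \<le> C * norm (projection n x)"
proof -
  obtain C where C: "C \<ge> 0" "\<And>n z x. z \<in> circle n \<Longrightarrow> norm (Res z x) \<le> C * norm x"
    using Res_bound_circles by metis
  define L where "L = 2 * a + 1 + g"
  have L: "L \<ge> 0"
    using a_pos gap_pos by (simp add: L_def)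
  have "norm (node (height n) *\<^sub>C proj n x - A (proj n x)) \<le> g * L * C * norm (proj n x)" for n x
  proof -
    define p where "p = proj n x"
    define \<mu> where "\<mu> = node (height n)"
    define r where "r = radius (level n) / 2"
    define \<kappa> where "\<kappa> = 1 / (2 * of_real pi * \<i>)"
    define u where "u = \<kappa> *\<^sub>C vec_contour_integral (circlepath (centre n) r) (\<lambda>z. (\<mu> - z) *\<^sub>C Res z p)"
    have r: "r > 0" "r \<le> g"
      using circle_radius_pos radius_level_le[of n] gap_pos by (auto simp: r_def)
    have cont: "continuous_on (sphere (centre n) r) (\<lambda>z. Res z p)"
      unfolding r_def by (rule Res_continuous_on_circle)
    have cont': "continuous_on (sphere (centre n) r) (\<lambda>z. (\<mu> - z) *\<^sub>C Res z p)"
      by (intro scaleC.continuous_on continuous_intros cont)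
    have bl: "bounded_clinear (Res \<mu>)"
      unfolding \<mu>_def by (rule Res_bounded_clinear[OF node_resolvent])
    have ident: "Res \<mu> ((\<mu> - z) *\<^sub>C Res z p) = Res z p - Res \<mu> p" if "z \<in> sphere (centre n) r" for z
    proof -
      have "Res z p = Res \<mu> (p + (\<mu> - z) *\<^sub>C Res z p)"
        unfolding \<mu>_def using that
        by (intro resolvent_identity(1)[OF circle_resolvent[of z n] node_resolvent]) (simp add: r_def)
      also have "\<dots> = Res \<mu> p + Res \<mu> ((\<mu> - z) *\<^sub>C Res z p)"
        by (simp add: linear_simps[OF bounded_clinear_linear[OF bl]])
      finally show ?thesis
        unfolding eq_diff_eq by (simp only: add.commute)
    qed
    have const: "vec_contour_integral (circlepath (centre n) r) (\<lambda>z. Res \<mu> p) = 0"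
    proof -
      have "contour_integral (circlepath (centre n) r) (\<lambda>z. 1) = 0"
        by (intro contour_integral_unique Cauchy_theorem_convex_simple[where S = UNIV]) auto
      then show ?thesis
        using vec_contour_integral_circlepath_scalar[of "centre n" r "\<lambda>_. 1" "Res \<mu> p"] r(1)
        by (simp add: scaleC_one)
    qed
    have "Res \<mu> u = \<kappa> *\<^sub>C vec_contour_integral (circlepath (centre n) r) (\<lambda>z. Res \<mu> ((\<mu> - z) *\<^sub>C Res z p))"
      unfolding u_def bounded_clinear_scaleC[OF bl, of \<kappa>]
        vec_contour_integral_circlepath_linear[OF bl cont' r(1)] ..
    also have "\<dots> = \<kappa> *\<^sub>C vec_contour_integral (circlepath (centre n) r) (\<lambda>z. Res z p - Res \<mu> p)"
      using vec_contour_integral_circlepath_cong[OF r(1) ident] by simp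
    also have "\<dots> = \<kappa> *\<^sub>C vec_contour_integral (circlepath (centre n) r) (\<lambda>z. Res z p)"
      using vec_contour_integral_circlepath_diff[OF cont continuous_on_const r(1), of "Res \<mu> p"] const by simp
    also have "\<dots> = proj n p"
      by (simp add: proj_def \<kappa>_def r_def)
    also have "\<dots> = p"
      by (simp add: p_def proj_proj)
    finally have "Res \<mu> u = p" .
    then have u: "\<mu> *\<^sub>C p - A p = u"
      using Res_solves(2)[OF node_resolvent, of "height n" u] by (simp add: \<mu>_def)
    have "norm (vec_contour_integral (circlepath (centre n) r) (\<lambda>z. (\<mu> - z) *\<^sub>C Res z p)) \<le> 2 * pi * r * (L * (C * norm p))"
    proof (rule norm_vec_contour_integral_circlepath_le[OF cont' r(1)])
      fix z assume "z \<in> sphere (centre n) r"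
      then have z: "z \<in> circle n"
        by (simp add: r_def)
      show "norm ((\<mu> - z) *\<^sub>C Res z p) \<le> L * (C * norm p)"
        unfolding norm_scaleC using node_circle_dist[OF z] C(2)[OF z, of p] L
        by (intro mult_mono) (auto simp: L_def \<mu>_def)
    qed
    then have "norm u \<le> r * (L * (C * norm p))"
      by (simp add: u_def \<kappa>_def norm_scaleC norm_divide norm_mult divide_le_eq mult_ac)
    also have "\<dots> \<le> g * (L * (C * norm p))"
      using r(2) L C(1) by (intro mult_right_mono) auto
    finally show ?thesis
      using u by (simp add: p_def \<mu>_def mult.assoc)
  qed
  moreover have "node (height n) *\<^sub>C projection n x - A (projection n x) = 0" if "\<not> leader n" for n x
    using that by (simp add: projection_def generator_zero)
  ultimately have "norm (node (height n) *\<^sub>C projection n x - A (projection n x)) \<le> g * L * C * norm (projection n x)" for n x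
    by (cases "leader n") (auto simp: projection_def generator_zero)
  then show ?thesis
    using gap_pos L C(1) by (intro exI[of _ "g * L * C"]) auto
qed

lemma card_height_bound: "\<exists>N. \<forall>F k. finite F \<longrightarrow> card {n\<in>F. height n = k} \<le> N"
proof -
  obtain N where "\<And>m::int. finite {n. \<lfloor>Im (lam n)\<rfloor> = m}" "\<And>m::int. card {n. \<lfloor>Im (lam n)\<rfloor> = m} \<le> N"
    using row_indices by blast
  moreover have "{n\<in>F. height n = k} \<subseteq> {n. \<lfloor>Im (lam n)\<rfloor> = k}" for F k
    by (auto simp: height_def)
  ultimately have "card {n\<in>F. height n = k} \<le> N" for F k
    by (meson card_mono order_trans)
  then show ?thesis by blast
qed

text \<open>Boundedly many clusters share a node, so Bessel's inequality for the nodes carries over.\<close>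

lemma sum_projection_sq_le:
  "\<exists>C\<ge>0. \<forall>F x. finite F \<longrightarrow> (\<Sum>n\<in>F. (norm (projection n x))\<^sup>2) \<le> C * (norm x)\<^sup>2"
proof -
  obtain C where C: "C \<ge> 0" "\<And>n x. norm (projection n x) \<le> C * norm (Res (node (height n)) x)"
    using projection_le_node_resolvent by blast
  obtain N where N: "\<And>F k. finite F \<Longrightarrow> card {n\<in>F. height n = k} \<le> N"
    using card_height_bound by blast
  have "(\<Sum>n\<in>F. (norm (projection n x))\<^sup>2) \<le> C\<^sup>2 * (real N * (4 * pi * M)\<^sup>2) * (norm x)\<^sup>2" if F: "finite F" for F x
  proof -
    define f where "f k = (norm (Res (node k) x))\<^sup>2" for k
    have "(\<Sum>n\<in>F. f (height n)) = (\<Sum>k\<in>height ` F. \<Sum>n\<in>{n\<in>F. height n = k}. f (height n))"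
      by (rule sum.image_gen[OF F])
    also have "\<dots> = (\<Sum>k\<in>height ` F. real (card {n\<in>F. height n = k}) * f k)"
      by (intro sum.cong) auto
    also have "\<dots> \<le> (\<Sum>k\<in>height ` F. real N * f k)"
      using N[OF F] by (intro sum_mono mult_right_mono) (auto simp: f_def)
    also have "\<dots> = real N * (\<Sum>k\<in>height ` F. f k)"
      by (simp add: sum_distrib_left)
    also have "\<dots> \<le> real N * (4 * pi * M * norm x)\<^sup>2"
      unfolding f_def using F Res_solves[OF node_resolvent]
      by (intro mult_left_mono sum_node_resolvent_sq_le) auto
    finally have s: "(\<Sum>n\<in>F. f (height n)) \<le> real N * (4 * pi * M * norm x)\<^sup>2" .
    have "(\<Sum>n\<in>F. (norm (projection n x))\<^sup>2) \<le> (\<Sum>n\<in>F. C\<^sup>2 * f (height n))"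
      unfolding f_def power_mult_distrib[symmetric] by (intro sum_mono power_mono C(2)) auto
    also have "\<dots> = C\<^sup>2 * (\<Sum>n\<in>F. f (height n))"
      by (simp add: sum_distrib_left)
    also have "\<dots> \<le> C\<^sup>2 * (real N * (4 * pi * M * norm x)\<^sup>2)"
      using s by (intro mult_left_mono) auto
    finally show ?thesis
      by (simp only: power_mult_distrib mult.assoc)
  qed
  then show ?thesis
    by (intro exI[of _ "C\<^sup>2 * (real N * (4 * pi * M)\<^sup>2)"]) auto
qed

lemma norm_sum_projection_sq_le:
  "\<exists>C\<ge>0. \<forall>F x. finite F \<longrightarrow> (norm (\<Sum>n\<in>F. projection n x))\<^sup>2 \<le> C * (\<Sum>n\<in>F. (norm (projection n x))\<^sup>2)"
proof -
  obtain C where C: "C \<ge> 0" "\<And>n x. norm (node (height n) *\<^sub>C projection n x - A (projection n x)) \<le> C * norm (projection n x)"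
    using node_image_projection by blast
  obtain N where N: "\<And>F k. finite F \<Longrightarrow> card {n\<in>F. height n = k} \<le> N"
    using card_height_bound by blast
  have "(norm (\<Sum>n\<in>F. projection n x))\<^sup>2 \<le> (4 * pi * M)\<^sup>2 * (real N * C\<^sup>2) * (\<Sum>n\<in>F. (norm (projection n x))\<^sup>2)"
    if F: "finite F" for F x
  proof -
    define p where "p n = projection n x" for n
    define G where "G k = {n\<in>F. height n = k}" for k
    define w where "w k = (\<Sum>n\<in>G k. p n)" for k
    have pD: "p n \<in> D" for n
      by (simp add: p_def projection_def proj_in_domain generator_zero)
    have image: "(\<Sum>n\<in>I. p n) \<in> D \<and> node k *\<^sub>C (\<Sum>n\<in>I. p n) - A (\<Sum>n\<in>I. p n) = (\<Sum>n\<in>I. node k *\<^sub>C p n - A (p n))"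
      if "finite I" for I k
      using that
      by (induction I rule: finite_induct)
        (auto simp: generator_zero generator_add pD scaleC_add_right algebra_simps)
    have finG: "finite (G k)" for k
      using F by (simp add: G_def)
    have "(\<Sum>n\<in>F. p n) = (\<Sum>k\<in>height ` F. w k)"
      unfolding w_def G_def by (rule sum.image_gen[OF F])
    then have "(norm (\<Sum>n\<in>F. p n))\<^sup>2 \<le> (4 * pi * M)\<^sup>2 * (\<Sum>k\<in>height ` F. (norm (node k *\<^sub>C w k - A (w k)))\<^sup>2)"
      using norm_sum_nodes_sq_le[of "height ` F" w] F image[OF finG] by (simp add: w_def)
    also have "\<dots> \<le> (4 * pi * M)\<^sup>2 * (\<Sum>k\<in>height ` F. real N * (\<Sum>n\<in>G k. C\<^sup>2 * (norm (p n))\<^sup>2))"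
    proof (intro mult_left_mono sum_mono)
      fix k
      have "(norm (node k *\<^sub>C w k - A (w k)))\<^sup>2 \<le> real (card (G k)) * (\<Sum>n\<in>G k. (norm (node k *\<^sub>C p n - A (p n)))\<^sup>2)"
        using norm_sum_sq_le[of "\<lambda>n. node k *\<^sub>C p n - A (p n)" "G k"] image[OF finG, of k k] by (simp add: w_def)
      also have "\<dots> \<le> real N * (\<Sum>n\<in>G k. C\<^sup>2 * (norm (p n))\<^sup>2)"
      proof (intro mult_mono sum_mono)
        show "real (card (G k)) \<le> real N"
          using N[OF F] by (simp add: G_def)
        show "(norm (node k *\<^sub>C p n - A (p n)))\<^sup>2 \<le> C\<^sup>2 * (norm (p n))\<^sup>2" if "n \<in> G k" for n
          using C(2)[of n x] that unfolding power_mult_distrib[symmetric]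
          by (intro power_mono) (auto simp: p_def G_def)
      qed (auto intro: sum_nonneg)
      finally show "(norm (node k *\<^sub>C w k - A (w k)))\<^sup>2 \<le> real N * (\<Sum>n\<in>G k. C\<^sup>2 * (norm (p n))\<^sup>2)" .
    qed simp
    also have "(\<Sum>k\<in>height ` F. real N * (\<Sum>n\<in>G k. C\<^sup>2 * (norm (p n))\<^sup>2))
        = real N * C\<^sup>2 * (\<Sum>n\<in>F. (norm (p n))\<^sup>2)"
      unfolding G_def sum_distrib_left[symmetric] sum.image_gen[OF F, of _ height, symmetric] by simp
    finally show ?thesis
      by (simp only: p_def mult.assoc)
  qed
  then show ?thesis
    by (intro exI[of _ "(4 * pi * M)\<^sup>2 * (real N * C\<^sup>2)"]) auto
qed

text \<open>The partial sums are uniformly bounded and converge on the dense span of the generalized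
  eigenvectors.\<close>

lemma projection_sums: "(\<lambda>n. projection n x) sums x"
proof -
  obtain C where C: "C \<ge> 0" "\<And>F x. finite F \<Longrightarrow> (\<Sum>n\<in>F. (norm (projection n x))\<^sup>2) \<le> C * (norm x)\<^sup>2"
    using sum_projection_sq_le by blast
  obtain B where B: "B \<ge> 0" "\<And>F x. finite F \<Longrightarrow> (norm (\<Sum>n\<in>F. projection n x))\<^sup>2 \<le> B * (\<Sum>n\<in>F. (norm (projection n x))\<^sup>2)"
    using norm_sum_projection_sq_le by blast
  define Q where "Q = sqrt (B * C)"
  have Q: "Q \<ge> 0"
    using B(1) C(1) by (simp add: Q_def)
  have bound: "norm (\<Sum>n<m. projection n x) \<le> Q * norm x" for m x
  proof -
    have "(norm (\<Sum>n<m. projection n x))\<^sup>2 \<le> B * (C * (norm x)\<^sup>2)"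
      using B(2)[of "{..<m}" x] mult_left_mono[OF C(2)[of "{..<m}" x] B(1)] by simp
    also have "\<dots> = (Q * norm x)\<^sup>2"
      using B(1) C(1) by (simp add: Q_def power_mult_distrib)
    finally show ?thesis
      using Q by (intro power2_le_imp_le[of "norm (\<Sum>n<m. projection n x)"]) auto
  qed
  show ?thesis
    unfolding sums_def
  proof (rule LIMSEQ_I)
    fix e :: real assume e: "e > 0"
    have "x \<in> closure eigenspan"
      using dense by simp
    then obtain w where w: "w \<in> eigenspan" "dist w x < e / (2 * (Q + 1))"
      using e Q by (metis closure_approachable divide_pos_pos add_nonneg_pos zero_less_one mult_pos_pos zero_less_numeral)
    obtain m0 where m0: "\<And>m. m \<ge> m0 \<Longrightarrow> norm ((\<Sum>n<m. projection n w) - w) < e / 2"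
      using LIMSEQ_D[OF projection_sums_eigenspan[OF w(1), unfolded sums_def], of "e / 2"] e by auto
    have "norm ((\<Sum>n<m. projection n x) - x) < e" if "m \<ge> m0" for m
    proof -
      have "(\<Sum>n<m. projection n x) - (\<Sum>n<m. projection n w) = (\<Sum>n<m. projection n (x - w))"
        using linear_simps(2)[OF bounded_clinear_linear[OF projection_bounded_clinear]]
        by (simp add: sum_subtractf)
      then have "norm ((\<Sum>n<m. projection n x) - (\<Sum>n<m. projection n w)) \<le> Q * dist w x"
        using bound[of "x - w" m] by (simp add: dist_norm norm_minus_commute)
      then have "norm ((\<Sum>n<m. projection n x) - x) \<le> Q * dist w x + norm ((\<Sum>n<m. projection n w) - w) + dist w x"
        using norm_triangle_ineq[of "(\<Sum>n<m. projection n x) - (\<Sum>n<m. projection n w)" "(\<Sum>n<m. projection n w) - w"]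
          norm_triangle_ineq[of "(\<Sum>n<m. projection n x) - w" "w - x"]
        by (simp add: dist_norm)
      also have "\<dots> = (Q + 1) * dist w x + norm ((\<Sum>n<m. projection n w) - w)"
        by (simp add: algebra_simps)
      also have "(Q + 1) * dist w x < e / 2"
        using w(2) Q by (simp add: field_simps)
      finally show ?thesis
        using m0[OF that] by simp
    qed
    then show "\<exists>m0. \<forall>m\<ge>m0. norm ((\<Sum>n<m. projection n x) - x) < e"
      by blast
  qed
qed

lemma projection_riesz_family: "riesz_family projection"
proof -
  obtain C where C: "C \<ge> 0" "\<And>F x. finite F \<Longrightarrow> (\<Sum>n\<in>F. (norm (projection n x))\<^sup>2) \<le> C * (norm x)\<^sup>2"
    using sum_projection_sq_le by blast
  obtain B where B: "B \<ge> 0" "\<And>F x. finite F \<Longrightarrow> (norm (\<Sum>n\<in>F. projection n x))\<^sup>2 \<le> B * (\<Sum>n\<in>F. (norm (projection n x))\<^sup>2)"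
    using norm_sum_projection_sq_le by blast
  have summ: "summable (\<lambda>n. (norm (projection n x))\<^sup>2)" for x
    using C(2)[of "{..<_}" x] by (intro summableI_nonneg_bounded) auto
  have upper: "(\<Sum>n. (norm (projection n x))\<^sup>2) \<le> (C + 1) * (norm x)\<^sup>2" for x
  proof -
    have "(\<Sum>n. (norm (projection n x))\<^sup>2) \<le> C * (norm x)\<^sup>2"
      using C(2)[of "{..<_}" x] summ by (intro suminf_le_const) auto
    also have "\<dots> \<le> (C + 1) * (norm x)\<^sup>2"
      by (intro mult_right_mono) auto
    finally show ?thesis .
  qed
  have lower: "1 / (B + 1) * (norm x)\<^sup>2 \<le> (\<Sum>n. (norm (projection n x))\<^sup>2)" for x
  proof -
    have "(norm x)\<^sup>2 \<le> B * (\<Sum>n. (norm (projection n x))\<^sup>2)"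
    proof (rule LIMSEQ_le_const2)
      show "(\<lambda>m. (norm (\<Sum>n<m. projection n x))\<^sup>2) \<longlonglongrightarrow> (norm x)\<^sup>2"
        using projection_sums[of x] unfolding sums_def by (intro tendsto_intros)
      have "(norm (\<Sum>n<m. projection n x))\<^sup>2 \<le> B * (\<Sum>n. (norm (projection n x))\<^sup>2)" for m
        using B(2)[of "{..<m}" x] mult_left_mono[OF sum_le_suminf[OF summ[of x], of "{..<m}"] B(1)] by simp
      then show "\<exists>N. \<forall>m\<ge>N. (norm (\<Sum>n<m. projection n x))\<^sup>2 \<le> B * (\<Sum>n. (norm (projection n x))\<^sup>2)"
        by blast
    qed
    also have "\<dots> \<le> (B + 1) * (\<Sum>n. (norm (projection n x))\<^sup>2)"
      by (intro mult_right_mono suminf_nonneg summ) auto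
    finally show ?thesis
      using B(1) by (simp add: divide_le_eq mult.commute)
  qed
  have pos: "1 / (B + 1) > 0" "C + 1 > 0"
    using B(1) C(1) by auto
  have "\<exists>M\<^sub>1>0. \<forall>x. summable (\<lambda>n. (norm (projection n x))\<^sup>2) \<and>
      1 / (B + 1) * (norm x)\<^sup>2 \<le> (\<Sum>n. (norm (projection n x))\<^sup>2) \<and>
      (\<Sum>n. (norm (projection n x))\<^sup>2) \<le> M\<^sub>1 * (norm x)\<^sup>2"
    using pos(2) summ lower upper by blast
  then show ?thesis
    unfolding riesz_family_def using pos(1) projection_bounded_clinear projection_idempotent by blast
qed

end

theorem theorem1p6:
  fixes T :: "real \<Rightarrow> 'a::complex_hilbert_space \<Rightarrow> 'a"
    and D :: "'a set" and A :: "'a \<Rightarrow> 'a"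
    and lam :: "nat \<Rightarrow> complex" and K :: nat
  assumes "C0_group T" and "is_generator T D A"
    and "lists_eigenvalues D A lam"
    and "K > 0"
    and "closure (cspan (\<Union>\<mu>. gen_eigenvectors D A \<mu>)) = UNIV"
    and "\<exists>S :: nat \<Rightarrow> nat set. disjoint_family_on S {..<K} \<and> (\<Union>k<K. S k) = UNIV \<and>
           (\<forall>k<K. uniform_gap lam (S k))"
  shows "\<exists>P :: nat \<Rightarrow> 'a \<Rightarrow> 'a.
           (\<forall>n. \<exists>\<sigma>. is_spectral_projection D A \<sigma> (P n)) \<and>
           (\<forall>x. (\<lambda>n. P n x) sums x) \<and>
           (\<forall>n. cfinite_dim (range (P n)) \<and> cdim (range (P n)) \<le> K) \<and>
           riesz_family P"
proof -
  obtain S :: "nat \<Rightarrow> nat set" where S: "(\<Union>k<K. S k) = UNIV" "\<forall>k<K. uniform_gap lam (S k)"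
    using assms(6) by blast
  obtain g where g: "g > 0" "\<forall>k<K. \<forall>n\<in>S k. \<forall>m\<in>S k. n \<noteq> m \<longrightarrow> g \<le> cmod (lam n - lam m)"
    using common_gap[of K lam S] S(2) by blast
  have "\<forall>n. \<exists>k<K. n \<in> S k"
    using S(1) by blast
  then obtain c where c: "\<And>n. c n < K" "\<And>n. n \<in> S (c n)"
    by metis
  interpret group_generator T D A
    using assms(1,2) by unfold_locales
  obtain M a where "group_with_constants T D A M a"
    using constants_exist by blast
  then interpret group_with_constants T D A M a .
  interpret complete_eigen_system T D A M a lam g K c
  proof
    show "g \<le> cmod (lam n - lam m)" if "c n = c m" "n \<noteq> m" for n m
      using g(2) c that by metis
  qed (use assms g c in auto)
  show ?thesis
    using spectral_projection projection_sums range_projection projection_riesz_family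
    by (intro exI[of _ projection]) auto
qed

end
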